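(* Let $n\ge1$ and $\delta>0$. Let $f\in H^{s_1}(\mathbf{T}^n)$ and $g\in H^{s_2}(\mathbf{T}^n)$ for some $s_1,s_2\in\mathbb{R}$. For $\beta<n+4$ and $t\ge0$ let $U^{\delta,\beta}(t)$ be the solution of the nonlocal wave equation $\frac{d^2}{dt^2}U=L^{\delta,\beta}U$, $U(0)=f$, $\frac{d}{dt}U(0)=g$, given by $$U^{\delta,\beta}(t)=(\hat f_0+\hat g_0t)+\sum_{0\ne k\in\mathbb{Z}^n}\left[\hat f_k\cos(\sqrt{-m_k}\,t)+\frac{\hat g_k}{\sqrt{-m_k}}\sin(\sqrt{-m_k}\,t)\right]e^{ik\cdot x}\in H^{s'}(\mathbf{T}^n),$$ and let $U^0(t)$ be the solution of the local wave equation $\frac{d^2}{dt^2}U^0=\Delta U^0$, $U^0(0)=f$, $\frac{d}{dt}U^0(0)=g$, given by $$U^0(t)=(\hat f_0+\hat g_0t)+\sum_{0\ne k\in\mathbb{Z}^n}\left[\hat f_k\cos(\|k\|t)+\frac{\hat g_k}{\|k\|}\sin(\|k\|t)\right]e^{ik\cdot x}\in H^{s}(\mathbf{T}^n),$$ where $s=\min\{s_1,s_2+1\}$ and $s'=\min\{s_1,s_2+\theta\}$ with $\theta=\max\{0,\frac{\beta-n}{2}\}$. Then, for any $t\ge0$ and for any $\varepsilon\in(0,2)$ with $\varepsilon<n/2$, $$\lim_{\beta\to n+2}U^{\delta,\beta}(t)=U^0(t)\quad\text{in }H^{s_0}(\mathbf{T}^n),$$ where $s_0=\min\left\{s_1,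s_2+\frac{2-\varepsilon}{2}\right\}$.
   Context: For $k\in\mathbb{Z}^n$, $m_k=m^{\delta,\beta}(k)$, where for $\nu\in\mathbb{R}^n$ $$m^{\delta,\beta}(\nu)=-\|\nu\|^2\,{}_2F_3\!\left(1,\tfrac{n+2-\beta}{2};2,\tfrac{n+2}{2},\tfrac{n+4-\beta}{2};-\tfrac14\|\nu\|^2\delta^2\right),$$ ${}_2F_3(a_1,a_2;b_1,b_2,b_3;z)=\sum_{j\ge0}\frac{(a_1)_j(a_2)_j}{(b_1)_j(b_2)_j(b_3)_j}\frac{z^j}{j!}$, $(a)_j=a(a+1)\cdots(a+j-1)$. For $\beta<n+4$ one has $m_k<0$ for all $k\neq0$. The nonlocal Laplacian acts on periodic distributions by $L^{\delta,\beta}\big(\sum_k\hat T_ke^{ik\cdot x}\big)=\sum_km_k\hat T_ke^{ik\cdot x}$. $\mathbf{T}^n=\prod_{j=1}^n[0,2\pi]$ is the periodic torus; a periodic distribution $g$ is written $g=\sum_{k\in\mathbb{Z}^n}\hat g_ke^{ik\cdot x}$ with Fourier coefficients $\hat g_k$; for $q\in\mathbb{R}$, $H^q(\mathbf{T}^n)$ is the space of periodic distributions with $\|g\|_{H^q(\mathbf{T}^n)}^2=\sum_{k\in\mathbb{Z}^n}(1+\|k\|^2)^q|\hat g_k|^2<\infty$. The limit $\beta\to n+2$ is two-sided. *)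

theory Defs
  imports "HOL-Analysis.Analysis"
begin

definition partial_deriv :: "'n::finite \<Rightarrow> (real^'n \<Rightarrow> complex) \<Rightarrow> real^'n \<Rightarrow> complex" where
  "partial_deriv i \<phi> x = frechet_derivative \<phi> (at x) (axis i 1)"

definition iter_partial :: "'n::finite list \<Rightarrow> (real^'n \<Rightarrow> complex) \<Rightarrow> real^'n \<Rightarrow> complex" where
  "iter_partial is \<phi> = foldr partial_deriv is \<phi>"

text \<open>Smooth functions on the torus are the smooth functions on the whole space that are
  \<open>2\<pi>\<close>-periodic in every coordinate.\<close>

definition test_function :: "(real^'n::finite \<Rightarrow> complex) \<Rightarrow> bool" where
  "test_function \<phi> \<longleftrightarrow>
     (\<forall>is. iter_partial is \<phi> differentiable_on UNIV) \<and>
     (\<forall>x i. \<phi> (x + axis i (2 * pi)) = \<phi> x)"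

text \<open>A periodic distribution is a linear functional on the test functions that is continuous, i.e.
  bounded by some \<open>C\<^sup>N\<close>-norm. Functionals are total functions here, but only their values on
  test functions matter.\<close>

type_synonym 'n pdist = "(real^'n \<Rightarrow> complex) \<Rightarrow> complex"

definition periodic_distribution :: "'n::finite pdist \<Rightarrow> bool" where
  "periodic_distribution T \<longleftrightarrow>
     (\<forall>\<phi> \<psi>. test_function \<phi> \<longrightarrow> test_function \<psi> \<longrightarrow> T (\<lambda>x. \<phi> x + \<psi> x) = T \<phi> + T \<psi>) \<and>
     (\<forall>c \<phi>. test_function \<phi> \<longrightarrow> T (\<lambda>x. c * \<phi> x) = c * T \<phi>) \<and>
     (\<exists>(C::real) (N::nat). \<forall>\<phi> B. test_function \<phi> \<longrightarrow>
        (\<forall>is x. length is \<le> N \<longrightarrow> norm (iter_partial is \<phi> x) \<le> B) \<longrightarrow> norm (T \<phi>) \<le> C * B)"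

definition real_vec :: "int^'n::finite \<Rightarrow> real^'n" where
  "real_vec k = (\<chi> i. real_of_int (k $ i))"

definition echar :: "int^'n::finite \<Rightarrow> real^'n \<Rightarrow> complex" where
  "echar k x = cis (real_vec k \<bullet> x)"

definition fourier_coeff :: "'n::finite pdist \<Rightarrow> int^'n \<Rightarrow> complex" where
  "fourier_coeff T k = T (echar (- k)) / of_real ((2 * pi) ^ CARD('n))"

text \<open>The distribution \<open>\<Sum>\<^sub>k c\<^sub>k e\<^bsup>ik\<cdot>x\<^esup>\<close>, the function \<open>e\<^bsup>ik\<cdot>x\<^esup>\<close> being identified with
  integration against it over the torus. The sum over \<open>k\<close> converges absolutely for every test
  function when \<open>c\<close> grows at most polynomially.\<close>

definition fourier_series :: "(int^'n::finite \<Rightarrow> complex) \<Rightarrow> 'n pdist" where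
  "fourier_series c \<phi> =
     (\<Sum>\<^sub>\<infinity>k. c k * integral (cbox 0 (\<chi> i. 2 * pi)) (\<lambda>x. echar k x * \<phi> x))"

definition sobolev_weight :: "real \<Rightarrow> 'n::finite pdist \<Rightarrow> int^'n \<Rightarrow> real" where
  "sobolev_weight q T k =
     (1 + (norm (real_vec k))\<^sup>2) powr q * (norm (fourier_coeff T k))\<^sup>2"

definition sobolev_space :: "real \<Rightarrow> 'n::finite pdist set" where
  "sobolev_space q = {T. periodic_distribution T \<and> sobolev_weight q T summable_on UNIV}"

definition sobolev_norm :: "real \<Rightarrow> 'n::finite pdist \<Rightarrow> real" where
  "sobolev_norm q T = sqrt (\<Sum>\<^sub>\<infinity>k. sobolev_weight q T k)"

text \<open>The membership conditions keep \<^const>\<open>sobolev_norm\<close> away from non-summable families, where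
  \<^const>\<open>infsum\<close> is \<open>0\<close>.\<close>

definition tendsto_sobolev ::
    "real \<Rightarrow> ('b \<Rightarrow> 'n::finite pdist) \<Rightarrow> 'n pdist \<Rightarrow> 'b filter \<Rightarrow> bool" where
  "tendsto_sobolev q F T \<F> \<longleftrightarrow>
     T \<in> sobolev_space q \<and> (\<forall>\<^sub>F b in \<F>. F b \<in> sobolev_space q) \<and>
     ((\<lambda>b. sobolev_norm q (\<lambda>\<phi>. F b \<phi> - T \<phi>)) \<longlongrightarrow> 0) \<F>"

definition hyp2F3 :: "real \<Rightarrow> real \<Rightarrow> real \<Rightarrow> real \<Rightarrow> real \<Rightarrow> real \<Rightarrow> real" where
  "hyp2F3 a1 a2 b1 b2 b3 z =
     (\<Sum>j. pochhammer a1 j * pochhammer a2 j /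
           (pochhammer b1 j * pochhammer b2 j * pochhammer b3 j) * (z ^ j / fact j))"

definition multiplier :: "real \<Rightarrow> real \<Rightarrow> real^'n::finite \<Rightarrow> real" where
  "multiplier \<delta> \<beta> \<nu> =
     - (norm \<nu>)\<^sup>2 *
       hyp2F3 1 ((real CARD('n) + 2 - \<beta>) / 2)
         2 ((real CARD('n) + 2) / 2) ((real CARD('n) + 4 - \<beta>) / 2)
         (- (1 / 4) * (norm \<nu>)\<^sup>2 * \<delta>\<^sup>2)"

definition nonlocal_laplacian :: "real \<Rightarrow> real \<Rightarrow> 'n::finite pdist \<Rightarrow> 'n pdist" where
  "nonlocal_laplacian \<delta> \<beta> T =
     fourier_series (\<lambda>k. of_real (multiplier \<delta> \<beta> (real_vec k)) * fourier_coeff T k)"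

definition laplacian :: "'n::finite pdist \<Rightarrow> 'n pdist" where
  "laplacian T \<phi> = T (\<lambda>x. \<Sum>i\<in>UNIV. partial_deriv i (partial_deriv i \<phi>) x)"

text \<open>Solutions of \<open>U'' = A U\<close>, \<open>U(0) = f\<close>, \<open>U'(0) = g\<close> on \<open>t \<ge> 0\<close>, where the time derivatives
  are taken in the space of periodic distributions, i.e. after pairing with each test function.\<close>

definition wave_solution ::
    "('n::finite pdist \<Rightarrow> 'n pdist) \<Rightarrow> 'n pdist \<Rightarrow> 'n pdist \<Rightarrow> (real \<Rightarrow> 'n pdist) \<Rightarrow> bool" where
  "wave_solution A f g U \<longleftrightarrow>
     (\<exists>V. (\<forall>t\<ge>0. periodic_distribution (U t) \<and> periodic_distribution (V t)) \<and>
       (\<forall>\<phi>. test_function \<phi> \<longrightarrow>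
          (\<forall>t\<ge>0. ((\<lambda>\<tau>. U \<tau> \<phi>) has_vector_derivative V t \<phi>) (at t within {0..}) \<and>
                 ((\<lambda>\<tau>. V \<tau> \<phi>) has_vector_derivative A (U t) \<phi>) (at t within {0..})) \<and>
          U 0 \<phi> = f \<phi> \<and> V 0 \<phi> = g \<phi>))"

definition unique_wave_solution ::
    "('n::finite pdist \<Rightarrow> 'n pdist) \<Rightarrow> 'n pdist \<Rightarrow> 'n pdist \<Rightarrow> (real \<Rightarrow> 'n pdist) \<Rightarrow> bool" where
  "unique_wave_solution A f g U \<longleftrightarrow>
     wave_solution A f g U \<and>
     (\<forall>V. wave_solution A f g V \<longrightarrow> (\<forall>t\<ge>0. \<forall>\<phi>. test_function \<phi> \<longrightarrow> V t \<phi> = U t \<phi>))"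

definition nonlocal_wave ::
    "real \<Rightarrow> real \<Rightarrow> 'n::finite pdist \<Rightarrow> 'n pdist \<Rightarrow> real \<Rightarrow> 'n pdist" where
  "nonlocal_wave \<delta> \<beta> f g t = fourier_series (\<lambda>k.
     if k = 0 then fourier_coeff f 0 + fourier_coeff g 0 * of_real t
     else let \<omega> = sqrt (- multiplier \<delta> \<beta> (real_vec k)) in
       fourier_coeff f k * of_real (cos (\<omega> * t)) +
       fourier_coeff g k / of_real \<omega> * of_real (sin (\<omega> * t)))"

definition local_wave :: "'n::finite pdist \<Rightarrow> 'n pdist \<Rightarrow> real \<Rightarrow> 'n pdist" where
  "local_wave f g t = fourier_series (\<lambda>k.
     if k = 0 then fourier_coeff f 0 + fourier_coeff g 0 * of_real t
     else let \<omega> = norm (real_vec k) in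
       fourier_coeff f k * of_real (cos (\<omega> * t)) +
       fourier_coeff g k / of_real \<omega> * of_real (sin (\<omega> * t)))"

end

theory Submission
  imports Defs
begin

text \<open>On the \<open>k\<close>-th Fourier mode both wave equations are the harmonic oscillator
  \<open>c'' = - \<omega>\<^sub>k\<^sup>2 c\<close>, so a solution is determined mode by mode once every periodic distribution is known
  to be the sum of its Fourier series. With \<open>a = (n + 2 - \<beta>) / 2\<close> and \<open>y = \<parallel>k\<parallel>\<^sup>2 \<delta>\<^sup>2 / 4\<close>
  one has \<open>\<omega>\<^sub>k\<^sup>2 = - m\<^sub>k = \<parallel>k\<parallel>\<^sup>2 F\<^sub>a y\<close>, where \<open>y F\<^sub>a' + a F\<^sub>a = a G\<close> for a function \<open>0 \<le> G \<le> 1\<close> built from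
  a Bessel function. Hence \<open>y\<^sup>a F\<^sub>a\<close> and \<open>y\<^sup>a (F\<^sub>a - 1)\<close> are monotone. This yields \<open>m\<^sub>k < 0\<close>, the growth
  \<open>- m\<^sub>k \<ge> c \<parallel>k\<parallel>\<^bsup>2\<theta>\<^esup>\<close> that gives the Sobolev regularity, and, since \<open>F\<^sub>a \<longrightarrow> 1\<close> as \<open>a \<longrightarrow> 0\<close>, the
  bound \<open>- m\<^sub>k \<ge> c \<parallel>k\<parallel>\<^bsup>2 - \<epsilon>\<^esup>\<close> uniformly in \<open>\<beta>\<close> near \<open>n + 2\<close>, which dominates the series of the
  squared Sobolev norm in the limit.\<close>

subsection \<open>The profile of the multiplier\<close>

text \<open>The bounds 0 <= G <= 1 rest on the energy w^2 + y w'^2 of the Bessel-type function w,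
  which does not increase because b = n/2 >= 1/2. Monotonicity alone settles the growth for a < 1.
  For a > 1, where theta = 0, it would only give y F_a >= c y^(1-a), which decays, so the
  oscillation of w is averaged out over [y/2, y]. The limit is two-sided, and F_a tends to 1 at each
  fixed y with an error bound that grows like exp y, so a separate uniform lower bound is required.
  For a <= 0 one has F_a >= 1. For a > 0, that is beta < n + 2, the lower bound on -m_k is only of
  order ||k||^(2-2a), and the loss epsilon in s_0 absorbs 2a. The mode k = 0 obeys the same formulas
  once sin(omega t)/omega is read as t at omega = 0.\<close>

definition bessel_coeff :: "real \<Rightarrow> nat \<Rightarrow> real" where
  "bessel_coeff b j = (-1) ^ j / (fact j * pochhammer b j)"

text \<open>This is 0F1(; b; -y), equal to Gamma(b) y^((1-b)/2) J_(b-1)(2 sqrt y) for y > 0. With b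
  = n/2 it is the Fourier transform of the uniform probability measure on the unit sphere at radius
  2 sqrt y; b = 1/2 gives cos(2 sqrt y). In the variable y it is entire.\<close>

definition bessel :: "real \<Rightarrow> real \<Rightarrow> real" where
  "bessel b y = (\<Sum>j. bessel_coeff b j * y ^ j)"

lemma min_le_pochhammer:
  fixes b :: real
  assumes "b > 0"
  shows "min 1 b \<le> pochhammer b j"
proof (cases j)
  case (Suc i)
  have "1 \<le> pochhammer (b + 1) i"
  proof (induction i)
    case (Suc i)
    have "1 * 1 \<le> pochhammer (b + 1) i * (b + 1 + real i)"
      using Suc assms by (intro mult_mono) auto
    then show ?case by (simp add: pochhammer_Suc)
  qed simp
  then have "b * 1 \<le> b * pochhammer (b + 1) i"
    using assms by (intro mult_left_mono) auto
  then show ?thesis using Suc by (simp add: pochhammer_rec)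
qed simp

lemma summable_of_fact_bound:
  fixes c :: "nat \<Rightarrow> real"
  assumes "\<And>j. \<bar>c j\<bar> \<le> C / fact j"
  shows "summable (\<lambda>j. c j * y ^ j)"
proof (rule summable_comparison_test)
  show "\<exists>N. \<forall>n\<ge>N. norm (c n * y ^ n) \<le> C * (inverse (fact n) * \<bar>y\<bar> ^ n)"
  proof (intro exI allI impI)
    fix n :: nat
    have "norm (c n * y ^ n) = \<bar>c n\<bar> * \<bar>y\<bar> ^ n"
      by (simp add: abs_mult power_abs)
    also have "\<dots> \<le> C / fact n * \<bar>y\<bar> ^ n"
      using assms by (intro mult_right_mono) auto
    finally show "norm (c n * y ^ n) \<le> C * (inverse (fact n) * \<bar>y\<bar> ^ n)"
      by (simp add: field_simps)
  qed
  show "summable (\<lambda>n. C * (inverse (fact n) * \<bar>y\<bar> ^ n))"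
    using summable_exp[of "\<bar>y\<bar>"] by (intro summable_mult) simp
qed

lemma summable_bessel:
  assumes "b > 0"
  shows "summable (\<lambda>j. bessel_coeff b j * y ^ j)"
proof (rule summable_of_fact_bound)
  fix j :: nat
  have "min 1 b \<le> pochhammer b j" "min 1 b > 0" using assms min_le_pochhammer by auto
  then have "\<bar>bessel_coeff b j\<bar> = 1 / (fact j * pochhammer b j)"
    by (simp add: bessel_coeff_def abs_mult)
  also have "\<dots> \<le> 1 / (fact j * min 1 b)"
    using \<open>min 1 b \<le> pochhammer b j\<close> \<open>min 1 b > 0\<close>
    by (intro divide_left_mono mult_left_mono mult_pos_pos) auto
  also have "\<dots> = (1 / min 1 b) / fact j" by simp
  finally show "\<bar>bessel_coeff b j\<bar> \<le> (1 / min 1 b) / fact j" .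
qed

lemma bessel_0 [simp]: "bessel b 0 = 1"
  unfolding bessel_def
  by (subst powser_zero) (simp add: bessel_coeff_def)

lemma diffs_bessel_coeff:
  assumes "b > 0"
  shows "diffs (bessel_coeff b) j = - 1 / b * bessel_coeff (b + 1) j"
proof -
  have "pochhammer (b + 1) j > 0" using assms by (simp add: pochhammer_pos)
  moreover have "fact (Suc j) = (1 + real j) * fact j" by simp
  ultimately show ?thesis using assms
    unfolding diffs_def bessel_coeff_def pochhammer_rec by (simp add: divide_simps)
qed

lemma DERIV_bessel:
  assumes "b > 0"
  shows "(bessel b has_real_derivative - bessel (b + 1) y / b) (at y)"
proof -
  have "((\<lambda>x. \<Sum>j. bessel_coeff b j * x ^ j) has_real_derivative
      (\<Sum>j. diffs (bessel_coeff b) j * y ^ j)) (at y)"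
    by (intro termdiffs_strong_converges_everywhere summable_bessel assms)
  moreover have "(\<Sum>j. diffs (bessel_coeff b) j * y ^ j) = - 1 / b * bessel (b + 1) y"
    unfolding bessel_def diffs_bessel_coeff[OF assms] mult.assoc
    using assms by (intro suminf_mult summable_bessel) auto
  ultimately show ?thesis by (simp add: bessel_def[abs_def])
qed

text \<open>For w = \<open>bessel b\<close> this is the differential equation y w'' + b w' + w = 0,
  since each derivative raises the parameter by one. It is proved by comparing coefficients.\<close>

lemma bessel_recurrence:
  assumes b: "b > 0"
  shows "b * (b + 1) * bessel b y = b * (b + 1) * bessel (b + 1) y - y * bessel (b + 2) y"
proof -
  have s: "(\<lambda>j. bessel_coeff b j * y ^ j) sums bessel b y" if "b > 0" for b
    unfolding bessel_def using summable_bessel[OF that] by (rule summable_sums)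
  have "(\<lambda>j. y * (bessel_coeff (b + 2) j * y ^ j)) sums (y * bessel (b + 2) y)"
    using b by (intro sums_mult s) auto
  \<comment> \<open>Multiplication by y shifts the series by one place; the missing term of index 0
    is filled with 0 so that the series can be compared index by index.\<close>
  then have "(\<lambda>j. case j of 0 \<Rightarrow> 0 | Suc j \<Rightarrow> y * (bessel_coeff (b + 2) j * y ^ j)) sums (y * bessel (b + 2) y)"
    using sums_Suc[of "\<lambda>j. case j of 0 \<Rightarrow> 0 | Suc j \<Rightarrow> y * (bessel_coeff (b + 2) j * y ^ j)"] by simp
  then have "(\<lambda>j. b * (b + 1) * (bessel_coeff (b + 1) j * y ^ j) -
      (case j of 0 \<Rightarrow> 0 | Suc j \<Rightarrow> y * (bessel_coeff (b + 2) j * y ^ j))) sums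
      (b * (b + 1) * bessel (b + 1) y - y * bessel (b + 2) y)"
    using b by (intro sums_diff sums_mult s) auto
  moreover have "b * (b + 1) * (bessel_coeff (b + 1) j * y ^ j) -
      (case j of 0 \<Rightarrow> 0 | Suc j \<Rightarrow> y * (bessel_coeff (b + 2) j * y ^ j)) =
      b * (b + 1) * (bessel_coeff b j * y ^ j)" for j
  proof (cases j)
    case 0
    then show ?thesis by (simp add: bessel_coeff_def)
  next
    case (Suc i)
    define P where "P = pochhammer (b + 2) i"
    have P: "P > 0" using b by (simp add: pochhammer_pos P_def)
    have 1: "pochhammer (b + 1) (Suc i) = (b + 1) * P"
      by (simp add: pochhammer_rec P_def add.assoc)
    have "pochhammer b (Suc i) * (b + real (Suc i)) = pochhammer b (Suc (Suc i))"
      by (simp add: pochhammer_Suc)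
    also have "\<dots> = b * (b + 1) * P"
      by (simp add: pochhammer_rec P_def add.assoc)
    finally have 2: "pochhammer b (Suc i) = b * (b + 1) * P / (b + real (Suc i))"
      using b by (simp add: field_simps)
    have f: "fact (Suc i) = (1 + real i) * fact i" by simp
    have "b * (b + 1) * bessel_coeff (b + 1) j - bessel_coeff (b + 2) i = b * (b + 1) * bessel_coeff b j"
      unfolding bessel_coeff_def Suc 1 2 f P_def[symmetric]
      using b P by (simp add: divide_simps) (simp add: algebra_simps)
    then have "(b * (b + 1) * bessel_coeff (b + 1) j - bessel_coeff (b + 2) i) * y ^ j = 
         b * (b + 1) * bessel_coeff b j * y ^ j" by simp
    then show ?thesis unfolding Suc by (simp add: algebra_simps)
  qed
  ultimately have "(\<lambda>j. b * (b + 1) * (bessel_coeff b j * y ^ j)) sums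
      (b * (b + 1) * bessel (b + 1) y - y * bessel (b + 2) y)" by simp
  moreover have "(\<lambda>j. b * (b + 1) * (bessel_coeff b j * y ^ j)) sums (b * (b + 1) * bessel b y)"
    using b by (intro sums_mult s) auto
  ultimately show ?thesis by (rule sums_unique2[symmetric])
qed

text \<open>Since w' = - \<open>bessel (b + 1)\<close> / b, the left side is w^2 + y w'^2. By the
  differential equation its derivative is (1 - 2b) w'^2, which is nonpositive for b >= 1/2, and its
  value at 0 is 1.\<close>

lemma bessel_energy_le:
  assumes b: "b \<ge> 1 / 2" and y: "y \<ge> 0"
  shows "(bessel b y)\<^sup>2 + y * (bessel (b + 1) y)\<^sup>2 / b\<^sup>2 \<le> 1"
proof -
  let ?E = "\<lambda>y. (bessel b y)\<^sup>2 + y * (bessel (b + 1) y)\<^sup>2 / b\<^sup>2"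
  have "?E y \<le> ?E 0"
  proof (rule DERIV_nonpos_imp_nonincreasing[OF y])
    fix x :: real assume "0 \<le> x"
    let ?u = "bessel b x" and ?v = "bessel (b + 1) x" and ?w = "bessel (b + 2) x"
    have w: "x * ?w = b * (b + 1) * (?v - ?u)"
      using bessel_recurrence[of b x] b by (simp add: algebra_simps)
    have d: "(bessel b has_real_derivative - ?v / b) (at x)"
      "(bessel (b + 1) has_real_derivative - ?w / (b + 1)) (at x)"
      using DERIV_bessel[of b x] DERIV_bessel[of "b + 1" x] b by (simp_all add: add.assoc)
    have "2 * ?u * (- ?v / b) + (?v\<^sup>2 + x * (2 * ?v * (- ?w / (b + 1)))) / b\<^sup>2 =
        2 * ?u * (- ?v / b) + (?v\<^sup>2 - 2 * ?v * (x * ?w) / (b + 1)) / b\<^sup>2"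
      by (simp add: field_simps)
    also have "\<dots> = 2 * ?u * (- ?v / b) + (?v\<^sup>2 - 2 * ?v * b * (?v - ?u)) / b\<^sup>2"
    proof -
      have "2 * ?v * (b * (b + 1) * (?v - ?u)) / (b + 1) = 2 * ?v * b * (?v - ?u)"
        using b by simp
      then show ?thesis unfolding w by (rule arg_cong)
    qed
    also have "\<dots> = (1 - 2 * b) * ?v\<^sup>2 / b\<^sup>2"
      using b by (simp add: field_simps power2_eq_square)
    finally have "2 * ?u * (- ?v / b) + (?v\<^sup>2 + x * (2 * ?v * (- ?w / (b + 1)))) / b\<^sup>2 \<le> 0"
      using b by (simp add: divide_nonpos_nonneg mult_nonpos_nonneg)
    moreover have "(?E has_real_derivative
        2 * ?u * (- ?v / b) + (?v\<^sup>2 + x * (2 * ?v * (- ?w / (b + 1)))) / b\<^sup>2) (at x)"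
    proof (intro DERIV_add DERIV_cdivide)
      show "((\<lambda>x. (bessel b x)\<^sup>2) has_real_derivative 2 * ?u * (- ?v / b)) (at x)"
        by (auto intro!: derivative_eq_intros d)
      show "((\<lambda>x. x * (bessel (b + 1) x)\<^sup>2) has_real_derivative
          ?v\<^sup>2 + x * (2 * ?v * (- ?w / (b + 1)))) (at x)"
        by (auto intro!: derivative_eq_intros d)
    qed
    ultimately show "\<exists>d. (?E has_real_derivative d) (at x) \<and> d \<le> 0" by (intro exI conjI) auto
  qed
  then show ?thesis by simp
qed

lemma abs_bessel_le_1:
  assumes "b \<ge> 1 / 2" "y \<ge> 0"
  shows "\<bar>bessel b y\<bar> \<le> 1"
proof -
  have "(bessel b y)\<^sup>2 + y * (bessel (b + 1) y)\<^sup>2 / b\<^sup>2 \<ge> (bessel b y)\<^sup>2 + 0"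
    using assms by (intro add_left_mono) auto
  then have "(bessel b y)\<^sup>2 \<le> 1" using bessel_energy_le[OF assms] by linarith
  then show ?thesis by (simp add: abs_square_le_1)
qed

text \<open>The derivative half of the energy bound, y |w'| <= sqrt y. It makes the antiderivative
  of w of lower order than y.\<close>

lemma abs_bessel_Suc_le:
  assumes "b \<ge> 1 / 2" "y > 0"
  shows "y * \<bar>bessel (b + 1) y\<bar> / b \<le> sqrt y"
proof -
  let ?v = "bessel (b + 1) y"
  have "y * ?v\<^sup>2 / b\<^sup>2 \<le> (bessel b y)\<^sup>2 + y * ?v\<^sup>2 / b\<^sup>2" by simp
  also have "\<dots> \<le> 1" using bessel_energy_le assms by simp
  finally have "y * (y * ?v\<^sup>2 / b\<^sup>2) \<le> y * 1"
    using assms by (intro mult_left_mono) auto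
  then have "(y * \<bar>?v\<bar> / b)\<^sup>2 \<le> y"
    by (simp add: power_mult_distrib power_divide power2_eq_square algebra_simps)
  then show ?thesis by (rule real_le_rsqrt)
qed

text \<open>The slope of w is at least -1/b because the energy bound also holds for the parameter b
  + 1.\<close>

lemma bessel_ge:
  assumes b: "b \<ge> 1 / 2" and y: "y \<ge> 0"
  shows "1 - y / b \<le> bessel b y"
proof -
  have "bessel b 0 + 0 / b \<le> bessel b y + y / b"
  proof (rule DERIV_nonneg_imp_nondecreasing[OF y])
    fix x :: real assume "0 \<le> x"
    have "((\<lambda>y. bessel b y + y / b) has_real_derivative - bessel (b + 1) x / b + 1 / b) (at x)"
      using b by (auto intro!: derivative_eq_intros DERIV_bessel)
    moreover have "- bessel (b + 1) x / b + 1 / b \<ge> 0"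
      using abs_bessel_le_1[of "b + 1" x] \<open>0 \<le> x\<close> b by (simp add: field_simps abs_le_iff)
    ultimately show "\<exists>d. ((\<lambda>y. bessel b y + y / b) has_real_derivative d) (at x) \<and> d \<ge> 0" by metis
  qed
  then show ?thesis by simp
qed

text \<open>In the application \<open>b = n / 2\<close>, \<open>a = (n + 2 - \<beta>) / 2\<close> and
  \<open>y = \<parallel>\<nu>\<parallel>\<^sup>2 \<delta>\<^sup>2 / 4\<close>. The Euler equation \<open>y F' + a F = b a (1 - w) / y\<close>, where \<open>w\<close> is the Bessel-type
  function above, replaces the integral representation, which is available for \<open>a > 0\<close> only.\<close>

definition profile_coeff :: "real \<Rightarrow> real \<Rightarrow> nat \<Rightarrow> real" where
  "profile_coeff b a j =
     (-1) ^ j / (fact (Suc j) * pochhammer (b + 1) j) * (if j = 0 then 1 else a / (a + real j))"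

definition profile :: "real \<Rightarrow> real \<Rightarrow> real \<Rightarrow> real" where
  "profile b a y = (\<Sum>j. profile_coeff b a j * y ^ j)"

text \<open>Here (1)_j cancels j!, (2)_j is (j+1)!, and (a)_j / (a+1)_j telescopes. The condition a
  > -1, which is beta < n + 4, keeps (a+1)_j away from 0.\<close>

lemma hyp2F3_eq_profile:
  assumes "a > -1"
  shows "hyp2F3 1 a 2 (b + 1) (a + 1) (- y) = profile b a y"
  unfolding hyp2F3_def profile_def
proof (rule suminf_cong)
  fix j
  have 2: "pochhammer (2 :: real) j = fact (Suc j)"
    using pochhammer_rec[of "1 :: real" j] by (simp add: pochhammer_fact[symmetric] del: fact_Suc)
  \<comment> \<open>The index 0 is kept apart because of a = 0: the ratio of empty products is 1,
    while a / (a + 0) would be 0 / 0 = 0.\<close>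
  have r: "pochhammer a j / pochhammer (a + 1) j = (if j = 0 then 1 else a / (a + real j))"
  proof (cases j)
    case (Suc i)
    have "pochhammer (a + 1) i > 0" using assms by (simp add: pochhammer_pos)
    then show ?thesis
      unfolding Suc pochhammer_rec[of a i] pochhammer_Suc[of "a + 1" i] by (simp add: add_ac)
  qed simp
  have "pochhammer 1 j * pochhammer a j / (pochhammer 2 j * pochhammer (b + 1) j * pochhammer (a + 1) j)
      * ((- y) ^ j / fact j) = (fact j / fact j) * (-1) ^ j / (fact (Suc j) * pochhammer (b + 1) j) *
      (pochhammer a j / pochhammer (a + 1) j) * y ^ j"
    unfolding 2 by (simp add: pochhammer_fact[symmetric] power_minus[of y] mult_ac del: fact_Suc)
  then show "pochhammer 1 j * pochhammer a j / (pochhammer 2 j * pochhammer (b + 1) j * pochhammer (a + 1) j)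
      * ((- y) ^ j / fact j) = profile_coeff b a j * y ^ j"
    unfolding r profile_coeff_def by simp
qed

text \<open>The factor a / (a + j) stays explicit because it is estimated in two ways: by a constant
  for summability, and by 2 |a| for the limit a -> 0.\<close>

lemma abs_profile_coeff_le:
  assumes b: "b > 0"
  shows "\<bar>profile_coeff b a j\<bar> \<le> \<bar>if j = 0 then 1 else a / (a + real j)\<bar> / fact j"
proof -
  have p: "pochhammer (b + 1) j \<ge> 1"
    using min_le_pochhammer[of "b + 1" j] b by simp
  have "\<bar>profile_coeff b a j\<bar> =
     \<bar>if j = 0 then 1 else a / (a + real j)\<bar> / (fact (Suc j) * pochhammer (b + 1) j)"
    unfolding profile_coeff_def abs_mult using p by (simp add: abs_mult del: fact_Suc)
  also have "\<dots> \<le> \<bar>if j = 0 then 1 else a / (a + real j)\<bar> / (fact j * 1)"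
    using p by (intro divide_left_mono mult_mono fact_mono mult_pos_pos) (auto simp del: fact_Suc)
  finally show ?thesis by simp
qed

lemma summable_profile:
  assumes b: "b > 0" and a: "a > -1"
  shows "summable (\<lambda>j. profile_coeff b a j * y ^ j)"
proof (rule summable_of_fact_bound)
  fix j :: nat
  have "\<bar>if j = 0 then 1 else a / (a + real j)\<bar> \<le> 1 + \<bar>a\<bar> / (a + 1)"
  proof (cases "j = 0")
    case False
    then have "\<bar>a / (a + real j)\<bar> = \<bar>a\<bar> / (a + real j)" using a by simp
    also have "\<dots> \<le> \<bar>a\<bar> / (a + 1)" using a False
      by (intro divide_left_mono mult_pos_pos) auto
    finally show ?thesis using False by simp
  qed (use a in auto)
  then show "\<bar>profile_coeff b a j\<bar> \<le> (1 + \<bar>a\<bar> / (a + 1)) / fact j"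
    using abs_profile_coeff_le[OF b, of a j] by (meson divide_right_mono fact_ge_zero order_trans)
qed

lemma profile_0 [simp]: "profile b a 0 = 1"
  unfolding profile_def by (subst powser_zero) (simp add: profile_coeff_def)

lemma profile_a_0: "profile b 0 y = 1"
proof -
  have "profile b 0 y = (\<Sum>j. if j = 0 then 1 else 0)"
    unfolding profile_def by (intro suminf_cong) (auto simp: profile_coeff_def)
  also have "\<dots> = 1" using suminf_finite[of "{0}" "\<lambda>j. if j = 0 then 1 else 0 :: real"] by simp
  finally show ?thesis .
qed

text \<open>The Euler operator y d/dy + a multiplies the j-th coefficient by j + a and so cancels
  the denominator of a / (a + j). What remains is a multiple of the Bessel series without its first
  term. The extra factor y keeps the identity valid at y = 0. The sign of F' at 0 decides on which
  side of 1 the profile starts.\<close>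

lemma DERIV_profile_ex:
  assumes b: "b > 0" and a: "a > -1"
  obtains F' where "\<And>y. (profile b a has_real_derivative F' y) (at y)"
    and "\<And>y. y * (y * F' y + a * profile b a y) = a * b * (1 - bessel b y)"
    and "F' 0 = - a / (2 * (b + 1) * (a + 1))"
proof
  let ?c = "profile_coeff b a"
  let ?F' = "\<lambda>y. \<Sum>j. diffs ?c j * y ^ j"
  note sm = summable_profile[OF b a]
  show "(profile b a has_real_derivative ?F' y) (at y)" for y
    unfolding profile_def[abs_def] by (intro termdiffs_strong_converges_everywhere sm)
  show "?F' 0 = - a / (2 * (b + 1) * (a + 1))"
    by (subst powser_zero) (simp add: diffs_def profile_coeff_def)
  fix y :: real
  have "summable (\<lambda>j. diffs ?c j * y ^ j)"
    by (rule termdiff_converges_all[OF sm])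
  then have "(\<lambda>j. real j * ?c j * y ^ (j - Suc 0)) sums ?F' y"
    by (rule diffs_equiv)
  then have "(\<lambda>j. y * (y * (real j * ?c j * y ^ (j - Suc 0)) + a * (?c j * y ^ j))) sums
      (y * (y * ?F' y + a * profile b a y))"
    unfolding profile_def using sm by (intro sums_add sums_mult summable_sums)
  moreover have "y * (y * (real j * ?c j * y ^ (j - Suc 0)) + a * (?c j * y ^ j)) =
     - (a * b * (bessel_coeff b (Suc j) * y ^ Suc j))" for j
  proof -
    have "y * (real j * ?c j * y ^ (j - Suc 0)) = real j * ?c j * y ^ j"
      by (cases j) auto
    then have "y * (y * (real j * ?c j * y ^ (j - Suc 0)) + a * (?c j * y ^ j)) =
        ((real j + a) * ?c j) * y ^ Suc j" by (simp add: algebra_simps)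
    also have "(real j + a) * ?c j = a * ((-1) ^ j / (fact (Suc j) * pochhammer (b + 1) j))"
      using a by (auto simp: profile_coeff_def add.commute)
    also have "\<dots> = - (a * b * bessel_coeff b (Suc j))"
      unfolding bessel_coeff_def pochhammer_rec using b by (simp del: fact_Suc)
    finally show ?thesis by simp
  qed
  moreover have "(\<lambda>j. - (a * b * (bessel_coeff b (Suc j) * y ^ Suc j))) sums - (a * b * (bessel b y - 1))"
  proof (intro sums_minus sums_mult)
    have "(\<lambda>j. bessel_coeff b j * y ^ j) sums bessel b y"
      unfolding bessel_def by (rule summable_sums[OF summable_bessel[OF b]])
    then show "(\<lambda>j. bessel_coeff b (Suc j) * y ^ Suc j) sums (bessel b y - 1)"
      by (subst sums_Suc_iff) (simp add: bessel_coeff_def)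
  qed
  ultimately show "y * (y * ?F' y + a * profile b a y) = a * b * (1 - bessel b y)"
    by (auto dest: sums_unique2 simp: algebra_simps)
qed

text \<open>With the integrating factor y^a the Euler equation becomes (y^a (F - c))' = a y^(a-1) (G
  - c), where G = b (1 - w) / y. As 0 <= G <= 1, the derivative has the sign of a for c = 0 and the
  opposite sign for c = 1; the four monotonicity lemmas below are these cases.\<close>

lemma DERIV_powr_profile:
  assumes b: "b > 0" and a: "a > -1" and y: "y > 0"
  shows "((\<lambda>y. y powr a * (profile b a y - c)) has_real_derivative
    a * y powr (a - 1) * (b * (1 - bessel b y) / y - c)) (at y)"
proof -
  obtain F' where F': "\<And>y. (profile b a has_real_derivative F' y) (at y)"
    and e: "\<And>y. y * (y * F' y + a * profile b a y) = a * b * (1 - bessel b y)"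
    using DERIV_profile_ex[OF b a] by metis
  let ?F = "profile b a y"
  have p: "y powr a = y powr (a - 1) * y"
    using y by (simp add: powr_diff)
  have "((\<lambda>y. y powr a * (profile b a y - c)) has_real_derivative
      a * y powr (a - 1) * (?F - c) + y powr a * F' y) (at y)"
    using y by (auto intro!: derivative_eq_intros F')
  moreover have "y * F' y + a * ?F = a * b * (1 - bessel b y) / y"
    using e[of y] y by (simp add: field_simps)
  then have "a * y powr (a - 1) * (?F - c) + y powr a * F' y =
     y powr (a - 1) * (a * b * (1 - bessel b y) / y - a * c)"
    unfolding p by algebra
  ultimately show ?thesis by (simp add: algebra_simps)
qed

section \<open>Monotonicity, sign and growth of the profile\<close>

context
  fixes b a :: real
  assumes b: "b \<ge> 1 / 2" and a: "a > -1"
begin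

lemma bessel_ratio_bounds:
  assumes "y > 0"
  shows "0 \<le> b * (1 - bessel b y) / y" "b * (1 - bessel b y) / y \<le> 1"
proof -
  have "bessel b y \<le> 1" "1 - bessel b y \<le> y / b"
    using abs_bessel_le_1[OF b, of y] bessel_ge[OF b, of y] assms by (auto simp: abs_le_iff)
  then show "0 \<le> b * (1 - bessel b y) / y" "b * (1 - bessel b y) / y \<le> 1"
    using b assms by (simp_all add: pos_le_divide_eq pos_divide_le_eq mult.commute)
qed

lemma powr_profile_mono:
  assumes "0 \<le> a" "0 < x" "x \<le> y"
  shows "x powr a * profile b a x \<le> y powr a * profile b a y"
proof (rule DERIV_nonneg_imp_nondecreasing[OF assms(3)])
  fix z assume z: "x \<le> z"
  then have "z > 0" using assms by simp
  moreover from this have "a * z powr (a - 1) * (b * (1 - bessel b z) / z) \<ge> 0"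
    using assms(1) bessel_ratio_bounds[of z] by (intro mult_nonneg_nonneg) auto
  ultimately show "\<exists>d. ((\<lambda>y. y powr a * profile b a y) has_real_derivative d) (at z) \<and> d \<ge> 0"
    using DERIV_powr_profile[of b a z 0] a b by auto
qed

lemma powr_profile_antimono:
  assumes "a \<le> 0" "0 < x" "x \<le> y"
  shows "y powr a * profile b a y \<le> x powr a * profile b a x"
proof (rule DERIV_nonpos_imp_nonincreasing[OF assms(3)])
  fix z assume z: "x \<le> z"
  then have "z > 0" using assms by simp
  moreover from this have "a * z powr (a - 1) * (b * (1 - bessel b z) / z) \<le> 0"
    using assms(1) bessel_ratio_bounds[of z] by (intro mult_nonpos_nonneg) auto
  ultimately show "\<exists>d. ((\<lambda>y. y powr a * profile b a y) has_real_derivative d) (at z) \<and> d \<le> 0"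
    using DERIV_powr_profile[of b a z 0] a b by auto
qed

lemma powr_profile_minus_1_mono:
  assumes "a \<le> 0" "0 < x" "x \<le> y"
  shows "x powr a * (profile b a x - 1) \<le> y powr a * (profile b a y - 1)"
proof (rule DERIV_nonneg_imp_nondecreasing[OF assms(3)])
  fix z assume z: "x \<le> z"
  then have "z > 0" using assms by simp
  moreover from this have "a * z powr (a - 1) * (b * (1 - bessel b z) / z - 1) \<ge> 0"
    using assms(1) bessel_ratio_bounds[of z] by (intro mult_nonpos_nonpos) (auto simp: mult_le_0_iff)
  ultimately show "\<exists>d. ((\<lambda>y. y powr a * (profile b a y - 1)) has_real_derivative d) (at z) \<and> d \<ge> 0"
    using DERIV_powr_profile[of b a z 1] a b by auto
qed

lemma powr_profile_minus_1_antimono: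
  assumes "a \<ge> 0" "0 < x" "x \<le> y"
  shows "y powr a * (profile b a y - 1) \<le> x powr a * (profile b a x - 1)"
proof (rule DERIV_nonpos_imp_nonincreasing[OF assms(3)])
  fix z assume z: "x \<le> z"
  then have "z > 0" using assms by simp
  moreover from this have "a * z powr (a - 1) * (b * (1 - bessel b z) / z - 1) \<le> 0"
    using assms(1) bessel_ratio_bounds[of z] by (intro mult_nonneg_nonpos) auto
  ultimately show "\<exists>d. ((\<lambda>y. y powr a * (profile b a y - 1)) has_real_derivative d) (at z) \<and> d \<le> 0"
    using DERIV_powr_profile[of b a z 1] a b by auto
qed

lemma isCont_profile: "isCont (profile b a) y"
proof -
  have "b > 0" using b by simp
  then show ?thesis using DERIV_profile_ex[OF _ a] DERIV_isCont by metis
qed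

text \<open>Monotonicity of y^a (F - 1) only transports positivity to the right. The starting point
  x is taken so close to 0 that F x > F 0 = 1, because F'(0) > 0.\<close>

lemma profile_gt_1:
  assumes "a < 0" "y > 0"
  shows "profile b a y > 1"
proof -
  have "b > 0" using b by simp
  then obtain F' where "(profile b a has_real_derivative F' 0) (at 0)"
    "F' (0::real) = - a / (2 * (b + 1) * (a + 1))"
    using DERIV_profile_ex[OF _ a] by metis
  moreover have "- a / (2 * (b + 1) * (a + 1)) > 0"
    using a b assms by (intro divide_pos_pos mult_pos_pos) auto
  ultimately obtain d where d: "d > 0" "\<And>h. \<lbrakk>0 < h; h < d\<rbrakk> \<Longrightarrow> profile b a 0 < profile b a (0 + h)"
    using DERIV_pos_inc_right by metis
  define x where "x = min y (d / 2)"
  have x: "0 < x" "x \<le> y" "x < d" using d(1) assms by (auto simp: x_def)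
  then have "0 < x powr a * (profile b a x - 1)" using d(2)[of x] by simp
  also have "\<dots> \<le> y powr a * (profile b a y - 1)"
    using powr_profile_minus_1_mono x assms by simp
  finally show ?thesis using assms by (simp add: zero_less_mult_iff)
qed

lemma profile_le_1:
  assumes "a > 0" "y > 0"
  shows "profile b a y \<le> 1"
proof -
  have "b > 0" using b by simp
  then obtain F' where "(profile b a has_real_derivative F' 0) (at 0)"
    "F' (0::real) = - a / (2 * (b + 1) * (a + 1))"
    using DERIV_profile_ex[OF _ a] by metis
  moreover have "- a / (2 * (b + 1) * (a + 1)) < 0"
    using a b assms by (intro divide_neg_pos mult_pos_pos) auto
  ultimately obtain d where d: "d > 0" "\<And>h. \<lbrakk>0 < h; h < d\<rbrakk> \<Longrightarrow> profile b a 0 > profile b a (0 + h)"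
    using DERIV_neg_dec_right by metis
  define x where "x = min y (d / 2)"
  have x: "0 < x" "x \<le> y" "x < d" using d(1) assms by (auto simp: x_def)
  have "y powr a * (profile b a y - 1) \<le> x powr a * (profile b a x - 1)"
    using powr_profile_minus_1_antimono x assms by simp
  also have "\<dots> \<le> 0" using d(2)[of x] x by (intro mult_nonneg_nonpos) auto
  finally show ?thesis using assms by (simp add: mult_le_0_iff)
qed

text \<open>For a > 0 the bound F <= 1 says nothing about the sign; instead F is positive near 0 by
  continuity, and y^a F is nondecreasing.\<close>

lemma profile_pos:
  assumes "y > 0"
  shows "profile b a y > 0"
proof -
  consider "a < 0" | "a = 0" | "a > 0" by linarith
  then show ?thesis
  proof cases
    case 3
    have "isCont (profile b a) 0" by (rule isCont_profile)
    then have "(profile b a \<longlongrightarrow> 1) (at 0)" by (simp add: isCont_def)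
    then have "\<forall>\<^sub>F x in at 0. profile b a x > 0" by (rule order_tendstoD) simp
    then have "\<forall>\<^sub>F x in at_right 0. profile b a x > 0"
      by (simp add: eventually_at_split)
    moreover have "\<forall>\<^sub>F x in at_right 0. x \<in> {0<..<y}"
      using assms by (rule eventually_at_right_real)
    ultimately have "\<forall>\<^sub>F x in at_right (0::real). x > 0 \<and> x < y \<and> profile b a x > 0"
      by eventually_elim auto
    then obtain x where "x > 0" "x < y" "profile b a x > 0"
      using eventually_happens' trivial_limit_at_right_real by blast
    then have "0 < x powr a * profile b a x" "x powr a * profile b a x \<le> y powr a * profile b a y"
      using powr_profile_mono 3 by auto
    then show ?thesis using assms by (smt (verit) zero_less_mult_iff powr_gt_zero)
  qed (use profile_gt_1[OF _ assms] profile_a_0 in force)+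
qed

text \<open>For a <= 0 the decrease of y^a F gives the growth rate (y/x)^(-a), and -a < 1. Linear
  growth is enough to make the frequencies polynomially bounded.\<close>

lemma profile_le_linear:
  assumes "0 < x" "x \<le> y"
  shows "profile b a y \<le> max 1 (profile b a x) * (y / x)"
proof (cases "a \<le> 0")
  case True
  have y: "y > 0" and r: "1 \<le> y / x" using assms by auto
  have "profile b a y \<le> (x powr a * profile b a x) / y powr a"
    using powr_profile_antimono[OF True assms] y by (simp add: field_simps)
  also have "\<dots> = profile b a x * (y / x) powr (- a)"
    using assms y by (simp add: powr_divide powr_minus field_simps)
  also have "\<dots> \<le> profile b a x * (y / x) powr 1"
    using profile_pos[of x] a r assms by (intro mult_left_mono powr_mono) auto
  also have "\<dots> \<le> max 1 (profile b a x) * (y / x)"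
    using assms y r by (simp only: powr_one) (intro mult_right_mono, auto)
  finally show ?thesis .
next
  case False
  then have "profile b a y \<le> 1 * 1" using profile_le_1[of y] assms by simp
  also have "\<dots> \<le> max 1 (profile b a x) * (y / x)" using assms by (intro mult_mono) auto
  finally show ?thesis .
qed

text \<open>The constant is the value at a fixed point x. It tends to 1 as a -> 0, so the bound can
  be made uniform in a, which the unspecified constant of \<open>profile_growth\<close> does not
  allow.\<close>

lemma profile_ge_powr:
  assumes "0 \<le> a" "0 < x" "x \<le> y"
  shows "profile b a x * (y / x) powr (- a) \<le> profile b a y"
proof -
  have y: "y > 0" using assms by auto
  have "profile b a x * (y / x) powr (- a) = (x powr a * profile b a x) / y powr a"
    using assms y by (simp add: powr_divide powr_minus field_simps)
  also have "\<dots> \<le> profile b a y"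
    using powr_profile_mono[OF assms] y by (simp add: field_simps)
  finally show ?thesis .
qed

text \<open>For \<open>a \<ge> 1\<close> the oscillation of the Bessel function has to be averaged out; it has the
  antiderivative \<open>(1 - b) w - y w'\<close>, which grows like \<open>\<surd>y\<close> only.\<close>

lemma DERIV_bessel_antiderivative:
  shows "((\<lambda>y. (1 - b) * bessel b y + y * bessel (b + 1) y / b) has_real_derivative bessel b y) (at y)"
proof -
  have b0: "b > 0" using b by simp
  have d: "(bessel b has_real_derivative - bessel (b + 1) y / b) (at y)"
      "(bessel (b + 1) has_real_derivative - bessel (b + 2) y / (b + 1)) (at y)"
    using DERIV_bessel[of b y] DERIV_bessel[of "b + 1" y] b0 by (simp_all add: add.assoc)
  have "y * bessel (b + 2) y = b * (b + 1) * (bessel (b + 1) y - bessel b y)"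
    using bessel_recurrence[OF b0, of y] by (simp add: algebra_simps)
  \<comment> \<open>This is y w'' = - b w' - w, multiplied by - b.\<close>
  then have *: "y * (- bessel (b + 2) y / (b + 1)) = - b * (bessel (b + 1) y - bessel b y)"
    using b0 by simp
  have "(1 - b) * (- bessel (b + 1) y / b) + (bessel (b + 1) y + y * (- bessel (b + 2) y / (b + 1))) / b
      = bessel b y"
    unfolding * using b0 by (simp add: field_simps)
  moreover have "((\<lambda>y. (1 - b) * bessel b y + y * bessel (b + 1) y / b) has_real_derivative
      (1 - b) * (- bessel (b + 1) y / b) + (bessel (b + 1) y + y * (- bessel (b + 2) y / (b + 1))) / b) (at y)"
    by (intro DERIV_add DERIV_cdivide) (auto intro!: derivative_eq_intros d)
  ultimately show ?thesis by simp
qed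

lemma bessel_antiderivative_le:
  assumes y: "y > 0"
  shows "\<bar>(1 - b) * bessel b y + y * bessel (b + 1) y / b\<bar> \<le> 1 + b + sqrt y"
proof -
  have "\<bar>1 - b\<bar> * \<bar>bessel b y\<bar> \<le> (1 + b) * 1"
    using abs_bessel_le_1[OF b, of y] y b by (intro mult_mono) auto
  moreover have "\<bar>y * bessel (b + 1) y / b\<bar> = y * \<bar>bessel (b + 1) y\<bar> / b"
    using y b by (simp add: abs_mult)
  ultimately show ?thesis
    using abs_bessel_Suc_le[OF b y] abs_triangle_ineq[of "(1 - b) * bessel b y" "y * bessel (b + 1) y / b"]
    by (simp add: abs_mult)
qed

text \<open>The derivative of y^a F is a b y^(a-2) (1 - w), where 1 - w >= 0. On [y/2, y] the power
  is comparable to its value at y, the factor 2^(-|a-2|) covering both signs of a - 2. So the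
  increase over that interval is at least a constant times y/2 minus the change of the
  antiderivative of w.\<close>

lemma powr_profile_ge_large:
  assumes a1: "a \<ge> 1" and y: "y > 0"
  shows "a * b * 2 powr (- \<bar>a - 2\<bar>) * y powr (a - 2) * (y / 2 - 2 * (1 + b + sqrt y)) \<le> y powr a * profile b a y"
proof -
  define c where "c = a * b * 2 powr (- \<bar>a - 2\<bar>) * y powr (a - 2)"
  define h where "h = (\<lambda>y. (1 - b) * bessel b y + y * bessel (b + 1) y / b)"
  have c0: "c \<ge> 0" using a1 b by (auto simp: c_def)
  have b0: "b > 0" using b by simp
  \<comment> \<open>The integration is expressed as monotonicity: \<open>y - h y\<close> is an
    antiderivative of 1 - w.\<close>
  let ?\<Phi> = "\<lambda>y. y powr a * profile b a y - c * (y - h y)"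
  have "?\<Phi> (y / 2) \<le> ?\<Phi> y"
  proof (rule DERIV_nonneg_imp_nondecreasing[where f = ?\<Phi>])
    fix z assume z: "y / 2 \<le> z" "z \<le> y"
    then have z0: "z > 0" using y by simp
    have "c \<le> a * b * z powr (a - 2)"
    proof -
      have "2 powr (- \<bar>a - 2\<bar>) * y powr (a - 2) \<le> z powr (a - 2)"
      proof (cases "a \<ge> 2")
        case True
        then have "2 powr (- \<bar>a - 2\<bar>) * y powr (a - 2) = (y / 2) powr (a - 2)"
          using y powr_minus[of 2 "a - 2"] by (simp add: powr_divide field_simps)
        also have "\<dots> \<le> z powr (a - 2)" using z y True by (intro powr_mono2) auto
        finally show ?thesis .
      next
        case False
        have "2 powr (- \<bar>a - 2\<bar>) * y powr (a - 2) \<le> 1 * y powr (a - 2)"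
          by (intro mult_right_mono) (auto simp: powr_minus field_simps ge_one_powr_ge_zero)
        also have "\<dots> \<le> z powr (a - 2)" using z z0 False by (simp add: powr_mono2')
        finally show ?thesis .
      qed
      then show ?thesis using a1 b by (simp add: c_def mult.assoc)
    qed
    moreover have "1 - bessel b z \<ge> 0" using abs_bessel_le_1[OF b, of z] z0 by (simp add: abs_le_iff)
    ultimately have "0 \<le> (a * b * z powr (a - 2) - c) * (1 - bessel b z)" by simp
    moreover have "z powr (a - 1) = z powr (a - 2) * z" using z0 by (simp add: powr_diff power2_eq_square)
    then have "(a * b * z powr (a - 2) - c) * (1 - bessel b z) =
        a * z powr (a - 1) * (b * (1 - bessel b z) / z - 0) - c * (1 - bessel b z)"
      using z0 by (simp add: field_simps)
    moreover have "(?\<Phi> has_real_derivative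
        a * z powr (a - 1) * (b * (1 - bessel b z) / z - 0) - c * (1 - bessel b z)) (at z)"
    proof (intro DERIV_diff DERIV_cmult)
      show "((\<lambda>x. x powr a * profile b a x) has_real_derivative
         a * z powr (a - 1) * (b * (1 - bessel b z) / z - 0)) (at z)"
        using DERIV_powr_profile[OF b0 a z0, of 0] by simp
      show "(h has_real_derivative bessel b z) (at z)"
        unfolding h_def by (rule DERIV_bessel_antiderivative)
    qed auto
    ultimately show "\<exists>d. (?\<Phi> has_real_derivative d) (at z) \<and> d \<ge> 0" by auto
  next
    show "y / 2 \<le> y" using y by simp
  qed
  moreover have "(y / 2) powr a * profile b a (y / 2) \<ge> 0" using profile_pos[of "y / 2"] y by simp
  ultimately have "c * (y - h y - (y / 2 - h (y / 2))) \<le> y powr a * profile b a y"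
    by (simp add: algebra_simps)
  moreover have "y / 2 - 2 * (1 + b + sqrt y) \<le> y - h y - (y / 2 - h (y / 2))"
  proof -
    have "\<bar>h y\<bar> \<le> 1 + b + sqrt y" using bessel_antiderivative_le[OF y] by (simp add: h_def)
    moreover have "\<bar>h (y / 2)\<bar> \<le> 1 + b + sqrt (y / 2)"
      unfolding h_def using y by (intro bessel_antiderivative_le) simp
    then have "\<bar>h (y / 2)\<bar> \<le> 1 + b + sqrt y"
      by (rule order_trans) (use y in simp)
    ultimately show ?thesis by (simp add: abs_le_iff field_simps)
  qed
  then have "c * (y / 2 - 2 * (1 + b + sqrt y)) \<le> c * (y - h y - (y / 2 - h (y / 2)))"
    using c0 by (intro mult_left_mono)
  ultimately show ?thesis unfolding c_def by linarith
qed

text \<open>With a = (n + 2 - beta)/2 the exponent is theta. For a < 0 the increasing quantity is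
  y^a (F - 1), since y^a F itself decreases; for 0 < a < 1 it is y^a F. For a >= 1 the averaged
  estimate covers large y, and monotonicity of y^a F covers the bounded range that is left.\<close>

lemma profile_growth:
  assumes x: "x > 0"
  obtains c where "c > 0" "\<And>y. y \<ge> x \<Longrightarrow> c * y powr (max 0 (1 - a)) \<le> y * profile b a y"
proof -
  consider "a < 0" | "a = 0" | "0 < a" "a < 1" | "a \<ge> 1" by linarith
  then show ?thesis
  proof cases
    case 1
    show ?thesis
    proof
      show "x powr a * (profile b a x - 1) > 0" using profile_gt_1[OF 1 x] x by simp
      fix y assume y: "y \<ge> x"
      have "x powr a * (profile b a x - 1) \<le> y powr a * (profile b a y - 1)"
        using powr_profile_minus_1_mono[of x y] 1 x y by simp
      also have "\<dots> \<le> y powr a * profile b a y" by (intro mult_left_mono) auto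
      finally have "(x powr a * (profile b a x - 1)) * y powr (1 - a) \<le>
          y powr a * profile b a y * y powr (1 - a)" by (intro mult_right_mono) auto
      also have "\<dots> = (y powr a * y powr (1 - a)) * profile b a y" by simp
      also have "y powr a * y powr (1 - a) = y" using x y by (simp flip: powr_add)
      finally show "x powr a * (profile b a x - 1) * y powr (max 0 (1 - a)) \<le> y * profile b a y"
        using 1 by (simp add: max_def)
    qed
  next
    case 2
    then show ?thesis using x by (intro that[of 1]) (auto simp: profile_a_0)
  next
    case 3
    show ?thesis
    proof
      show "x powr a * profile b a x > 0" using profile_pos[OF x] x by simp
      fix y assume y: "y \<ge> x"
      have "x powr a * profile b a x \<le> y powr a * profile b a y"
        using powr_profile_mono[of x y] 3 x y by simp
      then have "(x powr a * profile b a x) * y powr (1 - a) \<le>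
          y powr a * profile b a y * y powr (1 - a)" by (intro mult_right_mono) auto
      also have "\<dots> = (y powr a * y powr (1 - a)) * profile b a y" by simp
      also have "y powr a * y powr (1 - a) = y" using x y by (simp flip: powr_add)
      finally show "x powr a * profile b a x * y powr (max 0 (1 - a)) \<le> y * profile b a y"
        using 3 by (simp add: max_def)
    qed
  next
    case 4
    define c where "c = a * b * 2 powr (- \<bar>a - 2\<bar>)"
    have c: "c > 0" using 4 b by (simp add: c_def)
    \<comment> \<open>From y >= 256 one gets 2 sqrt y <= y/8, and from y >= 16 (1 + b) one gets 2 (1
      + b) <= y/8; together they leave y/4 of y/2.\<close>
    define Y where "Y = 256 + 16 * (1 + b)"
    have Y: "y / 2 - 2 * (1 + b + sqrt y) \<ge> y / 4 \<and> y > 0" if "y \<ge> Y" for y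
    proof -
      have "y \<ge> 256" using that b by (simp add: Y_def)
      then have "sqrt y \<ge> 16" using real_le_rsqrt[of 16 y] by simp
      then have "16 * sqrt y \<le> sqrt y * sqrt y" by (intro mult_right_mono; linarith)
      also have "\<dots> = y" using \<open>y \<ge> 256\<close> by (simp add: real_sqrt_mult_self)
      finally show ?thesis using \<open>y \<ge> 256\<close> that b unfolding Y_def by simp
    qed
    have Y0: "Y > 0" using b by (simp add: Y_def)
    show ?thesis
    proof
      \<comment> \<open>Below Y the product y F = y^(1-a) (y^a F) is bounded factor by factor: the
        first factor is nonincreasing as a >= 1, the second is nondecreasing.\<close>
      let ?d = "Y powr (1 - a) * (x powr a * profile b a x)"
      show "min (c / 4) ?d > 0" using c Y0 x profile_pos[OF x] by simp
      fix y assume y: "y \<ge> x"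
      then have y0: "y > 0" using x by simp
      have yy: "y powr (1 - a) * (y powr a * profile b a y) = y * profile b a y"
        using y0 by (simp add: powr_diff)
      have m0: "max 0 (1 - a) = 0" "y powr 0 = 1" using 4 y0 by auto
      show "min (c / 4) ?d * y powr (max 0 (1 - a)) \<le> y * profile b a y"
      proof (cases "y \<ge> Y")
        case True
        have "c / 4 = y powr (1 - a) * (c * y powr (a - 2) * (y / 4))"
          using y0 by (simp add: powr_diff power2_eq_square)
        also have "\<dots> \<le> y powr (1 - a) * (c * y powr (a - 2) * (y / 2 - 2 * (1 + b + sqrt y)))"
          using Y[OF True] c by (intro mult_left_mono) auto
        also have "\<dots> \<le> y powr (1 - a) * (y powr a * profile b a y)"
          using powr_profile_ge_large[OF 4 y0] by (intro mult_left_mono) (auto simp: c_def)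
        finally have "c / 4 \<le> y * profile b a y" unfolding yy .
        then show ?thesis unfolding m0 mult_1_right by (rule min.coboundedI1)
      next
        case False
        have "?d \<le> y powr (1 - a) * (y powr a * profile b a y)"
          using x y False 4 profile_pos[OF x]
          by (intro mult_mono[OF powr_mono2' powr_profile_mono]) auto
        then show ?thesis unfolding m0 mult_1_right yy by (rule min.coboundedI2)
      qed
    qed
  qed
qed

end

text \<open>Every coefficient of positive index carries a / (a + j), which is at most 2 |a| in
  modulus for |a| < 1/2, whence |F - 1| <= 2 |a| exp |y|. Both signs of a are covered, as the limit
  is two-sided.\<close>

lemma profile_tendsto_1:
  assumes b: "b > 0"
  shows "((\<lambda>a. profile b a y) \<longlongrightarrow> 1) (at 0)"
proof -
  have le: "\<bar>profile b a y - 1\<bar> \<le> 2 * \<bar>a\<bar> * exp \<bar>y\<bar>" if a: "\<bar>a\<bar> < 1 / 2" for a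
  proof -
    have a': "a > -1" using a by simp
    have sf: "summable (\<lambda>j. profile_coeff b a (Suc j) * y ^ Suc j)"
      using summable_profile[OF b a', of y]
      by (simp only: summable_Suc_iff[of "\<lambda>j. profile_coeff b a j * y ^ j"])
    have t: "norm (profile_coeff b a (Suc j) * y ^ Suc j) \<le> 2 * \<bar>a\<bar> * (inverse (fact (Suc j)) * \<bar>y\<bar> ^ Suc j)" for j
    proof -
      have "1 \<le> 2 * (a + real (Suc j))" using a by simp
      then have "\<bar>a\<bar> / (a + real (Suc j)) \<le> \<bar>a\<bar> / (1 / 2)"
        using a by (intro divide_left_mono) auto
      then have "\<bar>a / (a + real (Suc j))\<bar> \<le> 2 * \<bar>a\<bar>" using a by simp
      then have "\<bar>a / (a + real (Suc j))\<bar> / fact (Suc j) \<le> 2 * \<bar>a\<bar> / fact (Suc j)"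
        by (intro divide_right_mono) auto
      with abs_profile_coeff_le[OF b, of a "Suc j"]
      have "\<bar>profile_coeff b a (Suc j)\<bar> \<le> 2 * \<bar>a\<bar> / fact (Suc j)" by (simp del: fact_Suc)
      then have "\<bar>profile_coeff b a (Suc j)\<bar> * \<bar>y ^ Suc j\<bar> \<le> 2 * \<bar>a\<bar> / fact (Suc j) * \<bar>y ^ Suc j\<bar>"
        by (intro mult_right_mono) auto
      then show ?thesis unfolding real_norm_def abs_mult power_abs by (simp add: field_simps del: fact_Suc power_Suc)
    qed
    have se: "summable (\<lambda>j. inverse (fact j) * \<bar>y\<bar> ^ j)" using summable_exp[of "\<bar>y\<bar>"] .
    then have se': "summable (\<lambda>j. inverse (fact (Suc j)) * \<bar>y\<bar> ^ Suc j)"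
      by (simp only: summable_Suc_iff[of "\<lambda>j. inverse (fact j) * \<bar>y\<bar> ^ j"])
    have "profile b a y - 1 = (\<Sum>j. profile_coeff b a (Suc j) * y ^ Suc j)"
      unfolding profile_def using suminf_split_head[OF summable_profile[OF b a', of y]]
      by (simp add: profile_coeff_def)
    also have "norm \<dots> \<le> (\<Sum>j. 2 * \<bar>a\<bar> * (inverse (fact (Suc j)) * \<bar>y\<bar> ^ Suc j))"
      by (intro norm_suminf_le t summable_mult se')
    also have "\<dots> = 2 * \<bar>a\<bar> * (\<Sum>j. inverse (fact (Suc j)) * \<bar>y\<bar> ^ Suc j)"
      by (rule suminf_mult[OF se'])
    also have "(\<Sum>j. inverse (fact (Suc j)) * \<bar>y\<bar> ^ Suc j) = exp \<bar>y\<bar> - 1"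
      using suminf_split_head[OF se] by (simp add: exp_def scaleR_conv_of_real field_simps)
    also have "2 * \<bar>a\<bar> * (exp \<bar>y\<bar> - 1) \<le> 2 * \<bar>a\<bar> * exp \<bar>y\<bar>" by (intro mult_left_mono) auto
    finally show ?thesis by simp
  qed
  have lim: "((\<lambda>a. 2 * \<bar>a\<bar> * exp \<bar>y\<bar>) \<longlongrightarrow> 2 * \<bar>0\<bar> * exp \<bar>y\<bar>) (at 0)" by (intro tendsto_intros)
  have "\<forall>\<^sub>F a::real in at 0. \<bar>a\<bar> < 1 / 2"
    unfolding eventually_at by (intro exI[of _ "1 / 2"]) auto
  then have ev: "\<forall>\<^sub>F a in at 0. norm (profile b a y - 1) \<le> 2 * \<bar>a\<bar> * exp \<bar>y\<bar>"
    by eventually_elim (use le in auto)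
  have "((\<lambda>a. profile b a y - 1) \<longlongrightarrow> 0) (at 0)"
    by (rule Lim_null_comparison[OF ev]) (use lim in simp)
  then show ?thesis by (simp add: LIM_zero_iff)
qed

subsection \<open>Test functions and characters\<close>

lemma partial_derivI:
  assumes "(\<phi> has_derivative D) (at x)"
  shows "partial_deriv i \<phi> x = D (axis i 1)"
  using frechet_derivative_at[OF assms] by (simp add: partial_deriv_def)

lemma iter_partial_Nil [simp]: "iter_partial [] \<phi> = \<phi>"
  by (simp add: iter_partial_def)

lemma iter_partial_Cons: "iter_partial (i # is) \<phi> = partial_deriv i (iter_partial is \<phi>)"
  by (simp add: iter_partial_def)

lemma iter_partial_append: "iter_partial (is @ js) \<phi> = iter_partial is (iter_partial js \<phi>)"
  by (simp add: iter_partial_def)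

lemma has_derivative_frechet:
  assumes "\<phi> differentiable_on UNIV"
  shows "(\<phi> has_derivative frechet_derivative \<phi> (at x)) (at x)"
  using assms frechet_derivative_works by (auto simp: differentiable_on_def)

lemma partial_deriv_add:
  assumes "\<phi> differentiable_on UNIV" "\<psi> differentiable_on UNIV"
  shows "partial_deriv i (\<lambda>x. \<phi> x + \<psi> x) = (\<lambda>x. partial_deriv i \<phi> x + partial_deriv i \<psi> x)"
proof
  fix x
  show "partial_deriv i (\<lambda>x. \<phi> x + \<psi> x) x = partial_deriv i \<phi> x + partial_deriv i \<psi> x"
    using partial_derivI[OF has_derivative_add[OF has_derivative_frechet has_derivative_frechet], OF assms]
    by (simp add: partial_deriv_def)
qed

lemma partial_deriv_cmult:
  assumes "\<phi> differentiable_on UNIV"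
  shows "partial_deriv i (\<lambda>x. c * \<phi> x) = (\<lambda>x. c * partial_deriv i \<phi> x)"
proof
  fix x
  show "partial_deriv i (\<lambda>x. c * \<phi> x) x = c * partial_deriv i \<phi> x"
    using partial_derivI[OF has_derivative_mult_right[OF has_derivative_frechet[OF assms]], of i c x]
    by (simp add: partial_deriv_def)
qed

lemma test_functionD:
  assumes "test_function \<phi>"
  shows "iter_partial is \<phi> differentiable_on UNIV" "\<phi> differentiable_on UNIV"
    "\<phi> (x + axis i (2 * pi)) = \<phi> x"
  using assms iter_partial_Nil[of \<phi>] unfolding test_function_def by metis+

lemma iter_partial_add:
  assumes "test_function \<phi>" "test_function \<psi>"
  shows "iter_partial is (\<lambda>x. \<phi> x + \<psi> x) = (\<lambda>x. iter_partial is \<phi> x + iter_partial is \<psi> x)"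
proof (induction "is")
  case (Cons i "is")
  show ?case unfolding iter_partial_Cons Cons
    by (intro partial_deriv_add test_functionD assms)
qed simp

lemma iter_partial_cmult:
  assumes "test_function \<phi>"
  shows "iter_partial is (\<lambda>x. c * \<phi> x) = (\<lambda>x. c * iter_partial is \<phi> x)"
proof (induction "is")
  case (Cons i "is")
  show ?case unfolding iter_partial_Cons Cons
    by (intro partial_deriv_cmult test_functionD assms)
qed simp

lemma differentiable_on_cmult:
  fixes \<phi> :: "real^'n::finite \<Rightarrow> complex"
  shows "\<phi> differentiable_on UNIV \<Longrightarrow> (\<lambda>x. c * \<phi> x) differentiable_on UNIV"
  unfolding differentiable_on_def by (auto intro: differentiable_mult)

lemma test_function_add:
  assumes "test_function \<phi>" "test_function \<psi>"
  shows "test_function (\<lambda>x. \<phi> x + \<psi> x)"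
  using assms unfolding test_function_def iter_partial_add[OF assms]
  by (auto intro: differentiable_on_add)

lemma test_function_cmult:
  assumes "test_function \<phi>"
  shows "test_function (\<lambda>x. c * \<phi> x)"
  using assms unfolding test_function_def iter_partial_cmult[OF assms]
  by (auto intro: differentiable_on_cmult)

lemma iter_partial_0: "iter_partial is (\<lambda>x :: real^'n::finite. 0) = (\<lambda>x. 0)"
proof (induction "is")
  case (Cons i "is")
  show ?case unfolding iter_partial_Cons Cons
    using partial_derivI[OF has_derivative_const[of "0 :: complex"]] by auto
qed simp

lemma test_function_0: "test_function (\<lambda>x. 0)"
  by (simp add: test_function_def iter_partial_0)

lemma test_function_sum:
  assumes "\<And>k. k \<in> F \<Longrightarrow> test_function (\<phi> k)"
  shows "test_function (\<lambda>x. \<Sum>k\<in>F. \<phi> k x)"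
  using assms by (induction F rule: infinite_finite_induct)
    (auto intro: test_function_0 test_function_add)

lemma iter_partial_sum:
  assumes "\<And>k. k \<in> F \<Longrightarrow> test_function (\<phi> k)"
  shows "iter_partial is (\<lambda>x. \<Sum>k\<in>F. \<phi> k x) = (\<lambda>x. \<Sum>k\<in>F. iter_partial is (\<phi> k) x)"
  using assms by (induction F rule: infinite_finite_induct)
    (auto simp: iter_partial_0 iter_partial_add test_function_sum)

lemma partial_deriv_periodic:
  assumes d: "\<phi> differentiable_on UNIV" and p: "\<And>x. \<phi> (x + v) = \<phi> x"
  shows "partial_deriv i \<phi> (x + v) = partial_deriv i \<phi> x"
proof -
  have "((\<lambda>x. \<phi> (x + v)) has_derivative (\<lambda>h. frechet_derivative \<phi> (at (x + v)) h)) (at x)"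
    by (rule has_derivative_compose[OF _ has_derivative_frechet[OF d]])
      (auto intro!: derivative_eq_intros)
  then show ?thesis
    using partial_derivI[of \<phi> _ x i] by (simp add: p partial_deriv_def)
qed

lemma test_function_iter_partial:
  assumes "test_function \<phi>"
  shows "test_function (iter_partial is \<phi>)"
proof -
  have "iter_partial is \<phi> (x + axis i (2 * pi)) = iter_partial is \<phi> x" for x i
    by (induction "is" arbitrary: x)
      (auto simp: iter_partial_Cons test_functionD[OF assms] intro!: partial_deriv_periodic)
  then show ?thesis
    using assms unfolding test_function_def by (simp flip: iter_partial_append)
qed

lemma partial_deriv_eq_iter: "partial_deriv i \<phi> = iter_partial [i] \<phi>"
  by (simp add: iter_partial_Cons)

lemma test_function_partial_deriv: "test_function \<phi> \<Longrightarrow> test_function (partial_deriv i \<phi>)"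
  unfolding partial_deriv_eq_iter by (rule test_function_iter_partial)

lemma continuous_on_test_function:
  assumes "test_function \<phi>"
  shows "continuous_on S \<phi>"
  using differentiable_imp_continuous_on[OF test_functionD(2)[OF assms]] continuous_on_subset by blast

lemma echar_0 [simp]: "echar 0 x = 1"
  by (simp add: echar_def real_vec_def inner_vec_def)

lemma real_vec_add: "real_vec (k + l) = real_vec k + real_vec l"
  and real_vec_minus: "real_vec (- k) = - real_vec k"
  and real_vec_nth: "real_vec k $ i = real_of_int (k $ i)"
  by (simp_all add: real_vec_def vec_eq_iff)

lemma real_vec_0 [simp]: "real_vec 0 = 0"
  by (simp add: real_vec_def vec_eq_iff)

lemma echar_add: "echar (k + l) x = echar k x * echar l x"
  by (simp add: echar_def real_vec_add inner_add_left cis_mult)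

lemma norm_echar [simp]: "norm (echar k x) = 1"
  by (simp add: echar_def)

lemma echar_periodic: "echar k (x + axis i (2 * pi)) = echar k x"
proof -
  have "real_vec k \<bullet> axis i (2 * pi) = 2 * pi * real_of_int (k $ i)"
    by (simp add: inner_axis real_vec_nth)
  then show ?thesis
    by (simp add: echar_def inner_add_right flip: cis_mult)
qed

lemma has_derivative_echar:
  "(echar k has_derivative (\<lambda>h. \<i> * of_real (real_vec k \<bullet> h) * echar k x)) (at x)"
  unfolding echar_def[abs_def]
  by (rule derivative_eq_intros refl)+ (auto simp: scaleR_conv_of_real)

lemma echar_differentiable: "echar k differentiable_on UNIV"
  using has_derivative_echar by (auto simp: differentiable_on_def differentiable_def)

lemma continuous_on_echar: "continuous_on S (echar k)"
  using differentiable_imp_continuous_on[OF echar_differentiable] continuous_on_subset by blast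

lemma partial_deriv_echar:
  "partial_deriv i (echar k) = (\<lambda>x. \<i> * of_int (k $ i) * echar k x)"
  using partial_derivI[OF has_derivative_echar] by (auto simp: inner_axis real_vec_nth)

lemma iter_partial_echar:
  "iter_partial is (echar k) = (\<lambda>x. (\<Prod>i\<leftarrow>is. \<i> * of_int (k $ i)) * echar k x)"
proof (induction "is")
  case (Cons i "is")
  show ?case unfolding iter_partial_Cons Cons partial_deriv_cmult[OF echar_differentiable]
    by (simp add: partial_deriv_echar mult_ac)
qed simp

lemma test_function_echar: "test_function (echar k)"
  unfolding test_function_def iter_partial_echar
  by (auto intro: differentiable_on_cmult echar_differentiable echar_periodic)

section \<open>Integration over the torus and orthogonality of the characters\<close>

definition torus :: "(real^'n::finite) set" where
  "torus = cbox 0 (\<chi> i. 2 * pi)"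

text \<open>This is (2 pi)^n times the Fourier coefficient of the function at - k, which is why
  \<open>echar (- k)\<close> accompanies \<open>pairing k\<close> in the inversion formula.\<close>

definition pairing :: "int^'n::finite \<Rightarrow> (real^'n \<Rightarrow> complex) \<Rightarrow> complex" where
  "pairing k \<phi> = integral torus (\<lambda>x. echar k x * \<phi> x)"

lemma fourier_series_eq: "fourier_series c \<phi> = (\<Sum>\<^sub>\<infinity>k. c k * pairing k \<phi>)"
  by (simp add: fourier_series_def pairing_def torus_def)

lemma measure_torus: "measure lborel (torus :: (real^'n::finite) set) = (2 * pi) ^ CARD('n)"
proof -
  have "(0 :: real^'n) \<in> torus" by (simp add: torus_def mem_box_cart)
  then have "(torus :: (real^'n) set) \<noteq> {}" by blast
  then show ?thesis unfolding torus_def by (subst content_cbox_cart) auto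
qed

text \<open>The box lengthened by h in direction i is cut in two ways: at height 2 pi into the torus
  and a top slab, at height h into a bottom slab and the translated torus. The two slabs have the
  same integral by periodicity.\<close>

lemma integral_torus_translate:
  fixes \<psi> :: "real^'n::finite \<Rightarrow> complex"
  assumes c: "continuous_on UNIV \<psi>" and p: "\<And>x. \<psi> (x + axis i (2 * pi)) = \<psi> x"
    and h: "0 \<le> h" "h \<le> 2 * pi"
  shows "integral torus (\<lambda>x. \<psi> (x + axis i h)) = integral torus \<psi>"
proof -
  let ?p = "(\<chi> i. 2 * pi) :: real^'n" and ?e = "axis i 1 :: real^'n"
  have ax: "axis i r $ j = (if j = i then r else 0)" for j and r :: real
    by (simp add: axis_def)
  have int: "\<psi> integrable_on cbox u v" for u v
    by (rule integrable_continuous) (rule continuous_on_subset[OF c], simp)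
  have shift: "integral (cbox u v) (\<lambda>x. \<psi> (x + w)) = integral (cbox (u + w) (v + w)) \<psi>" for u v w
    using integral_shift_cbox_plus[of u v \<psi> w] by (simp add: o_def add.commute)
  have split: "integral (cbox 0 (?p + axis i h)) \<psi> =
      integral (cbox 0 (?p + axis i h) \<inter> {x. x \<bullet> ?e \<le> c}) \<psi> +
      integral (cbox 0 (?p + axis i h) \<inter> {x. x \<bullet> ?e \<ge> c}) \<psi>" for c
    by (rule integral_split[OF int]) (simp add: axis_in_Basis_iff)
  have box: "x \<in> cbox u v \<longleftrightarrow> (u $ i \<le> x $ i \<and> x $ i \<le> v $ i) \<and> (\<forall>j. j \<noteq> i \<longrightarrow> u $ j \<le> x $ j \<and> x $ j \<le> v $ j)"
    for x u v :: "real^'n"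
    unfolding mem_box_cart by metis
  have "cbox 0 (?p + axis i h) \<inter> {x. x \<bullet> ?e \<le> 2 * pi} = cbox 0 ?p"
    using h by (auto simp: box inner_axis ax)
  moreover have "cbox 0 (?p + axis i h) \<inter> {x. x \<bullet> ?e \<ge> 2 * pi} = cbox (axis i (2 * pi)) (?p + axis i h)"
    using h by (auto simp: box inner_axis ax)
  moreover have "cbox 0 (?p + axis i h) \<inter> {x. x \<bullet> ?e \<le> h} = cbox 0 (?p + axis i h - axis i (2 * pi))"
    using h by (auto simp: box inner_axis ax)
  moreover have "cbox 0 (?p + axis i h) \<inter> {x. x \<bullet> ?e \<ge> h} = cbox (axis i h) (?p + axis i h)"
    using h by (auto simp: box inner_axis ax)
  moreover have "integral (cbox (axis i (2 * pi)) (?p + axis i h)) \<psi> =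
      integral (cbox 0 (?p + axis i h - axis i (2 * pi))) \<psi>"
    using shift[of 0 "?p + axis i h - axis i (2 * pi)" "axis i (2 * pi)"] by (simp add: p)
  ultimately have "integral (cbox (axis i h) (?p + axis i h)) \<psi> = integral (cbox 0 ?p) \<psi>"
    using split[of h] split[of "2 * pi"] by simp
  then show ?thesis using shift[of 0 ?p "axis i h"] by (simp add: torus_def)
qed

text \<open>Differentiating the integral of the translate under the integral sign at h = 0 gives the
  left side, and that integral is constant in h. The derivative is one-sided because translation is
  controlled for h in [0, 2 pi] only.\<close>

lemma integral_partial_deriv:
  fixes \<psi> :: "real^'n::finite \<Rightarrow> complex"
  assumes d: "\<psi> differentiable_on UNIV" and c: "continuous_on UNIV (partial_deriv i \<psi>)"
    and p: "\<And>x. \<psi> (x + axis i (2 * pi)) = \<psi> x"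
  shows "integral torus (partial_deriv i \<psi>) = 0"
proof -
  have ax: "axis i r = r *\<^sub>R axis i (1 :: real)" for r :: real
    by (simp add: axis_def vec_eq_iff)
  have "axis i = (\<lambda>r :: real. r *\<^sub>R (axis i 1 :: real^'n))" by (rule ext) (rule ax)
  then have bl: "bounded_linear (axis i :: real \<Rightarrow> real^'n)"
    using bounded_linear_scaleR_left[of "axis i 1 :: real^'n"] by simp
  note [continuous_intros] = bounded_linear.continuous_on[OF bl]
  have c\<psi>: "continuous_on UNIV \<psi>" by (rule differentiable_imp_continuous_on[OF d])
  have "((\<lambda>h. integral (cbox 0 (\<chi> i. 2 * pi)) (\<lambda>x. \<psi> (x + axis i h))) has_vector_derivative
      integral (cbox 0 (\<chi> i. 2 * pi)) (\<lambda>x. partial_deriv i \<psi> (x + axis i 0))) (at 0 within {0..2 * pi})"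
  proof (rule leibniz_rule_vector_derivative)
    fix h :: real and x :: "real^'n"
    have "((\<lambda>h. \<psi> (x + axis i h)) has_derivative
        (\<lambda>r. frechet_derivative \<psi> (at (x + axis i h)) (axis i r))) (at h within {0..2 * pi})"
    proof (rule has_derivative_compose[OF _ has_derivative_frechet[OF d]])
      show "((\<lambda>h. x + axis i h) has_derivative axis i) (at h within {0..2 * pi})"
        using bounded_linear.has_derivative[OF bl has_derivative_ident]
        by (auto intro!: derivative_eq_intros)
    qed
    moreover have "linear (frechet_derivative \<psi> (at (x + axis i h)))"
      using has_derivative_frechet[OF d] has_derivative_linear by blast
    then have "frechet_derivative \<psi> (at (x + axis i h)) (axis i r) =
        r *\<^sub>R partial_deriv i \<psi> (x + axis i h)" for r
      unfolding partial_deriv_def by (subst ax) (rule linear_scale)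
    ultimately show "((\<lambda>h. \<psi> (x + axis i h)) has_vector_derivative
        partial_deriv i \<psi> (x + axis i h)) (at h within {0..2 * pi})"
      by (simp add: has_vector_derivative_def)
  next
    fix h
    show "(\<lambda>x. \<psi> (x + axis i h)) integrable_on cbox 0 (\<chi> i. 2 * pi)"
      by (intro integrable_continuous continuous_on_compose2[OF c\<psi>] continuous_intros) auto
  next
    show "continuous_on ({0..2 * pi} \<times> cbox 0 (\<chi> i. 2 * pi)) (\<lambda>(h, x). partial_deriv i \<psi> (x + axis i h))"
      unfolding split_beta by (intro continuous_on_compose2[OF c] continuous_intros) auto
  qed auto
  then have "((\<lambda>h. integral torus (\<lambda>x. \<psi> (x + axis i h))) has_vector_derivative
      integral torus (partial_deriv i \<psi>)) (at 0 within {0..2 * pi})"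
    using ax[of 0] by (simp add: torus_def)
  then have "((\<lambda>h. integral torus \<psi>) has_vector_derivative integral torus (partial_deriv i \<psi>))
      (at 0 within {0..2 * pi})"
    by (rule has_vector_derivative_transform[rotated 2])
      (use integral_torus_translate[OF c\<psi> p] in auto)
  moreover have "((\<lambda>h. integral torus \<psi>) has_vector_derivative 0) (at 0 within {0..2 * pi})"
    by (rule has_vector_derivative_const)
  ultimately show ?thesis
    by (rule vector_derivative_unique_within[rotated])
      (auto simp: at_within_Icc_at_right trivial_limit_at_right_real)
qed

lemma integrable_torus:
  fixes \<psi> :: "real^'n::finite \<Rightarrow> complex"
  shows "continuous_on UNIV \<psi> \<Longrightarrow> \<psi> integrable_on torus"
  unfolding torus_def by (rule integrable_continuous) (rule continuous_on_subset, auto)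

text \<open>Integration by parts: the partial derivative of \<open>echar k x * \<phi> x\<close>
  integrates to 0.\<close>

lemma pairing_partial_deriv:
  assumes "test_function \<phi>"
  shows "pairing k (partial_deriv i \<phi>) = - \<i> * of_int (k $ i) * pairing k \<phi>"
proof -
  have deriv: "((\<lambda>x. echar k x * \<phi> x) has_derivative
      (\<lambda>h. echar k x * frechet_derivative \<phi> (at x) h + \<i> * of_real (real_vec k \<bullet> h) * echar k x * \<phi> x)) (at x)" for x
    by (rule has_derivative_mult[OF has_derivative_echar has_derivative_frechet[OF test_functionD(2)[OF assms]]])
  have eq: "partial_deriv i (\<lambda>x. echar k x * \<phi> x) =
      (\<lambda>x. echar k x * partial_deriv i \<phi> x + \<i> * of_int (k $ i) * (echar k x * \<phi> x))"
    using partial_derivI[OF deriv] by (auto simp: partial_deriv_def inner_axis real_vec_nth mult_ac)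
  note cont = continuous_on_echar continuous_on_test_function[OF assms]
    continuous_on_test_function[OF test_function_partial_deriv[OF assms]]
  have "integral torus (partial_deriv i (\<lambda>x. echar k x * \<phi> x)) = 0"
  proof (rule integral_partial_deriv)
    show "(\<lambda>x. echar k x * \<phi> x) differentiable_on UNIV"
      using deriv by (auto simp: differentiable_on_def differentiable_def)
    show "continuous_on UNIV (partial_deriv i (\<lambda>x. echar k x * \<phi> x))"
      unfolding eq by (intro continuous_intros cont)
  qed (simp add: echar_periodic test_functionD(3)[OF assms])
  also have "integral torus (partial_deriv i (\<lambda>x. echar k x * \<phi> x)) =
      pairing k (partial_deriv i \<phi>) + \<i> * of_int (k $ i) * pairing k \<phi>"
    unfolding eq pairing_def
    by (subst integral_add) (auto intro!: integrable_torus continuous_intros cont)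
  finally show ?thesis by (simp add: eq_neg_iff_add_eq_0)
qed

lemma pairing_iter_partial:
  assumes "test_function \<phi>"
  shows "pairing k (iter_partial is \<phi>) = (\<Prod>i\<leftarrow>is. - \<i> * of_int (k $ i)) * pairing k \<phi>"
  by (induction "is")
    (simp_all add: iter_partial_Cons pairing_partial_deriv test_function_iter_partial[OF assms])

text \<open>For k + l nonzero some partial derivative of \<open>echar (k + l)\<close> is a nonzero
  multiple of it, and derivatives integrate to 0.\<close>

lemma pairing_echar:
  "pairing k (echar l) = (if k = - l then of_real ((2 * pi) ^ CARD('n)) else 0)"
  for k l :: "int^'n::finite"
proof -
  have eq: "pairing k (echar l) = integral torus (echar (k + l))"
    by (simp add: pairing_def flip: echar_add)
  show ?thesis
  proof (cases "k = - l")
    case True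
    have "integral torus (echar (0 :: int^'n)) = of_real (measure lborel (torus :: (real^'n) set))"
      unfolding torus_def echar_0[abs_def] by (simp add: scaleR_conv_of_real)
    then show ?thesis using True eq by (simp add: measure_torus)
  next
    case False
    then have "k + l \<noteq> 0" by (simp add: add_eq_0_iff2)
    then obtain i where i: "(k + l) $ i \<noteq> 0" by (auto simp: vec_eq_iff)
    have "integral torus (partial_deriv i (echar (k + l))) = 0"
      by (intro integral_partial_deriv echar_differentiable continuous_on_test_function
          test_function_partial_deriv test_function_echar echar_periodic)
    then have "of_int ((k + l) $ i) * integral torus (echar (k + l)) = 0"
      by (simp add: partial_deriv_echar mult.assoc)
    then show ?thesis using i eq False by (simp flip: of_int_add)
  qed
qed

lemma pairing_add:
  assumes "test_function \<phi>" "test_function \<psi>"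
  shows "pairing k (\<lambda>x. \<phi> x + \<psi> x) = pairing k \<phi> + pairing k \<psi>"
  unfolding pairing_def distrib_left
  by (intro integral_add integrable_torus continuous_intros continuous_on_echar
      continuous_on_test_function assms)

lemma pairing_cmult: "pairing k (\<lambda>x. c * \<phi> x) = c * pairing k \<phi>"
  unfolding pairing_def by (simp add: mult.left_commute[of _ c])

lemma pairing_sum:
  assumes "\<And>j. j \<in> F \<Longrightarrow> test_function (\<phi> j)"
  shows "pairing k (\<lambda>x. \<Sum>j\<in>F. \<phi> j x) = (\<Sum>j\<in>F. pairing k (\<phi> j))"
  using assms by (induction F rule: infinite_finite_induct)
    (auto simp: pairing_add test_function_sum, auto simp: pairing_def)

lemma norm_pairing_le:
  fixes \<phi> :: "real^'n::finite \<Rightarrow> complex"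
  assumes c: "continuous_on UNIV \<phi>" and B: "\<And>x. norm (\<phi> x) \<le> B"
  shows "norm (pairing k \<phi>) \<le> B * (2 * pi) ^ CARD('n)"
proof -
  have "norm (pairing k \<phi>) \<le> B * measure lborel (cbox 0 (\<chi> i. 2 * pi) :: (real^'n) set)"
    unfolding pairing_def torus_def
  proof (rule integrable_bound)
    show "0 \<le> B" using B norm_ge_zero order_trans by blast
    show "(\<lambda>x. echar k x * \<phi> x) integrable_on cbox 0 (\<chi> i. 2 * pi)"
      using integrable_torus[of "\<lambda>x. echar k x * \<phi> x"] unfolding torus_def
      by (simp add: continuous_on_mult continuous_on_echar c)
  qed (simp add: norm_mult B)
  then show ?thesis by (simp add: measure_torus torus_def[symmetric])
qed

subsection \<open>Weights on the lattice\<close>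

definition weight :: "int^'n::finite \<Rightarrow> real" where
  "weight k = 1 + (norm (real_vec k))\<^sup>2"

lemma weight_ge_1: "weight k \<ge> 1"
  by (simp add: weight_def)

lemma weight_pos [simp]: "weight k > 0"
  using weight_ge_1[of k] by linarith

lemma weight_nonneg [simp]: "weight k \<ge> 0"
  using weight_pos[of k] by linarith

lemma weight_neq_0 [simp]: "weight k \<noteq> 0"
  using weight_pos[of k] by linarith

lemma weight_minus [simp]: "weight (- k) = weight k"
  by (simp add: weight_def real_vec_minus)

lemma norm_real_vec_sq: "(norm (real_vec k))\<^sup>2 = (\<Sum>i\<in>UNIV. (real_of_int (k $ i))\<^sup>2)"
  unfolding power2_norm_eq_inner inner_vec_def real_vec_nth by (simp add: power2_eq_square)

lemma nth_sq_le_weight: "1 + (real_of_int (k $ i))\<^sup>2 \<le> weight k"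
  unfolding weight_def norm_real_vec_sq
  using member_le_sum[of i UNIV "\<lambda>i. (real_of_int (k $ i))\<^sup>2"] by simp

lemma abs_nth_le_weight: "\<bar>real_of_int (k $ i)\<bar> \<le> weight k"
proof -
  have "2 * \<bar>real_of_int (k $ i)\<bar> * 1 \<le> \<bar>real_of_int (k $ i)\<bar>\<^sup>2 + 1\<^sup>2" by (rule sum_squares_bound)
  then show ?thesis using nth_sq_le_weight[of k i] by simp
qed

text \<open>The map j -> |j| is injective on each of the two sign classes, so twice the series over
  the naturals is a bound.\<close>

lemma sum_int_bound:
  obtains C :: real where "\<And>J :: int set. finite J \<Longrightarrow> (\<Sum>j\<in>J. 1 / (1 + (real_of_int j)\<^sup>2)) \<le> C"
proof -
  let ?f = "\<lambda>m::nat. 1 / (1 + (real m)\<^sup>2)"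
  have sm: "summable ?f"
  proof (rule summable_comparison_test)
    show "\<exists>N. \<forall>n\<ge>N. norm (?f n) \<le> inverse (real n ^ 2)"
    proof (intro exI allI impI)
      fix n :: nat assume "n \<ge> 1"
      then show "norm (?f n) \<le> inverse (real n ^ 2)"
        by (simp add: inverse_eq_divide) (intro divide_left_mono, auto simp: add_pos_pos)
    qed
    show "summable (\<lambda>n. inverse (real n ^ 2))" by (rule inverse_power_summable) simp
  qed
  have half: "(\<Sum>j\<in>J. 1 / (1 + (real_of_int j)\<^sup>2)) \<le> suminf ?f"
    if "finite J" and inj: "inj_on (\<lambda>j. nat \<bar>j\<bar>) J" for J :: "int set"
  proof -
    have "(\<Sum>j\<in>J. 1 / (1 + (real_of_int j)\<^sup>2)) = (\<Sum>j\<in>J. ?f (nat \<bar>j\<bar>))"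
      by (intro sum.cong) auto
    also have "\<dots> = sum ?f ((\<lambda>j. nat \<bar>j\<bar>) ` J)" by (subst sum.reindex[OF inj]) simp
    also have "\<dots> \<le> suminf ?f" using that by (intro sum_le_suminf sm) auto
    finally show ?thesis .
  qed
  show ?thesis
  proof
    fix J :: "int set" assume "finite J"
    have "inj_on (\<lambda>j. nat \<bar>j\<bar>) {j\<in>J. j \<ge> 0}" "inj_on (\<lambda>j. nat \<bar>j\<bar>) {j\<in>J. \<not> j \<ge> 0}"
      by (auto simp: inj_on_def)
    then have "(\<Sum>j\<in>{j\<in>J. j \<ge> 0}. 1 / (1 + (real_of_int j)\<^sup>2)) +
        (\<Sum>j\<in>{j\<in>J. \<not> j \<ge> 0}. 1 / (1 + (real_of_int j)\<^sup>2)) \<le> suminf ?f + suminf ?f"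
      using \<open>finite J\<close> by (intro add_mono half) auto
    also have "(\<Sum>j\<in>{j\<in>J. j \<ge> 0}. 1 / (1 + (real_of_int j)\<^sup>2)) +
        (\<Sum>j\<in>{j\<in>J. \<not> j \<ge> 0}. 1 / (1 + (real_of_int j)\<^sup>2)) = (\<Sum>j\<in>J. 1 / (1 + (real_of_int j)\<^sup>2))"
      using \<open>finite J\<close> by (subst sum.union_disjoint[symmetric]) (auto intro!: sum.cong)
    finally show "(\<Sum>j\<in>J. 1 / (1 + (real_of_int j)\<^sup>2)) \<le> suminf ?f + suminf ?f" .
  qed
qed

text \<open>The weight is at least each 1 + k_i^2, so its n-th power dominates their product, and
  the sum of the reciprocal products over a cube factorises into one-dimensional sums.\<close>

lemma summable_weight:
  "(\<lambda>k :: int^'n::finite. 1 / weight k ^ CARD('n)) summable_on UNIV"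
proof (rule nonneg_bdd_above_summable_on)
  let ?f = "\<lambda>j::int. 1 / (1 + (real_of_int j)\<^sup>2)"
  obtain C where C: "\<And>J. finite J \<Longrightarrow> sum ?f J \<le> C" using sum_int_bound by blast
  have "sum (\<lambda>k. 1 / weight k ^ CARD('n)) F \<le> C ^ CARD('n)" if F: "finite F" for F :: "(int^'n) set"
  proof -
    \<comment> \<open>J collects all coordinates that occur in F, so that F lies in the cube
      J^n.\<close>
    define J where "J = (\<Union>k\<in>F. range (($) k))"
    have J: "finite J" using F by (auto simp: J_def)
    have "(\<Sum>k\<in>F. 1 / weight k ^ CARD('n)) \<le> (\<Sum>k\<in>F. \<Prod>i\<in>UNIV. ?f (k $ i))"
    proof (rule sum_mono)
      fix k :: "int^'n"
      have p: "0 < 1 + (real_of_int (k $ i))\<^sup>2" for i by (simp add: add_pos_nonneg)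
      have "(\<Prod>i\<in>(UNIV :: 'n set). 1 / weight k) \<le> (\<Prod>i\<in>UNIV. ?f (k $ i))"
      proof (rule prod_mono, rule conjI)
        fix i
        show "1 / weight k \<le> ?f (k $ i)"
          using nth_sq_le_weight[of k i] p[of i] by (intro divide_left_mono mult_pos_pos) auto
      qed simp
      then show "1 / weight k ^ CARD('n) \<le> (\<Prod>i\<in>UNIV. ?f (k $ i))"
        by (simp add: power_one_over)
    qed
    also have "\<dots> = (\<Sum>g\<in>($) ` F. \<Prod>i\<in>UNIV. ?f (g i))"
      by (subst sum.reindex) (auto simp: inj_on_def vec_nth_inject)
    also have "\<dots> \<le> (\<Sum>g\<in>PiE (UNIV :: 'n set) (\<lambda>_. J). \<Prod>i\<in>UNIV. ?f (g i))"
      by (intro sum_mono2 finite_PiE prod_nonneg) (use J in \<open>auto simp: J_def\<close>)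
    also have "\<dots> = (\<Prod>i\<in>(UNIV :: 'n set). sum ?f J)"
      using J by (subst prod_sum_PiE) auto
    also have "\<dots> = sum ?f J ^ CARD('n)" by simp
    also have "\<dots> \<le> C ^ CARD('n)" by (intro power_mono C J sum_nonneg) simp
    finally show ?thesis .
  qed
  then show "bdd_above (sum (\<lambda>k :: int^'n. 1 / weight k ^ CARD('n)) ` {F. F \<subseteq> UNIV \<and> finite F})"
    by (intro bdd_aboveI[of _ "C ^ CARD('n)"]) auto
qed simp

subsection \<open>Decay of Fourier coefficients\<close>

text \<open>For k nonzero, 2M derivatives in the direction i of the largest coordinate produce
  k_i^(2M), and \<open>weight k\<close> is at most 2 n k_i^2. A single direction takes the place of
  powers of the Laplacian.\<close>

lemma pairing_decay:
  fixes \<phi> :: "real^'n::finite \<Rightarrow> complex"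
  assumes t: "test_function \<phi>" and B: "\<And>is x. length is \<le> 2 * M \<Longrightarrow> norm (iter_partial is \<phi> x) \<le> B"
  shows "weight k ^ M * norm (pairing k \<phi>) \<le> (2 * real CARD('n)) ^ M * (2 * pi) ^ CARD('n) * B"
proof -
  have B0: "B \<ge> 0" using order_trans[OF norm_ge_zero B[of "[]"]] by simp
  have c1: "1 \<le> real CARD('n)" by (simp add: Suc_leI)
  then have c2: "1 \<le> 2 * real CARD('n)" by linarith
  have le: "norm (pairing k (iter_partial is \<phi>)) \<le> B * (2 * pi) ^ CARD('n)" if "length is \<le> 2 * M" for "is"
    using that by (intro norm_pairing_le continuous_on_test_function test_function_iter_partial t B)
  show ?thesis
  proof (cases "k = 0")
    case True
    have "1 * norm (pairing k \<phi>) \<le> (2 * real CARD('n)) ^ M * (B * (2 * pi) ^ CARD('n))"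
      using le[of "[]"] by (intro mult_mono one_le_power c2) simp_all
    then show ?thesis using True by (simp add: weight_def mult_ac)
  next
    case False
    define m where "m = Max (range (\<lambda>i. \<bar>k $ i\<bar>))"
    have "m \<in> range (\<lambda>i. \<bar>k $ i\<bar>)" unfolding m_def by (intro Max_in) auto
    then obtain i where i: "m = \<bar>k $ i\<bar>" by blast
    have m: "\<bar>k $ j\<bar> \<le> \<bar>k $ i\<bar>" for j unfolding i[symmetric] m_def by (intro Max_ge) auto
    obtain j where "k $ j \<noteq> 0" using False by (auto simp: vec_eq_iff)
    then have "1 \<le> \<bar>k $ i\<bar>" using m[of j] by linarith
    then have "1 \<le> \<bar>real_of_int (k $ i)\<bar>" by linarith
    then have k1: "1 \<le> (real_of_int (k $ i))\<^sup>2" by (simp add: abs_le_square_iff[of 1, simplified])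
    have "(norm (real_vec k))\<^sup>2 \<le> (\<Sum>j\<in>(UNIV :: 'n set). (real_of_int (k $ i))\<^sup>2)"
      unfolding norm_real_vec_sq
    proof (rule sum_mono)
      fix j
      have "\<bar>real_of_int (k $ j)\<bar> \<le> \<bar>real_of_int (k $ i)\<bar>" using m[of j] by linarith
      then show "(real_of_int (k $ j))\<^sup>2 \<le> (real_of_int (k $ i))\<^sup>2" by (simp add: abs_le_square_iff)
    qed
    then have "weight k \<le> 1 + real CARD('n) * (real_of_int (k $ i))\<^sup>2" by (simp add: weight_def)
    \<comment> \<open>The summand 1 is absorbed, since k_i is a nonzero integer.\<close>
    also have "\<dots> \<le> real CARD('n) * (real_of_int (k $ i))\<^sup>2 + real CARD('n) * (real_of_int (k $ i))\<^sup>2"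
    proof -
      have "1 * 1 \<le> real CARD('n) * (real_of_int (k $ i))\<^sup>2"
        using k1 c1 by (intro mult_mono) simp_all
      then show ?thesis by simp
    qed
    finally have "weight k ^ M \<le> (2 * real CARD('n) * (real_of_int (k $ i))\<^sup>2) ^ M"
      using weight_pos[of k] by (intro power_mono) auto
    then have "weight k ^ M * norm (pairing k \<phi>) \<le>
       (2 * real CARD('n) * (real_of_int (k $ i))\<^sup>2) ^ M * norm (pairing k \<phi>)"
      by (intro mult_right_mono) auto
    also have "\<dots> = (2 * real CARD('n)) ^ M * norm (pairing k (iter_partial (replicate (2 * M) i) \<phi>))"
      unfolding pairing_iter_partial[OF t]
      by (simp add: norm_mult norm_power power_mult_distrib power_mult mult.assoc)
    also have "\<dots> \<le> (2 * real CARD('n)) ^ M * (B * (2 * pi) ^ CARD('n))"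
      by (intro mult_left_mono le) auto
    finally show ?thesis by (simp add: mult_ac)
  qed
qed

section \<open>Reduction to the fundamental cube and uniform bounds for test functions\<close>

lemma periodic_axis_int:
  fixes p :: "real^'n::finite \<Rightarrow> 'b"
  assumes p: "\<And>x i. p (x + axis i (2 * pi)) = p x"
  shows "p (x + axis i (2 * pi * real_of_int m)) = p x"
proof (induction m arbitrary: x rule: int_induct[where k = 0])
  case base
  have "axis i 0 = (0 :: real^'n)" by (simp add: axis_def vec_eq_iff)
  then show ?case by (simp only: of_int_0 mult_zero_right add_0_right)
next
  case (step1 m)
  have "axis i (2 * pi * real_of_int (m + 1)) = axis i (2 * pi * real_of_int m) + (axis i (2 * pi) :: real^'n)"
    by (simp add: axis_def vec_eq_iff algebra_simps)
  then show ?case using step1 p[of "x + axis i (2 * pi * real_of_int m)" i] by (simp add: add.assoc)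
next
  case (step2 m)
  have "axis i (2 * pi * real_of_int m) = axis i (2 * pi * real_of_int (m - 1)) + (axis i (2 * pi) :: real^'n)"
    by (simp add: axis_def vec_eq_iff algebra_simps)
  then show ?case using step2(2)[of x] p[of "x + axis i (2 * pi * real_of_int (m - 1))" i] by (simp add: add.assoc)
qed

text \<open>The point y is chosen before p, so that one y serves several periodic functions at
  once.\<close>

lemma periodic_reduce:
  fixes x :: "real^'n::finite"
  obtains y where "y \<in> torus" "\<And>p :: real^'n \<Rightarrow> 'b. (\<And>x i. p (x + axis i (2 * pi)) = p x) \<Longrightarrow> p x = p y"
proof -
  define m where "m i = \<lfloor>x $ i / (2 * pi)\<rfloor>" for i
  define y where "y = x + (\<Sum>i\<in>UNIV. axis i (2 * pi * real_of_int (- m i)))"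
  have yi: "y $ j = x $ j - 2 * pi * real_of_int (m j)" for j
    by (simp add: y_def axis_def if_distrib cong: if_cong)
  have "0 \<le> y $ j \<and> y $ j \<le> 2 * pi" for j
  proof -
    have "real_of_int (m j) \<le> x $ j / (2 * pi)" "x $ j / (2 * pi) \<le> real_of_int (m j) + 1"
      unfolding m_def by linarith+
    then show ?thesis unfolding yi by (simp add: field_simps)
  qed
  then have "y \<in> torus" by (auto simp: torus_def mem_box_cart)
  moreover have "p x = p y" if p: "\<And>x i. p (x + axis i (2 * pi)) = p x" for p :: "real^'n \<Rightarrow> 'b"
  proof -
    have "p (x + (\<Sum>i\<in>A. axis i (2 * pi * real_of_int (- m i)))) = p x" if "finite A" for A
      using that
    proof (induction A rule: finite_induct)
      case (insert i A)
      let ?z = "x + (\<Sum>i\<in>A. axis i (2 * pi * real_of_int (- m i)))"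
      have "p (?z + axis i (2 * pi * real_of_int (- m i))) = p ?z" by (rule periodic_axis_int[OF p])
      then show ?case using insert by (simp add: add_ac)
    qed simp
    then show ?thesis by (simp add: y_def)
  qed
  ultimately show ?thesis using that by blast
qed

text \<open>Compactness of the cube and periodicity bound each derivative; only finitely many index
  lists have length at most N, and the sum of their bounds serves them all.\<close>

lemma test_function_bounded:
  fixes \<phi> :: "real^'n::finite \<Rightarrow> complex"
  assumes t: "test_function \<phi>"
  obtains B where "\<And>is x. length is \<le> N \<Longrightarrow> norm (iter_partial is \<phi> x) \<le> B"
proof -
  have "\<exists>b. \<forall>x. norm (iter_partial is \<phi> x) \<le> b" for "is"
  proof -
    have ti: "test_function (iter_partial is \<phi>)" by (rule test_function_iter_partial[OF t])
    have "compact (iter_partial is \<phi> ` torus)"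
      unfolding torus_def by (intro compact_continuous_image continuous_on_test_function ti compact_cbox)
    then have "bounded (iter_partial is \<phi> ` torus)" by (rule compact_imp_bounded)
    then obtain b where b: "\<And>x. x \<in> torus \<Longrightarrow> norm (iter_partial is \<phi> x) \<le> b"
      unfolding bounded_iff by blast
    have "norm (iter_partial is \<phi> x) \<le> b" for x
      using periodic_reduce[of x] test_functionD(3)[OF ti] b by metis
    then show ?thesis by blast
  qed
  then obtain b where b: "\<And>is x. norm (iter_partial is \<phi> x) \<le> b is" by metis
  let ?L = "{is :: 'n list. set is \<subseteq> UNIV \<and> length is \<le> N}"
  have fin: "finite ?L" by (rule finite_lists_length_le) simp
  show ?thesis
  proof
    fix "is" :: "'n list" and x assume "length is \<le> N"
    then have "b is \<le> sum b ?L"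
      using order_trans[OF norm_ge_zero b] by (intro member_le_sum fin) auto
    with b[of "is" x] show "norm (iter_partial is \<phi> x) \<le> sum b ?L" by (rule order_trans)
  qed
qed

lemma summable_pairing:
  fixes \<phi> :: "real^'n::finite \<Rightarrow> complex"
  assumes t: "test_function \<phi>"
  shows "(\<lambda>k. weight k ^ N * norm (pairing k \<phi>)) summable_on UNIV"
proof -
  let ?M = "N + CARD('n)"
  obtain B where B: "\<And>is x. length is \<le> 2 * ?M \<Longrightarrow> norm (iter_partial is \<phi> x) \<le> B"
    using test_function_bounded[OF t] by metis
  define C where "C = (2 * real CARD('n)) ^ ?M * (2 * pi) ^ CARD('n) * B"
  show ?thesis
  proof (rule summable_on_comparison_test)
    show "(\<lambda>k :: int^'n. C * (1 / weight k ^ CARD('n))) summable_on UNIV"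
      by (intro summable_on_cmult_right summable_weight)
    fix k :: "int^'n"
    have "weight k ^ ?M * norm (pairing k \<phi>) \<le> C"
      unfolding C_def by (rule pairing_decay[OF t B])
    then show "weight k ^ N * norm (pairing k \<phi>) \<le> C * (1 / weight k ^ CARD('n))"
      by (simp add: power_add field_simps)
  qed simp
qed

subsection \<open>Completeness of the characters\<close>

text \<open>If all Fourier coefficients of \<open>\<psi>\<close> vanish then \<open>\<psi>\<close> is orthogonal to every polynomial, hence
  to every continuous function, of \<open>q x = \<Sum>i. 1 - cos (x i - x0 i)\<close>. A bump function of \<open>q\<close> supported near
  \<open>x0\<close> then forces \<open>\<psi> x0 = 0\<close>.\<close>

lemma pairing_eq_0_imp_eq_0:
  fixes \<psi> :: "real^'n::finite \<Rightarrow> complex"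
  assumes c: "continuous_on UNIV \<psi>" and 0: "\<And>k. pairing k \<psi> = 0" and x: "x \<in> torus"
  shows "\<psi> x = 0"
proof -
  let ?p = "(\<chi> i. 2 * pi) :: real^'n"
  have box_ne: "box 0 ?p \<noteq> {}"
    unfolding interval_ne_empty_cart by simp
  \<comment> \<open>For x0 in the open cube no other point of the closed cube is congruent to it
    modulo periods, so q vanishes there at x0 only. Boundary points follow by continuity at the
    end.\<close>
  have "\<psi> x0 = 0" if x0: "x0 \<in> box 0 ?p" for x0
  proof (rule ccontr)
    assume ne: "\<psi> x0 \<noteq> 0"
    \<comment> \<open>Rotation by the conjugate of \<open>\<psi> x0\<close> leaves a real function
      that is positive at x0.\<close>
    define u where "u x = Re (cnj (\<psi> x0) * \<psi> x)" for x
    have cu: "continuous_on S u" for S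
      unfolding u_def by (intro continuous_intros continuous_on_subset[OF c]) auto
    have u0: "u x0 > 0" using ne by (simp add: u_def complex_neq_0 power2_eq_square)
    define q where "q x = (\<Sum>i\<in>UNIV. 1 - cos (x $ i - x0 $ i))" for x :: "real^'n"
    have cq: "continuous_on S q" for S
      unfolding q_def by (intro continuous_intros)
    define N where "N = 2 * real CARD('n)"
    have q_range: "q x \<in> {0..N}" for x
    proof -
      have "q x \<le> (\<Sum>i\<in>(UNIV :: 'n set). 2)" unfolding q_def
      proof (rule sum_mono)
        fix i show "1 - cos (x $ i - x0 $ i) \<le> 2" using cos_ge_minus_one[of "x $ i - x0 $ i"] by linarith
      qed
      then show ?thesis by (auto simp: N_def q_def intro: sum_nonneg)
    qed
    \<comment> \<open>These multipliers keep all Fourier coefficients of \<open>\<psi>\<close> zero.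
      Characters only shift the index k, so A is closed under multiplication by them, hence by each
      1 - cos and by q.\<close>
    define A where "A = {p :: real^'n \<Rightarrow> complex. continuous_on UNIV p \<and> (\<forall>k. pairing k (\<lambda>x. p x * \<psi> x) = 0)}"
    have A1: "(\<lambda>x. 1) \<in> A" using 0 by (simp add: A_def)
    have Aadd: "(\<lambda>x. f x + g x) \<in> A" if "f \<in> A" "g \<in> A" for f g
    proof -
      have "pairing k (\<lambda>x. (f x + g x) * \<psi> x) = pairing k (\<lambda>x. f x * \<psi> x) + pairing k (\<lambda>x. g x * \<psi> x)" for k
        unfolding pairing_def distrib_left distrib_right using that
        by (intro integral_add integrable_torus continuous_intros continuous_on_echar c) (auto simp: A_def)
      then show ?thesis using that by (auto simp: A_def intro: continuous_intros)
    qed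
    have Acmult: "(\<lambda>x. a * f x) \<in> A" if "f \<in> A" for a f
      using that pairing_cmult[of _ a "\<lambda>x. f x * \<psi> x"] by (auto simp: A_def mult.assoc intro: continuous_intros)
    have Aechar: "(\<lambda>x. echar l x * f x) \<in> A" if "f \<in> A" for l f
    proof -
      have "pairing k (\<lambda>x. echar l x * f x * \<psi> x) = pairing (k + l) (\<lambda>x. f x * \<psi> x)" for k
        by (simp add: pairing_def echar_add mult.assoc)
      then show ?thesis using that by (auto simp: A_def intro!: continuous_intros continuous_on_echar)
    qed
    have A0: "(\<lambda>x. 0) \<in> A" using Acmult[OF A1, of 0] by simp
    have Asum: "(\<lambda>x. \<Sum>i\<in>I. f i x) \<in> A" if "finite I" "\<And>i. i \<in> I \<Longrightarrow> f i \<in> A" for I :: "'i set" and f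
      using that by (induction I rule: finite_induct) (auto intro: A0 Aadd)
    have Acos: "(\<lambda>x. (1 - of_real (cos (x $ i - x0 $ i))) * f x) \<in> A" if f: "f \<in> A" for i f
    proof -
      have e: "echar (axis i 1) x = cis (x $ i)" "echar (axis i (- 1)) x = cis (- (x $ i))" for x :: "real^'n"
      proof -
        have "real_vec (axis i r) \<bullet> x = real_of_int r * x $ i" for r
        proof -
          have "real_vec (axis i r) = axis i (real_of_int r)"
            by (simp add: vec_eq_iff real_vec_def axis_def)
          then show ?thesis by (simp add: inner_axis')
        qed
        then show "echar (axis i 1) x = cis (x $ i)" "echar (axis i (- 1)) x = cis (- (x $ i))"
          by (simp_all add: echar_def)
      qed
      have "(\<lambda>x. 1 * f x + (- cis (- (x0 $ i)) / 2 * (echar (axis i 1) x * f x) +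
          - cis (x0 $ i) / 2 * (echar (axis i (- 1)) x * f x))) \<in> A"
        by (intro Aadd Acmult Aechar f)
      moreover have "1 * f x + (- cis (- (x0 $ i)) / 2 * (echar (axis i 1) x * f x) +
          - cis (x0 $ i) / 2 * (echar (axis i (- 1)) x * f x)) =
          (1 - (cis (- (x0 $ i)) * cis (x $ i) + cis (x0 $ i) * cis (- (x $ i))) / 2) * f x" for x
        unfolding e by (simp add: field_simps)
      moreover have "(cis (- (x0 $ i)) * cis (x $ i) + cis (x0 $ i) * cis (- (x $ i))) / 2 =
          of_real (cos (x $ i - x0 $ i))" for x
        by (simp add: complex_eq_iff cos_diff sin_diff)
      ultimately show ?thesis by simp
    qed
    have Aq: "(\<lambda>x. of_real (q x) * f x) \<in> A" if "f \<in> A" for f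
    proof -
      have "(\<lambda>x. \<Sum>i\<in>UNIV. (1 - of_real (cos (x $ i - x0 $ i))) * f x) \<in> A"
        by (intro Asum Acos that) auto
      then show ?thesis by (simp add: q_def sum_distrib_right)
    qed
    have Apow: "(\<lambda>x. of_real (q x) ^ j) \<in> A" for j
      by (induction j) (auto intro: A1 Aq)
    have poly0: "integral torus (\<lambda>x. P (q x) * u x) = 0" if P: "real_polynomial_function P" for P :: "real \<Rightarrow> real"
    proof -
      obtain a n where P: "P = (\<lambda>t. \<Sum>i\<le>n. a i * t ^ i)"
        using P real_polynomial_function_iff_sum[of P] by blast
      have "(\<lambda>x. cnj (\<psi> x0) * (\<Sum>i\<le>n. of_real (a i) * of_real (q x) ^ i)) \<in> A"
        by (intro Acmult Asum Apow) auto
      moreover have "cnj (\<psi> x0) * (\<Sum>i\<le>n. of_real (a i) * of_real (q x) ^ i) = cnj (\<psi> x0) * of_real (P (q x))" for x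
        by (simp add: P)
      ultimately have PA: "(\<lambda>x. cnj (\<psi> x0) * of_real (P (q x))) \<in> A" by simp
      then have "pairing 0 (\<lambda>x. cnj (\<psi> x0) * of_real (P (q x)) * \<psi> x) = 0" by (simp add: A_def)
      then have "Re (integral torus (\<lambda>x. cnj (\<psi> x0) * of_real (P (q x)) * \<psi> x)) = 0"
        by (simp add: pairing_def)
      moreover have "(\<lambda>x. cnj (\<psi> x0) * of_real (P (q x)) * \<psi> x) integrable_on torus"
        using PA by (intro integrable_torus continuous_on_mult[OF _ c]) (simp only: A_def mem_Collect_eq)
      then have "integral torus (\<lambda>x. Re (cnj (\<psi> x0) * of_real (P (q x)) * \<psi> x)) =
          Re (integral torus (\<lambda>x. cnj (\<psi> x0) * of_real (P (q x)) * \<psi> x))"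
        by (rule integral_linear[OF _ bounded_linear_Re, unfolded o_def])
      moreover have "Re (cnj (\<psi> x0) * of_real (P (q x)) * \<psi> x) = P (q x) * u x" for x
        by (simp add: u_def algebra_simps)
      ultimately show ?thesis by simp
    qed
    have int: "f integrable_on torus" if "continuous_on UNIV f" for f :: "real^'n \<Rightarrow> real"
      unfolding torus_def by (rule integrable_continuous) (use that continuous_on_subset in blast)
    have cont0: "integral torus (\<lambda>x. h (q x) * u x) = 0" if h: "continuous_on UNIV h" for h :: "real \<Rightarrow> real"
    proof -
      have chq: "continuous_on UNIV (\<lambda>x. h (q x))"
        by (rule continuous_on_compose2[OF h cq]) auto
      have "compact (u ` torus)"
        unfolding torus_def by (intro compact_continuous_image cu compact_cbox)
      then have "bounded (u ` torus)" by (rule compact_imp_bounded)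
      then obtain M where M: "\<And>x. x \<in> torus \<Longrightarrow> \<bar>u x\<bar> \<le> M" "M > 0"
        by (auto simp: bounded_pos)
      define V where "V = (2 * pi) ^ CARD('n)"
      have V: "V > 0" by (simp add: V_def)
      have le: "\<bar>integral torus (\<lambda>x. h (q x) * u x)\<bar> \<le> 0 + e" if e: "e > 0" for e
      proof -
        \<comment> \<open>M bounds |u| and V is the volume of the torus, so approximating h to this
          accuracy changes the integral by at most e.\<close>
        have e': "e / (M * V) > 0" using e M V by simp
        obtain P where P: "real_polynomial_function P" "\<And>t. t \<in> {0..N} \<Longrightarrow> \<bar>h t - P t\<bar> < e / (M * V)"
          using Stone_Weierstrass_real_polynomial_function[OF compact_Icc continuous_on_subset[OF h] e', of 0 N]
          by auto
        have cP: "continuous_on UNIV P" using P(1) by (intro continuous_at_imp_continuous_on ballI continuous_real_polymonial_function)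
        have cPq: "continuous_on UNIV (\<lambda>x. P (q x))"
          by (rule continuous_on_compose2[OF cP cq]) auto
        have "integral torus (\<lambda>x. h (q x) * u x) = integral torus (\<lambda>x. h (q x) * u x) - integral torus (\<lambda>x. P (q x) * u x)"
          using poly0[OF P(1)] by simp
        also have "\<dots> = integral torus (\<lambda>x. h (q x) * u x - P (q x) * u x)"
          by (intro integral_diff[symmetric] int continuous_intros chq cPq cu)
        finally have "norm (integral torus (\<lambda>x. h (q x) * u x)) =
            norm (integral (cbox 0 ?p) (\<lambda>x. h (q x) * u x - P (q x) * u x))" by (simp add: torus_def)
        also have "\<dots> \<le> e / V * measure lborel (cbox 0 ?p)"
        proof (rule integrable_bound)
          show "(\<lambda>x. h (q x) * u x - P (q x) * u x) integrable_on cbox 0 ?p"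
            unfolding torus_def[symmetric] by (intro int continuous_intros chq cPq cu)
          fix x assume x: "x \<in> cbox 0 ?p"
          have "norm (h (q x) * u x - P (q x) * u x) = \<bar>h (q x) - P (q x)\<bar> * \<bar>u x\<bar>"
            by (simp add: abs_mult flip: left_diff_distrib)
          also have "\<dots> \<le> e / (M * V) * M"
            using P(2)[OF q_range[of x]] M(1)[of x] x e' by (intro mult_mono) (auto simp: torus_def)
          also have "\<dots> = e / V" using M by simp
          finally show "norm (h (q x) * u x - P (q x) * u x) \<le> e / V" .
        qed (use e V in simp)
        also have "\<dots> = e" using V unfolding torus_def[symmetric] measure_torus by (simp add: V_def)
        finally show ?thesis by simp
      qed
      have "\<bar>integral torus (\<lambda>x. h (q x) * u x)\<bar> \<le> 0" by (rule field_le_epsilon[OF le])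
      then show ?thesis by simp
    qed
    have q_pos: "q x > 0" if x: "x \<in> torus" "u x \<le> 0" for x
    proof (rule ccontr)
      assume "\<not> q x > 0"
      then have "q x = 0" using q_range[of x] by simp
      then have z: "1 - cos (x $ i - x0 $ i) = 0" for i
        unfolding q_def by (subst (asm) sum_nonneg_eq_0_iff) auto
      have "x $ i = x0 $ i" for i
      proof -
        have "cos (x $ i - x0 $ i) = 1" using z[of i] by simp
        then obtain n :: int where n: "x $ i - x0 $ i = real_of_int n * 2 * pi"
          unfolding cos_one_2pi_int by blast
        have "\<bar>x $ i - x0 $ i\<bar> < 2 * pi"
        proof -
          have "0 \<le> x $ i" "x $ i \<le> 2 * pi" "0 < x0 $ i" "x0 $ i < 2 * pi"
            using x(1) x0 by (auto simp: torus_def mem_box_cart)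
          then show ?thesis by linarith
        qed
        then have "\<bar>real_of_int n\<bar> < 1" unfolding n by (simp add: abs_mult)
        then have "n = 0" by linarith
        then show ?thesis using n by simp
      qed
      then have "x = x0" by (simp add: vec_eq_iff)
      then show False using x(2) u0 by simp
    qed
    \<comment> \<open>On this compact set q has a positive lower bound \<open>\<eta>\<close>, so the
      bump \<open>max 0 (\<eta> - t)\<close> of q vanishes there and its product with u is
      nonnegative on the whole torus.\<close>
    define K where "K = {x \<in> torus. u x \<le> 0}"
    have "closed {x. u x \<le> 0}" using cu by (intro closed_Collect_le continuous_intros) auto
    then have "compact (cbox 0 ?p \<inter> {x. u x \<le> 0})" by (rule compact_Int_closed[OF compact_cbox])
    moreover have "K = cbox 0 ?p \<inter> {x. u x \<le> 0}" by (auto simp: K_def torus_def)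
    ultimately have "compact K" by simp
    then obtain \<eta> where \<eta>: "\<eta> > 0" "\<And>x. x \<in> K \<Longrightarrow> \<eta> \<le> q x"
    proof (cases "K = {}")
      case False
      obtain y where "y \<in> K" "\<And>x. x \<in> K \<Longrightarrow> q y \<le> q x"
        using continuous_attains_inf[OF \<open>compact K\<close> False cq] by auto
      moreover from this have "q y > 0" using q_pos by (simp add: K_def)
      ultimately show ?thesis using that[of "q y"] by simp
    qed (use that[of 1] in auto)
    define h where "h t = max 0 (\<eta> - t)" for t :: real
    have ch: "continuous_on UNIV h" unfolding h_def by (intro continuous_intros)
    have chq: "continuous_on UNIV (\<lambda>x. h (q x))"
      by (rule continuous_on_compose2[OF ch cq]) auto
    \<comment> \<open>A nonnegative continuous function with integral 0 vanishes, whereas the value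
      at x0 is \<open>\<eta> * u x0\<close>, which is positive.\<close>
    have "h (q x0) * u x0 = 0"
    proof (rule has_integral_0_cbox_imp_0[OF _ _ _ box_ne])
      show "continuous_on (cbox 0 ?p) (\<lambda>x. h (q x) * u x)"
        by (intro continuous_intros continuous_on_subset[OF chq] cu) auto
      show "((\<lambda>x. h (q x) * u x) has_integral 0) (cbox 0 ?p)"
        using cont0[OF ch] integrable_integral[OF int[of "\<lambda>x. h (q x) * u x"]]
        by (simp add: torus_def continuous_on_mult chq cu)
      show "x0 \<in> cbox 0 ?p" using x0 box_subset_cbox by blast
      fix x assume "x \<in> box 0 ?p"
      then have "x \<in> torus" using box_subset_cbox unfolding torus_def by blast
      then show "0 \<le> h (q x) * u x"
        using \<eta>(2)[of x] by (cases "u x \<le> 0") (auto simp: h_def K_def)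
    qed
    moreover have "q x0 = 0" by (simp add: q_def)
    ultimately show False using u0 \<eta>(1) by (simp add: h_def)
  qed
  then have "\<And>x. x \<in> box 0 ?p \<Longrightarrow> \<psi> x = 0" by blast
  moreover have "closure (box 0 ?p) = torus" using closure_box[OF box_ne] by (simp add: torus_def)
  ultimately show ?thesis
    using continuous_constant_on_closure[of "box 0 ?p" \<psi> 0 x] continuous_on_subset[OF c] x by auto
qed


subsection \<open>Fourier inversion\<close>

lemma tail_tendsto_0:
  fixes a :: "'i \<Rightarrow> real"
  assumes a: "a summable_on UNIV"
  shows "((\<lambda>F. infsum a (- F)) \<longlongrightarrow> 0) (finite_subsets_at_top UNIV)"
proof -
  have "((\<lambda>F. infsum a UNIV - sum a F) \<longlongrightarrow> infsum a UNIV - infsum a UNIV) (finite_subsets_at_top UNIV)"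
    using has_sum_infsum[OF a] by (intro tendsto_intros) (simp add: has_sum_def)
  moreover have "\<forall>\<^sub>F F in finite_subsets_at_top UNIV. infsum a UNIV - sum a F = infsum a (- F)"
  proof (rule eventually_finite_subsets_at_top_weakI)
    fix F :: "'i set" assume F: "finite F"
    have "infsum a (F \<union> - F) = infsum a F + infsum a (- F)"
      using F by (intro infsum_Un_disjoint summable_on_subset_banach[OF a]) auto
    then show "infsum a UNIV - sum a F = infsum a (- F)" using F by simp
  qed
  ultimately show ?thesis by (subst (asm) tendsto_cong) auto
qed

text \<open>The bound depends on f only through its majorant a, so it is uniform over all series
  with a common majorant.\<close>

lemma norm_infsum_diff_le:
  fixes f :: "'i \<Rightarrow> 'a::banach"
  assumes a: "a summable_on UNIV" and le: "\<And>k. norm (f k) \<le> a k" and F: "finite F"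
  shows "norm (infsum f UNIV - sum f F) \<le> infsum a (- F)"
proof -
  have sf: "f summable_on UNIV"
    by (rule abs_summable_summable, rule summable_on_comparison_test[OF a]) (use le in auto)
  have "infsum f (F \<union> - F) = infsum f F + infsum f (- F)"
    using F by (intro infsum_Un_disjoint summable_on_subset_banach[OF sf]) auto
  then have "infsum f UNIV - sum f F = infsum f (- F)" using F by simp
  also have "norm \<dots> \<le> infsum a (- F)"
    by (rule norm_infsum_le[OF has_sum_infsum has_sum_infsum])
      (auto intro: summable_on_subset_banach sf a le)
  finally show ?thesis .
qed

lemma norm_fourier_term:
  "norm (pairing k \<phi> / (2 * pi) ^ CARD('n) * echar (- k) x) = norm (pairing k \<phi>) / (2 * pi) ^ CARD('n)"
  for \<phi> :: "real^'n::finite \<Rightarrow> complex"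
  by (simp add: norm_mult norm_divide norm_power)

lemma summable_norm_pairing:
  fixes \<phi> :: "real^'n::finite \<Rightarrow> complex"
  assumes "test_function \<phi>"
  shows "(\<lambda>k. norm (pairing k \<phi>) / (2 * pi) ^ CARD('n)) summable_on UNIV"
  using summable_on_cmult_left[OF summable_pairing[OF assms, of 0], of "1 / (2 * pi) ^ CARD('n)"] by simp

text \<open>The series converges uniformly to a continuous S with the same pairings as
  \<open>\<phi>\<close>. Completeness of the characters gives equality on the torus, and periodicity
  carries it to the whole space.\<close>

lemma fourier_inversion:
  fixes \<phi> :: "real^'n::finite \<Rightarrow> complex"
  assumes t: "test_function \<phi>"
  shows "\<phi> x = (\<Sum>\<^sub>\<infinity>k. pairing k \<phi> / (2 * pi) ^ CARD('n) * echar (- k) x)"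
proof -
  define a where "a k = norm (pairing k \<phi>) / (2 * pi) ^ CARD('n)" for k
  define f where "f k x = pairing k \<phi> / (2 * pi) ^ CARD('n) * echar (- k) x" for k x
  define S where "S x = (\<Sum>\<^sub>\<infinity>k. f k x)" for x
  have a: "a summable_on UNIV" unfolding a_def by (rule summable_norm_pairing[OF t])
  have tail: "norm (S x - (\<Sum>k\<in>F. f k x)) \<le> infsum a (- F)" if "finite F" for F x
    unfolding S_def by (rule norm_infsum_diff_le[OF a _ that]) (simp only: f_def a_def norm_fourier_term order_refl)
  note lim = tail_tendsto_0[OF a]
  have tf: "test_function (f k)" for k
    unfolding f_def by (intro test_function_cmult test_function_echar)
  have unif: "uniform_limit UNIV (\<lambda>F x. \<Sum>k\<in>F. f k x) S (finite_subsets_at_top UNIV)"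
    unfolding uniform_limit_iff
  proof (intro allI impI)
    fix e :: real assume "e > 0"
    then have "\<forall>\<^sub>F F in finite_subsets_at_top UNIV. infsum a (- F) < e"
      using lim by (rule order_tendstoD(2)[rotated])
    moreover have "\<forall>\<^sub>F F in finite_subsets_at_top UNIV. finite (F :: (int^'n) set)"
      by (rule eventually_finite_subsets_at_top_weakI)
    ultimately show "\<forall>\<^sub>F F in finite_subsets_at_top UNIV. \<forall>x\<in>UNIV. dist (\<Sum>k\<in>F. f k x) (S x) < e"
    proof eventually_elim
      case (elim F)
      then show ?case using tail[of F] by (auto simp: dist_norm norm_minus_commute intro: order_le_less_trans)
    qed
  qed
  have cS: "continuous_on UNIV S"
    by (rule uniform_limit_theorem[OF _ unif])
      (auto intro!: always_eventually continuous_on_test_function test_function_sum tf)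
  have pS: "pairing j S = pairing j \<phi>" for j
  proof -
    \<comment> \<open>Once F contains j, the partial sum already has the right j-th pairing, so only
      the uniform tail separates S from \<open>\<phi>\<close>.\<close>
    have pF: "pairing j (\<lambda>x. \<Sum>k\<in>F. f k x) = pairing j \<phi>" if "finite F" "j \<in> F" for F
    proof -
      have "pairing j (\<lambda>x. \<Sum>k\<in>F. f k x) = (\<Sum>k\<in>F. if j = k then pairing k \<phi> else 0)"
        unfolding pairing_sum[OF tf] unfolding f_def[abs_def] pairing_cmult pairing_echar
        by (intro sum.cong) auto
      then show ?thesis using that by simp
    qed
    have "norm (pairing j S - pairing j \<phi>) \<le> infsum a (- F) * (2 * pi) ^ CARD('n)" if "finite F" "j \<in> F" for F
    proof -
      have cF: "continuous_on UNIV (\<lambda>x. \<Sum>k\<in>F. f k x)"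
        by (intro continuous_on_test_function test_function_sum tf)
      have "pairing j S - pairing j \<phi> = pairing j (\<lambda>x. S x - (\<Sum>k\<in>F. f k x))"
        unfolding pF[OF that, symmetric] unfolding pairing_def right_diff_distrib
        by (intro integral_diff[symmetric] integrable_torus continuous_on_mult continuous_on_echar cS cF)
      also have "norm \<dots> \<le> infsum a (- F) * (2 * pi) ^ CARD('n)"
        by (intro norm_pairing_le continuous_intros cS cF tail that)
      finally show ?thesis .
    qed
    then have "\<forall>\<^sub>F F in finite_subsets_at_top UNIV. norm (pairing j S - pairing j \<phi>) \<le> infsum a (- F) * (2 * pi) ^ CARD('n)"
      unfolding eventually_finite_subsets_at_top by (intro exI[of _ "{j}"]) auto
    moreover have "((\<lambda>F. infsum a (- F) * (2 * pi) ^ CARD('n)) \<longlongrightarrow> 0 * (2 * pi) ^ CARD('n)) (finite_subsets_at_top UNIV)"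
      by (intro tendsto_intros lim)
    ultimately have "norm (pairing j S - pairing j \<phi>) \<le> 0 * (2 * pi) ^ CARD('n)"
      by (intro tendsto_lowerbound) auto
    then show ?thesis by simp
  qed
  have "pairing j (\<lambda>x. \<phi> x - S x) = 0" for j
    using pS[of j] unfolding pairing_def right_diff_distrib
    by (subst integral_diff) (auto intro!: integrable_torus continuous_on_mult continuous_on_echar cS continuous_on_test_function[OF t])
  then have eq: "\<phi> y - S y = 0" if "y \<in> torus" for y
    by (intro pairing_eq_0_imp_eq_0[of "\<lambda>x. \<phi> x - S x"] that continuous_intros continuous_on_test_function t cS)
  obtain y where y: "y \<in> torus" "\<And>p :: real^'n \<Rightarrow> complex. (\<And>x i. p (x + axis i (2 * pi)) = p x) \<Longrightarrow> p x = p y"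
    using periodic_reduce[of x] by metis
  have "S x = S y" by (rule y(2)) (simp add: S_def f_def echar_periodic)
  moreover have "\<phi> x = \<phi> y" by (rule y(2)) (rule test_functionD(3)[OF t])
  ultimately show ?thesis using eq[OF y(1)] by (simp add: S_def f_def)
qed

subsection \<open>Dominated convergence and termwise differentiation\<close>

text \<open>Dominated convergence for unordered sums along an arbitrary filter; it is applied to
  difference quotients as h -> 0 and to squared Sobolev norms as beta -> n + 2. Outside a finite set
  both sums are small by the majorant, and inside it only a finite sum has to converge.\<close>

lemma tannery:
  fixes f :: "'b \<Rightarrow> 'i \<Rightarrow> 'a::banach"
  assumes lim: "\<And>k. ((\<lambda>x. f x k) \<longlongrightarrow> g k) \<F>"
    and dom: "\<forall>\<^sub>F x in \<F>. \<forall>k. norm (f x k) \<le> D k" and D: "D summable_on UNIV" and nt: "\<F> \<noteq> bot"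
  shows "((\<lambda>x. \<Sum>\<^sub>\<infinity>k. f x k) \<longlongrightarrow> (\<Sum>\<^sub>\<infinity>k. g k)) \<F>"
proof (rule tendstoI)
  fix e :: real assume e: "e > 0"
  have g: "norm (g k) \<le> D k" for k
    using tendsto_norm[OF lim] by (rule tendsto_upperbound) (use dom nt in \<open>auto elim: eventually_mono\<close>)
  have "\<forall>\<^sub>F F in finite_subsets_at_top UNIV. infsum D (- F) < e / 3"
    using tail_tendsto_0[OF D] e by (intro order_tendstoD) auto
  moreover have "\<forall>\<^sub>F F in finite_subsets_at_top UNIV. finite (F :: 'i set)"
    by (rule eventually_finite_subsets_at_top_weakI)
  ultimately have "\<forall>\<^sub>F F in finite_subsets_at_top UNIV. infsum D (- F) < e / 3 \<and> finite F"
    by eventually_elim simp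
  then obtain F where F: "infsum D (- F) < e / 3" "finite F"
    using eventually_happens' finite_subsets_at_top_neq_bot by blast
  have "((\<lambda>x. \<Sum>k\<in>F. f x k) \<longlongrightarrow> (\<Sum>k\<in>F. g k)) \<F>" by (intro tendsto_sum lim)
  then have "\<forall>\<^sub>F x in \<F>. dist (\<Sum>k\<in>F. f x k) (\<Sum>k\<in>F. g k) < e / 3"
    by (rule tendstoD) (use e in simp)
  with dom show "\<forall>\<^sub>F x in \<F>. dist (\<Sum>\<^sub>\<infinity>k. f x k) (\<Sum>\<^sub>\<infinity>k. g k) < e"
  proof eventually_elim
    case (elim x)
    have "norm (infsum (f x) UNIV - sum (f x) F) < e / 3"
      using norm_infsum_diff_le[OF D _ F(2), of "f x"] elim F(1) by force
    moreover have "norm (infsum g UNIV - sum g F) < e / 3"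
      using norm_infsum_diff_le[OF D g F(2)] F(1) by linarith
    ultimately show ?case using elim(2)
      norm_triangle_ineq4[of "infsum (f x) UNIV - sum (f x) F + (sum (f x) F - sum g F)" "infsum g UNIV - sum g F"]
      norm_triangle_ineq[of "infsum (f x) UNIV - sum (f x) F" "sum (f x) F - sum g F"]
      by (simp add: dist_norm)
  qed
qed

lemma summable_on_dominated:
  fixes f :: "'i \<Rightarrow> 'a::banach"
  assumes "D summable_on A" "\<And>k. k \<in> A \<Longrightarrow> norm (f k) \<le> D k"
  shows "f summable_on A"
  by (rule abs_summable_summable, rule summable_on_comparison_test[OF assms]) auto

text \<open>The normalised remainder of the k-th term is at most 2 D k by the mean value inequality
  and tends to 0, so \<open>tannery\<close> applies.\<close>

lemma has_vector_derivative_infsum: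
  fixes u v :: "'i \<Rightarrow> real \<Rightarrow> 'a::banach"
  assumes u: "\<And>k t. (u k has_vector_derivative v k t) (at t)"
    and v: "\<And>k t. \<bar>t\<bar> \<le> R \<Longrightarrow> norm (v k t) \<le> D k" and D: "D summable_on UNIV"
    and su: "\<And>t. (\<lambda>k. u k t) summable_on UNIV" and t: "\<bar>t\<bar> < R"
  shows "((\<lambda>t. \<Sum>\<^sub>\<infinity>k. u k t) has_vector_derivative (\<Sum>\<^sub>\<infinity>k. v k t)) (at t)"
  unfolding has_vector_derivative_def has_derivative_at
proof (intro conjI bounded_linear_scaleR_left)
  have sv: "(\<lambda>k. v k t) summable_on UNIV"
    using t by (intro summable_on_dominated[OF D] v) auto
  define r where "r h k = (1 / norm h) *\<^sub>R (u k (t + h) - u k t - h *\<^sub>R v k t)" for h k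
  have rsum: "(\<Sum>\<^sub>\<infinity>k. r h k) = (1 / norm h) *\<^sub>R
      ((\<Sum>\<^sub>\<infinity>k. u k (t + h)) - (\<Sum>\<^sub>\<infinity>k. u k t) - h *\<^sub>R (\<Sum>\<^sub>\<infinity>k. v k t))" for h
  proof -
    have "((\<lambda>k. (1 / norm h) *\<^sub>R (u k (t + h) + (- 1) *\<^sub>R u k t + (- h) *\<^sub>R v k t)) has_sum (1 / norm h) *\<^sub>R
      ((\<Sum>\<^sub>\<infinity>k. u k (t + h)) + (- 1) *\<^sub>R (\<Sum>\<^sub>\<infinity>k. u k t) + (- h) *\<^sub>R (\<Sum>\<^sub>\<infinity>k. v k t))) UNIV"
      by (intro has_sum_scaleR has_sum_add has_sum_infsum su sv)
    then show ?thesis by (intro infsumI) (simp add: r_def)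
  qed
  have "((\<lambda>h. \<Sum>\<^sub>\<infinity>k. r h k) \<longlongrightarrow> (\<Sum>\<^sub>\<infinity>k::'i. 0)) (at 0)"
  proof (rule tannery)
    show "((\<lambda>h. r h k) \<longlongrightarrow> 0) (at 0)" for k
    proof -
      have "(\<lambda>h. norm (u k (t + h) - u k t - h *\<^sub>R v k t) / norm h) \<midarrow>0\<rightarrow> 0"
        using u[of k t] by (simp add: has_vector_derivative_def has_derivative_at)
      then show ?thesis
        by (intro tendsto_norm_zero_cancel[of "\<lambda>h. r h k"]) (simp add: r_def)
    qed
    have "\<forall>\<^sub>F h::real in at 0. \<bar>h\<bar> < R - \<bar>t\<bar>"
      unfolding eventually_at using t by (intro exI[of _ "R - \<bar>t\<bar>"]) auto
    then show "\<forall>\<^sub>F h in at 0. \<forall>k. norm (r h k) \<le> 2 * D k"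
    proof eventually_elim
      case (elim h)
      show ?case
      proof
        fix k
        have D0: "0 \<le> D k" using order_trans[OF norm_ge_zero v[of t k]] t by simp
        have "norm (u k (t + h) - u k t) \<le> D k * norm ((t + h) - t)"
        proof (rule differentiable_bound[where S = "{-R..R}"])
          show "(u k has_derivative (\<lambda>x. x *\<^sub>R v k s)) (at s within {-R..R})" for s
            using has_vector_derivative_at_within[OF u] by (simp add: has_vector_derivative_def)
          show "onorm (\<lambda>x. x *\<^sub>R v k s) \<le> D k" if "s \<in> {-R..R}" for s
          proof (rule onorm_le)
            have "norm (v k s) \<le> D k" using v that by auto
            then show "norm (x *\<^sub>R v k s) \<le> D k * norm x" for x
              by (simp add: mult.commute[of "D k"] mult_left_mono)
          qed
        qed (use elim t in auto)
        then have "norm (u k (t + h) - u k t) \<le> D k * \<bar>h\<bar>" by simp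
        moreover have "norm (h *\<^sub>R v k t) \<le> \<bar>h\<bar> * D k"
          using v[of t k] t by (simp add: mult_left_mono)
        ultimately have "norm (u k (t + h) - u k t - h *\<^sub>R v k t) \<le> D k * \<bar>h\<bar> + \<bar>h\<bar> * D k"
          using norm_triangle_ineq4[of "u k (t + h) - u k t" "h *\<^sub>R v k t"] by linarith
        then have "(1 / \<bar>h\<bar>) * norm (u k (t + h) - u k t - h *\<^sub>R v k t) \<le> (1 / \<bar>h\<bar>) * (2 * D k * \<bar>h\<bar>)"
          by (intro mult_left_mono) auto
        also have "\<dots> \<le> 2 * D k" using D0 by simp
        finally show "norm (r h k) \<le> 2 * D k" by (simp add: r_def)
      qed
    qed
    show "(\<lambda>k. 2 * D k) summable_on UNIV" by (intro summable_on_cmult_right D)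
  qed auto
  then have "((\<lambda>h. norm (\<Sum>\<^sub>\<infinity>k. r h k)) \<longlongrightarrow> 0) (at 0)" by (simp add: tendsto_norm_zero)
  then show "(\<lambda>h. norm ((\<Sum>\<^sub>\<infinity>k. u k (t + h)) - (\<Sum>\<^sub>\<infinity>k. u k t) - h *\<^sub>R (\<Sum>\<^sub>\<infinity>k. v k t)) / norm h) \<midarrow>0\<rightarrow> 0"
    by (simp add: rsum)
qed

subsection \<open>Periodic distributions and their Fourier coefficients\<close>

text \<open>For complex values these are precisely the coefficient families of periodic
  distributions. The codomain is general because the real frequencies have to satisfy the same kind
  of bound.\<close>

definition poly_bounded :: "(int^'n::finite \<Rightarrow> 'a::real_normed_vector) \<Rightarrow> bool" where
  "poly_bounded c \<longleftrightarrow> (\<exists>C N. \<forall>k. norm (c k) \<le> C * weight k ^ N)"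

lemma poly_boundedI: "(\<And>k. norm (c k) \<le> C * weight k ^ N) \<Longrightarrow> poly_bounded c"
  by (auto simp: poly_bounded_def)

lemma poly_boundedE:
  fixes c :: "int^'n::finite \<Rightarrow> 'a::real_normed_vector"
  assumes "poly_bounded c"
  obtains C N where "C \<ge> 0" "\<And>k. norm (c k) \<le> C * weight k ^ N"
proof -
  obtain C N where C: "\<And>k. norm (c k) \<le> C * weight k ^ N" using assms by (auto simp: poly_bounded_def)
  have "0 \<le> C * weight (0 :: int^'n) ^ N" using order_trans[OF norm_ge_zero C] .
  then have "C \<ge> 0" by (simp add: weight_def)
  then show ?thesis using C that by blast
qed

lemma poly_bounded_mono:
  assumes "poly_bounded c" "\<And>k. norm (d k) \<le> norm (c k)"
  shows "poly_bounded d"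
  using assms unfolding poly_bounded_def by (meson order_trans)

lemma poly_bounded_mult:
  fixes c d :: "int^'n::finite \<Rightarrow> 'a::real_normed_algebra"
  assumes "poly_bounded c" "poly_bounded d"
  shows "poly_bounded (\<lambda>k. c k * d k)"
proof -
  obtain C N where C: "C \<ge> 0" "\<And>k. norm (c k) \<le> C * weight k ^ N" using poly_boundedE[OF assms(1)] by metis
  obtain C' N' where C': "C' \<ge> 0" "\<And>k. norm (d k) \<le> C' * weight k ^ N'" using poly_boundedE[OF assms(2)] by metis
  show ?thesis
  proof (rule poly_boundedI)
    fix k
    have "norm (c k * d k) \<le> norm (c k) * norm (d k)" by (rule norm_mult_ineq)
    also have "\<dots> \<le> (C * weight k ^ N) * (C' * weight k ^ N')"
      using C C' by (intro mult_mono) auto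
    finally show "norm (c k * d k) \<le> C * C' * weight k ^ (N + N')" by (simp add: power_add mult_ac)
  qed
qed

lemma poly_bounded_add:
  assumes "poly_bounded c" "poly_bounded d"
  shows "poly_bounded (\<lambda>k. c k + d k)"
proof -
  obtain C N where C: "C \<ge> 0" "\<And>k. norm (c k) \<le> C * weight k ^ N" using poly_boundedE[OF assms(1)] by metis
  obtain C' N' where C': "C' \<ge> 0" "\<And>k. norm (d k) \<le> C' * weight k ^ N'" using poly_boundedE[OF assms(2)] by metis
  show ?thesis
  proof (rule poly_boundedI)
    fix k
    have "norm (c k + d k) \<le> norm (c k) + norm (d k)" by (rule norm_triangle_ineq)
    also have "\<dots> \<le> C * weight k ^ (N + N') + C' * weight k ^ (N + N')"
      using C C' weight_ge_1[of k] by (intro add_mono order_trans[OF C(2)] order_trans[OF C'(2)] mult_left_mono power_increasing) auto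
    finally show "norm (c k + d k) \<le> (C + C') * weight k ^ (N + N')" by (simp add: algebra_simps)
  qed
qed

lemma poly_bounded_const: "poly_bounded (\<lambda>k. c)"
  by (rule poly_boundedI[of _ "norm c" 0]) simp

lemma poly_bounded_of_real:
  "poly_bounded (\<lambda>k. of_real (c k) :: 'a::real_normed_algebra_1) \<longleftrightarrow> poly_bounded c"
  by (simp add: poly_bounded_def)

lemma summable_fourier_series:
  fixes \<phi> :: "real^'n::finite \<Rightarrow> complex"
  assumes c: "poly_bounded c" and t: "test_function \<phi>"
  shows "(\<lambda>k. norm (c k * pairing k \<phi>)) summable_on UNIV"
proof -
  obtain C N where C: "C \<ge> 0" "\<And>k. norm (c k) \<le> C * weight k ^ N" using poly_boundedE[OF c] by metis
  show ?thesis
  proof (rule summable_on_comparison_test)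
    show "(\<lambda>k. C * (weight k ^ N * norm (pairing k \<phi>))) summable_on UNIV"
      by (intro summable_on_cmult_right summable_pairing t)
    show "norm (c k * pairing k \<phi>) \<le> C * (weight k ^ N * norm (pairing k \<phi>))" for k
      using C(2)[of k] unfolding norm_mult mult.assoc[symmetric] by (intro mult_right_mono) auto
  qed simp
qed

lemma summable_fourier_series':
  assumes "poly_bounded c" "test_function \<phi>"
  shows "(\<lambda>k. c k * pairing k \<phi>) summable_on UNIV"
  by (rule abs_summable_summable[OF summable_fourier_series[OF assms]])

lemma periodic_distribution_fourier_series:
  fixes c :: "int^'n::finite \<Rightarrow> complex"
  assumes c: "poly_bounded c"
  shows "periodic_distribution (fourier_series c)"
  unfolding periodic_distribution_def
proof (intro conjI allI impI)
  fix \<phi> \<psi> :: "real^'n \<Rightarrow> complex" assume t: "test_function \<phi>" "test_function \<psi>"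
  show "fourier_series c (\<lambda>x. \<phi> x + \<psi> x) = fourier_series c \<phi> + fourier_series c \<psi>"
    unfolding fourier_series_eq pairing_add[OF t] distrib_left
    by (intro infsum_add summable_fourier_series' c t)
next
  fix a and \<phi> :: "real^'n \<Rightarrow> complex" assume t: "test_function \<phi>"
  show "fourier_series c (\<lambda>x. a * \<phi> x) = a * fourier_series c \<phi>"
    unfolding fourier_series_eq pairing_cmult mult.left_commute[of _ a]
    by (rule infsum_cmult_right')
next
  obtain C N where C: "C \<ge> 0" "\<And>k. norm (c k) \<le> C * weight k ^ N" using poly_boundedE[OF c] by metis
  \<comment> \<open>N powers of the weight absorb the growth of c, and n more make the lattice sum
    converge; each power costs two derivatives of the test function.\<close>
  define M where "M = N + CARD('n)"
  define K where "K = C * ((2 * real CARD('n)) ^ M * (2 * pi) ^ CARD('n))"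
  define \<Sigma> where "\<Sigma> = (\<Sum>\<^sub>\<infinity>k :: int^'n. 1 / weight k ^ CARD('n))"
  show "\<exists>C (N::nat). \<forall>\<phi> B. test_function \<phi> \<longrightarrow>
      (\<forall>is x. length is \<le> N \<longrightarrow> norm (iter_partial is \<phi> x) \<le> B) \<longrightarrow> norm (fourier_series c \<phi>) \<le> C * B"
  proof (intro exI allI impI)
    fix \<phi> :: "real^'n \<Rightarrow> complex" and B :: real
    assume t: "test_function \<phi>" and "\<forall>is x. length is \<le> 2 * M \<longrightarrow> norm (iter_partial is \<phi> x) \<le> B"
    then have B: "\<And>is x. length is \<le> 2 * M \<Longrightarrow> norm (iter_partial is \<phi> x) \<le> B" by blast
    have le: "norm (c k * pairing k \<phi>) \<le> K * B * (1 / weight k ^ CARD('n))" for k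
    proof -
      have "norm (c k * pairing k \<phi>) \<le> C * weight k ^ N * norm (pairing k \<phi>)"
        unfolding norm_mult by (intro mult_right_mono C) auto
      also have "\<dots> = C * (weight k ^ M * norm (pairing k \<phi>)) * (1 / weight k ^ CARD('n))"
        by (simp add: M_def power_add)
      also have "\<dots> \<le> C * ((2 * real CARD('n)) ^ M * (2 * pi) ^ CARD('n) * B) * (1 / weight k ^ CARD('n))"
        using C(1) by (intro mult_right_mono mult_left_mono pairing_decay[OF t B]) auto
      finally show ?thesis by (simp add: K_def mult_ac)
    qed
    have "norm (fourier_series c \<phi>) \<le> (\<Sum>\<^sub>\<infinity>k :: int^'n. K * B * (1 / weight k ^ CARD('n)))"
      unfolding fourier_series_eq
      by (rule norm_infsum_le[OF has_sum_infsum has_sum_infsum])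
        (intro summable_fourier_series' c t summable_on_cmult_right summable_weight le)+
    also have "\<dots> = K * \<Sigma> * B" unfolding \<Sigma>_def by (subst infsum_cmult_right') simp
    finally show "norm (fourier_series c \<phi>) \<le> K * \<Sigma> * B" .
  qed
qed

lemma norm_iter_partial_echar_le:
  assumes "length is \<le> N"
  shows "norm (\<Prod>i\<leftarrow>is. \<i> * of_int (k $ i) :: complex) \<le> weight k ^ N"
    and "norm (\<Prod>i\<leftarrow>is. - \<i> * of_int (k $ i) :: complex) \<le> weight k ^ N"
proof -
  have "norm (\<Prod>i\<leftarrow>is. \<i> * of_int (k $ i) :: complex) \<le> weight k ^ length is \<and>
      norm (\<Prod>i\<leftarrow>is. - \<i> * of_int (k $ i) :: complex) \<le> weight k ^ length is"
    by (induction "is") (auto simp: norm_mult intro!: mult_mono abs_nth_le_weight)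
  moreover have "weight k ^ length is \<le> weight k ^ N"
    using assms weight_ge_1[of k] by (intro power_increasing)
  ultimately show "norm (\<Prod>i\<leftarrow>is. \<i> * of_int (k $ i) :: complex) \<le> weight k ^ N"
    "norm (\<Prod>i\<leftarrow>is. - \<i> * of_int (k $ i) :: complex) \<le> weight k ^ N" by linarith+
qed

lemma periodic_distributionD:
  assumes "periodic_distribution T"
  shows "test_function \<phi> \<Longrightarrow> test_function \<psi> \<Longrightarrow> T (\<lambda>x. \<phi> x + \<psi> x) = T \<phi> + T \<psi>"
    and "test_function \<phi> \<Longrightarrow> T (\<lambda>x. c * \<phi> x) = c * T \<phi>"
  using assms by (auto simp: periodic_distribution_def)

lemma periodic_distribution_bound:
  fixes T :: "'n::finite pdist"
  assumes "periodic_distribution T"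
  obtains C N where "C \<ge> 0" "\<And>\<phi> B. test_function \<phi> \<Longrightarrow> B \<ge> 0 \<Longrightarrow>
     (\<And>is x. length is \<le> N \<Longrightarrow> norm (iter_partial is \<phi> x) \<le> B) \<Longrightarrow> norm (T \<phi>) \<le> C * B"
proof -
  obtain C N where C: "\<And>\<phi> B. test_function \<phi> \<Longrightarrow>
     (\<And>is x. length is \<le> N \<Longrightarrow> norm (iter_partial is \<phi> x) \<le> B) \<Longrightarrow> norm (T \<phi>) \<le> C * B"
    using assms unfolding periodic_distribution_def by blast
  show ?thesis
  proof (rule that[of "\<bar>C\<bar>" N])
    fix \<phi> :: "real^'n \<Rightarrow> complex" and B :: real assume "test_function \<phi>" "B \<ge> 0"
      "\<And>is x. length is \<le> N \<Longrightarrow> norm (iter_partial is \<phi> x) \<le> B"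
    then have "norm (T \<phi>) \<le> C * B" "C * B \<le> \<bar>C\<bar> * B" by (auto intro: C mult_right_mono)
    then show "norm (T \<phi>) \<le> \<bar>C\<bar> * B" by linarith
  qed simp
qed

lemma poly_bounded_fourier_coeff:
  fixes T :: "'n::finite pdist"
  assumes "periodic_distribution T"
  shows "poly_bounded (fourier_coeff T)"
proof -
  obtain C N where C: "C \<ge> 0" "\<And>\<phi> B. test_function \<phi> \<Longrightarrow> B \<ge> 0 \<Longrightarrow>
     (\<And>is x. length is \<le> N \<Longrightarrow> norm (iter_partial is \<phi> x) \<le> B) \<Longrightarrow> norm (T \<phi>) \<le> C * B"
    using periodic_distribution_bound[OF assms] by metis
  show ?thesis
  proof (rule poly_boundedI)
    fix k :: "int^'n"
    have "norm (T (echar (- k))) \<le> C * weight (- k) ^ N"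
      by (intro C test_function_echar)
        (auto simp: iter_partial_echar norm_mult intro: norm_iter_partial_echar_le simp del: vector_uminus_component weight_minus)
    then show "norm (fourier_coeff T k) \<le> C / (2 * pi) ^ CARD('n) * weight k ^ N"
      by (simp add: fourier_coeff_def norm_divide norm_power norm_mult divide_right_mono)
  qed
qed

text \<open>By orthogonality, pairing with \<open>echar (- k)\<close> leaves a single nonzero
  term.\<close>

lemma fourier_coeff_fourier_series [simp]:
  fixes c :: "int^'n::finite \<Rightarrow> complex"
  shows "fourier_coeff (fourier_series c) = c"
proof
  fix k
  have "fourier_series c (echar (- k)) = (\<Sum>\<^sub>\<infinity>j\<in>{k}. c j * pairing j (echar (- k)))"
    unfolding fourier_series_eq by (rule infsum_cong_neutral) (auto simp: pairing_echar)
  then show "fourier_coeff (fourier_series c) k = c k"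
    by (simp add: pairing_echar fourier_coeff_def)
qed

text \<open>The partial sums of the Fourier series of a test function converge in every \<open>C\<^sup>N\<close>-norm, because
  differentiation commutes with taking partial sums.\<close>

lemma fourier_series_fourier_coeff:
  fixes T :: "'n::finite pdist"
  assumes T: "periodic_distribution T" and t: "test_function \<phi>"
  shows "fourier_series (fourier_coeff T) \<phi> = T \<phi>"
proof -
  obtain C N where C: "C \<ge> 0" "\<And>\<phi> B. test_function \<phi> \<Longrightarrow> B \<ge> 0 \<Longrightarrow>
     (\<And>is x. length is \<le> N \<Longrightarrow> norm (iter_partial is \<phi> x) \<le> B) \<Longrightarrow> norm (T \<phi>) \<le> C * B"
    using periodic_distribution_bound[OF T] by metis
  define V :: real where "V = (2 * pi) ^ CARD('n)"
  have V: "V > 0" by (simp add: V_def)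
  \<comment> \<open>One majorant for all derivatives of order at most N: each derivative multiplies
    the pairing by a factor of modulus at most \<open>weight k\<close>.\<close>
  define a where "a k = weight k ^ N * norm (pairing k \<phi>) / V" for k
  have a: "a summable_on UNIV"
    using summable_on_cmult_left[OF summable_pairing[OF t, of N], of "1 / V"] by (simp add: a_def[abs_def])
  define p where "p k = pairing k \<phi> / of_real V" for k
  \<comment> \<open>The minus sign is built into the terms so that additivity and homogeneity of T
    turn the remainder into T of a single sum.\<close>
  have te: "test_function (\<lambda>x. - p k * echar (- k) x)" for k
    by (intro test_function_cmult test_function_echar)
  have le: "norm (T \<phi> - (\<Sum>k\<in>F. fourier_coeff T k * pairing k \<phi>)) \<le> C * infsum a (- F)" if F: "finite F" for F
  proof -
    have "T (\<lambda>x. \<Sum>k\<in>F. - p k * echar (- k) x) = (\<Sum>k\<in>F. T (\<lambda>x. - p k * echar (- k) x))"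
      using F
    proof (induction F rule: finite_induct)
      case empty
      show ?case using periodic_distributionD(2)[OF T test_function_0, of 0] by simp
    next
      case (insert k F)
      then show ?case
        using periodic_distributionD(1)[OF T te[of k] test_function_sum[of F, OF te]] by simp
    qed
    also have "\<dots> = - (\<Sum>k\<in>F. fourier_coeff T k * pairing k \<phi>)"
      unfolding sum_negf[symmetric] periodic_distributionD(2)[OF T test_function_echar]
      by (simp add: p_def fourier_coeff_def V_def mult.commute)
    finally have "T \<phi> - (\<Sum>k\<in>F. fourier_coeff T k * pairing k \<phi>) = T (\<lambda>x. \<phi> x + (\<Sum>k\<in>F. - p k * echar (- k) x))"
      using periodic_distributionD(1)[OF T t test_function_sum[of F, OF te]] by simp
    also have "norm \<dots> \<le> C * infsum a (- F)"
    proof (rule C(2))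
      show "test_function (\<lambda>x. \<phi> x + (\<Sum>k\<in>F. - p k * echar (- k) x))"
        by (intro test_function_add t test_function_sum te)
      show "0 \<le> infsum a (- F)" using V by (intro infsum_nonneg) (simp add: a_def)
      fix "is" :: "'n list" and x assume len: "length is \<le> N"
      let ?\<psi> = "iter_partial is \<phi>"
      let ?f = "\<lambda>k. pairing k ?\<psi> / (2 * pi) ^ CARD('n) * echar (- k) x"
      have t\<psi>: "test_function ?\<psi>" by (rule test_function_iter_partial[OF t])
      have f: "?f k = p k * iter_partial is (echar (- k)) x" for k
        unfolding pairing_iter_partial[OF t] iter_partial_echar by (simp add: p_def V_def)
      have "iter_partial is (\<lambda>x. \<phi> x + (\<Sum>k\<in>F. - p k * echar (- k) x)) x = ?\<psi> x - (\<Sum>k\<in>F. ?f k)"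
        unfolding iter_partial_add[OF t test_function_sum[of F, OF te]] iter_partial_sum[of F, OF te]
          iter_partial_cmult[OF test_function_echar] f by (simp add: sum_negf)
      also have "\<dots> = infsum ?f UNIV - sum ?f F"
        using fourier_inversion[OF t\<psi>, of x] by simp
      also have "norm \<dots> \<le> infsum a (- F)"
      proof (rule norm_infsum_diff_le[OF a _ F])
        fix k
        have "norm (pairing k ?\<psi>) \<le> weight k ^ N * norm (pairing k \<phi>)"
          unfolding pairing_iter_partial[OF t] norm_mult
          by (intro mult_right_mono norm_iter_partial_echar_le len) auto
        then show "norm (?f k) \<le> a k"
          unfolding norm_fourier_term a_def V_def by (intro divide_right_mono) auto
      qed
      finally show "norm (iter_partial is (\<lambda>x. \<phi> x + (\<Sum>k\<in>F. - p k * echar (- k) x)) x) \<le> infsum a (- F)" .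
    qed
    finally show ?thesis .
  qed
  have "((\<lambda>F. T \<phi> - (\<Sum>k\<in>F. fourier_coeff T k * pairing k \<phi>)) \<longlongrightarrow> 0) (finite_subsets_at_top UNIV)"
  proof (rule Lim_null_comparison)
    show "\<forall>\<^sub>F F in finite_subsets_at_top UNIV. norm (T \<phi> - (\<Sum>k\<in>F. fourier_coeff T k * pairing k \<phi>)) \<le> C * infsum a (- F)"
      by (rule eventually_finite_subsets_at_top_weakI) (rule le)
    show "((\<lambda>F. C * infsum a (- F)) \<longlongrightarrow> 0) (finite_subsets_at_top UNIV)"
      using tendsto_mult_left[OF tail_tendsto_0[OF a], of C] by simp
  qed
  then have "((\<lambda>F. T \<phi> - (T \<phi> - (\<Sum>k\<in>F. fourier_coeff T k * pairing k \<phi>))) \<longlongrightarrow> T \<phi> - 0) (finite_subsets_at_top UNIV)"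
    by (intro tendsto_diff tendsto_const)
  then have "((\<lambda>k. fourier_coeff T k * pairing k \<phi>) has_sum T \<phi>) UNIV" by (simp add: has_sum_def)
  then show ?thesis unfolding fourier_series_eq by (rule infsumI)
qed

subsection \<open>The wave equation for a Fourier multiplier\<close>

text \<open>The propagator of the initial velocity; its value at \<open>\<omega> = 0\<close> accounts for the mode \<open>k = 0\<close>.\<close>

definition osc :: "real \<Rightarrow> real \<Rightarrow> real" where
  "osc \<omega> t = (if \<omega> = 0 then t else sin (\<omega> * t) / \<omega>)"

lemma omega_osc [simp]: "\<omega> * osc \<omega> t = sin (\<omega> * t)"
  by (simp add: osc_def)

lemma osc_0 [simp]: "osc \<omega> 0 = 0"
  by (simp add: osc_def)

lemma DERIV_osc: "(osc \<omega> has_real_derivative cos (\<omega> * t)) (at t within S)"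
  unfolding osc_def[abs_def] by (cases "\<omega> = 0") (auto intro!: derivative_eq_intros)

lemma abs_osc_le: "\<bar>osc \<omega> t\<bar> \<le> \<bar>t\<bar>"
proof (cases "\<omega> = 0")
  case False
  have "\<bar>sin (\<omega> * t)\<bar> \<le> \<bar>\<omega> * t\<bar>" by (rule abs_sin_x_le_abs_x)
  then show ?thesis using False by (simp add: osc_def abs_mult field_simps)
qed (simp add: osc_def)

lemma osc_sq_le:
  assumes "\<omega> \<noteq> 0"
  shows "(osc \<omega> t)\<^sup>2 \<le> 1 / \<omega>\<^sup>2"
proof -
  have "(sin (\<omega> * t))\<^sup>2 \<le> 1" by (simp add: abs_square_le_1)
  then show ?thesis using assms by (simp add: osc_def power_divide divide_right_mono)
qed

text \<open>In the proof, p and q are the position and velocity at time t carried back to time 0 by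
  the oscillator flow. They are constant in t, and solving for c gives the formula. Writing the flow
  with \<open>osc\<close> includes the frequency 0.\<close>

lemma oscillator_unique:
  fixes c d :: "real \<Rightarrow> complex"
  assumes c: "\<And>t. t \<ge> 0 \<Longrightarrow> (c has_vector_derivative d t) (at t within {0..})"
    and d: "\<And>t. t \<ge> 0 \<Longrightarrow> (d has_vector_derivative - of_real (\<omega>\<^sup>2) * c t) (at t within {0..})"
    and t: "t \<ge> 0"
  shows "c t = c 0 * of_real (cos (\<omega> * t)) + d 0 * of_real (osc \<omega> t)"
proof -
  note dcos = has_vector_derivative_of_real[OF DERIV_cos[THEN DERIV_chain2, OF DERIV_cmult_Id]]
  note dsin = has_vector_derivative_of_real[OF DERIV_sin[THEN DERIV_chain2, OF DERIV_cmult_Id]]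
  note dosc = has_vector_derivative_of_real[OF DERIV_osc]
  define p where "p t = c t * of_real (cos (\<omega> * t)) - d t * of_real (osc \<omega> t)" for t
  define q where "q t = c t * of_real (\<omega> * sin (\<omega> * t)) + d t * of_real (cos (\<omega> * t))" for t
  have "(p has_vector_derivative 0) (at t within {0..})" if "t \<in> {0..}" for t
  proof -
    have t0: "t \<ge> 0" using that by simp
    have "(p has_vector_derivative
        (c t * of_real (- sin (\<omega> * t) * \<omega>) + d t * of_real (cos (\<omega> * t))) -
        (d t * of_real (cos (\<omega> * t)) + (- of_real (\<omega>\<^sup>2) * c t) * of_real (osc \<omega> t))) (at t within {0..})"
      unfolding p_def[abs_def]
      by (intro has_vector_derivative_diff has_vector_derivative_mult c d t0 dcos dosc)
    moreover have "(of_real (\<omega>\<^sup>2) :: complex) * of_real (osc \<omega> t) = of_real (sin (\<omega> * t) * \<omega>)"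
      unfolding of_real_mult[symmetric] by (simp add: power2_eq_square mult.assoc mult.commute[of "sin _"])
    ultimately show ?thesis by (simp add: algebra_simps)
  qed
  then obtain p0 where p0: "\<And>t. t \<in> {0..} \<Longrightarrow> p t = p0"
    using has_vector_derivative_zero_constant[of "{0..}" p] by auto
  have "(q has_vector_derivative 0) (at t within {0..})" if "t \<in> {0..}" for t
  proof -
    have t0: "t \<ge> 0" using that by simp
    have ds: "((\<lambda>t. of_real (\<omega> * sin (\<omega> * t)) :: complex) has_vector_derivative
        of_real (\<omega> * (cos (\<omega> * t) * \<omega>))) (at t within {0..})"
      by (intro has_vector_derivative_of_real DERIV_cmult DERIV_sin[THEN DERIV_chain2] DERIV_cmult_Id)
    have "(q has_vector_derivative
        (c t * of_real (\<omega> * (cos (\<omega> * t) * \<omega>)) + d t * of_real (\<omega> * sin (\<omega> * t))) +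
        (d t * of_real (- sin (\<omega> * t) * \<omega>) + (- of_real (\<omega>\<^sup>2) * c t) * of_real (cos (\<omega> * t)))) (at t within {0..})"
      unfolding q_def[abs_def]
      by (intro has_vector_derivative_add has_vector_derivative_mult c d t0 dcos ds)
    then show ?thesis by (simp add: algebra_simps power2_eq_square)
  qed
  then obtain q0 where q0: "\<And>t. t \<in> {0..} \<Longrightarrow> q t = q0"
    using has_vector_derivative_zero_constant[of "{0..}" q] by auto
  have "p t = c 0" "q t = d 0"
    using p0[of 0] p0[of t] q0[of 0] q0[of t] t by (simp_all add: p_def q_def)
  moreover have "p t * of_real (cos (\<omega> * t)) + q t * of_real (osc \<omega> t) = c t"
  proof -
    have "p t * of_real (cos (\<omega> * t)) + q t * of_real (osc \<omega> t) =
        c t * of_real ((cos (\<omega> * t))\<^sup>2 + (\<omega> * osc \<omega> t) * sin (\<omega> * t))"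
      unfolding p_def q_def by (simp add: algebra_simps power2_eq_square del: omega_osc)
    also have "(cos (\<omega> * t))\<^sup>2 + (\<omega> * osc \<omega> t) * sin (\<omega> * t) = 1"
      unfolding omega_osc by (simp flip: power2_eq_square)
    finally show ?thesis by simp
  qed
  ultimately show ?thesis by simp
qed

definition wave_coeff ::
    "(int^'n::finite \<Rightarrow> real) \<Rightarrow> (int^'n \<Rightarrow> complex) \<Rightarrow> (int^'n \<Rightarrow> complex) \<Rightarrow> real \<Rightarrow> int^'n \<Rightarrow> complex" where
  "wave_coeff \<omega> c d t k = c k * of_real (cos (\<omega> k * t)) + d k * of_real (osc (\<omega> k) t)"

definition wave_coeff' ::
    "(int^'n::finite \<Rightarrow> real) \<Rightarrow> (int^'n \<Rightarrow> complex) \<Rightarrow> (int^'n \<Rightarrow> complex) \<Rightarrow> real \<Rightarrow> int^'n \<Rightarrow> complex" where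
  "wave_coeff' \<omega> c d t k = d k * of_real (cos (\<omega> k * t)) - of_real (\<omega> k) * c k * of_real (sin (\<omega> k * t))"

text \<open>The bound |osc| <= |t| is insensitive to small frequencies; uniformity on bounded time
  intervals is what termwise differentiation requires.\<close>

lemma norm_wave_coeff_le:
  assumes "\<bar>t\<bar> \<le> R"
  shows "norm (wave_coeff \<omega> c d t k) \<le> norm (c k) + norm (d k) * R"
proof -
  have "norm (wave_coeff \<omega> c d t k) \<le> norm (c k) * \<bar>cos (\<omega> k * t)\<bar> + norm (d k) * \<bar>osc (\<omega> k) t\<bar>"
    unfolding wave_coeff_def by (rule norm_triangle_le) (simp add: norm_mult)
  also have "\<dots> \<le> norm (c k) * 1 + norm (d k) * R"
    using abs_osc_le[of "\<omega> k" t] assms by (intro add_mono mult_left_mono) auto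
  finally show ?thesis by simp
qed

lemma norm_wave_coeff'_le:
  "norm (wave_coeff' \<omega> c d t k) \<le> norm (d k) + norm (of_real (\<omega> k) * c k)"
proof -
  have "norm (wave_coeff' \<omega> c d t k) \<le> norm (d k) * \<bar>cos (\<omega> k * t)\<bar> + norm (of_real (\<omega> k) * c k) * \<bar>sin (\<omega> k * t)\<bar>"
    unfolding wave_coeff'_def by (rule order_trans[OF norm_triangle_ineq4]) (simp add: norm_mult)
  also have "\<dots> \<le> norm (d k) * 1 + norm (of_real (\<omega> k) * c k) * 1"
    by (intro add_mono mult_left_mono) auto
  finally show ?thesis by simp
qed

lemma wave_coeff_derivs:
  "((\<lambda>t. wave_coeff \<omega> c d t k * z) has_vector_derivative wave_coeff' \<omega> c d t k * z) (at t)"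
  "((\<lambda>t. wave_coeff' \<omega> c d t k * z) has_vector_derivative - of_real ((\<omega> k)\<^sup>2) * wave_coeff \<omega> c d t k * z) (at t)"
proof -
  let ?w = "\<omega> k"
  have cos: "((\<lambda>t. of_real (cos (?w * t)) :: complex) has_vector_derivative of_real (- sin (?w * t) * ?w)) (at t)"
    by (intro has_vector_derivative_of_real DERIV_cos[THEN DERIV_chain2] DERIV_cmult_Id)
  have sin: "((\<lambda>t. of_real (sin (?w * t)) :: complex) has_vector_derivative of_real (cos (?w * t) * ?w)) (at t)"
    by (intro has_vector_derivative_of_real DERIV_sin[THEN DERIV_chain2] DERIV_cmult_Id)
  have osc: "((\<lambda>t. of_real (osc ?w t) :: complex) has_vector_derivative of_real (cos (?w * t))) (at t)"
    by (intro has_vector_derivative_of_real DERIV_osc)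
  have "((\<lambda>t. wave_coeff \<omega> c d t k * z) has_vector_derivative
      (c k * of_real (- sin (?w * t) * ?w) + d k * of_real (cos (?w * t))) * z) (at t)"
    unfolding wave_coeff_def
    by (intro has_vector_derivative_mult_left has_vector_derivative_add has_vector_derivative_mult_right cos osc)
  then show "((\<lambda>t. wave_coeff \<omega> c d t k * z) has_vector_derivative wave_coeff' \<omega> c d t k * z) (at t)"
    by (simp add: wave_coeff'_def algebra_simps)
  have "((\<lambda>t. wave_coeff' \<omega> c d t k * z) has_vector_derivative
      (d k * of_real (- sin (?w * t) * ?w) - of_real ?w * c k * of_real (cos (?w * t) * ?w)) * z) (at t)"
    unfolding wave_coeff'_def
    by (intro has_vector_derivative_mult_left has_vector_derivative_diff has_vector_derivative_mult_right cos sin)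
  moreover have "(of_real (?w\<^sup>2) :: complex) * of_real (osc ?w t) = of_real ?w * of_real (sin (?w * t))"
    unfolding of_real_mult[symmetric] by (simp add: power2_eq_square mult.assoc)
  then have "- of_real (?w\<^sup>2) * wave_coeff \<omega> c d t k =
      d k * of_real (- sin (?w * t) * ?w) - of_real ?w * c k * of_real (cos (?w * t) * ?w)"
    unfolding wave_coeff_def by (simp add: algebra_simps power2_eq_square)
  ultimately show "((\<lambda>t. wave_coeff' \<omega> c d t k * z) has_vector_derivative - of_real ((\<omega> k)\<^sup>2) * wave_coeff \<omega> c d t k * z) (at t)"
    by simp
qed

lemma poly_bounded_wave_coeff:
  assumes "poly_bounded c" "poly_bounded d"
  shows "poly_bounded (wave_coeff \<omega> c d t)"
proof (rule poly_bounded_mono)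
  show "poly_bounded (\<lambda>k. norm (c k) + norm (d k) * \<bar>t\<bar>)"
    using assms by (intro poly_bounded_add poly_bounded_mult poly_bounded_const) (auto simp: poly_bounded_def)
  show "norm (wave_coeff \<omega> c d t k) \<le> norm (norm (c k) + norm (d k) * \<bar>t\<bar>)" for k
    using norm_wave_coeff_le[of t "\<bar>t\<bar>"] by (simp add: order_trans[OF _ abs_ge_self])
qed

lemma poly_bounded_wave_coeff':
  assumes "poly_bounded c" "poly_bounded d" "poly_bounded \<omega>"
  shows "poly_bounded (wave_coeff' \<omega> c d t)"
proof (rule poly_bounded_mono)
  have "poly_bounded (\<lambda>k. of_real (\<omega> k) * c k)"
    by (intro poly_bounded_mult poly_bounded_of_real[THEN iffD2] assms)
  then show "poly_bounded (\<lambda>k. norm (d k) + norm (of_real (\<omega> k) * c k))"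
    using assms by (intro poly_bounded_add) (auto simp: poly_bounded_def)
  show "norm (wave_coeff' \<omega> c d t k) \<le> norm (norm (d k) + norm (of_real (\<omega> k) * c k))" for k
    using norm_wave_coeff'_le[of \<omega> c d t k] by simp
qed

lemma summable_pairing_poly_bounded:
  fixes D :: "int^'n::finite \<Rightarrow> real"
  assumes "poly_bounded D" "\<And>k. D k \<ge> 0" "test_function \<phi>"
  shows "(\<lambda>k. D k * norm (pairing k \<phi>)) summable_on UNIV"
  using summable_fourier_series[of "\<lambda>k. of_real (D k)", OF _ assms(3)] assms(1,2)
  by (simp add: poly_bounded_of_real norm_mult)

text \<open>Existence is termwise differentiation, twice. For uniqueness, testing a solution against
  \<open>echar (- k)\<close> shows that its k-th coefficient solves the oscillator equation, and a
  distribution is determined by its coefficients.\<close>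

lemma unique_wave_solution_multiplier:
  fixes f g :: "'n::finite pdist" and \<omega> :: "int^'n \<Rightarrow> real"
  assumes f: "periodic_distribution f" and g: "periodic_distribution g" and \<omega>: "poly_bounded \<omega>"
    and A: "\<And>T \<phi>. periodic_distribution T \<Longrightarrow> test_function \<phi> \<Longrightarrow>
      A T \<phi> = fourier_series (\<lambda>k. - of_real ((\<omega> k)\<^sup>2) * fourier_coeff T k) \<phi>"
  shows "unique_wave_solution A f g (\<lambda>t. fourier_series (wave_coeff \<omega> (fourier_coeff f) (fourier_coeff g) t))"
proof -
  let ?c = "fourier_coeff f" and ?d = "fourier_coeff g"
  let ?u = "wave_coeff \<omega> ?c ?d" and ?v = "wave_coeff' \<omega> ?c ?d"
  note pb = poly_bounded_fourier_coeff[OF f] poly_bounded_fourier_coeff[OF g]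
  have pbn: "poly_bounded (\<lambda>k. norm (?c k))" "poly_bounded (\<lambda>k. norm (?d k))"
    using pb by (simp_all add: poly_bounded_def)
  have pu: "poly_bounded (?u t)" and pv: "poly_bounded (?v t)" for t
    by (intro poly_bounded_wave_coeff poly_bounded_wave_coeff' pb \<omega>)+
  have dU: "((\<lambda>t. fourier_series (?u t) \<phi>) has_vector_derivative fourier_series (?v t) \<phi>) (at t)"
    and dV: "((\<lambda>t. fourier_series (?v t) \<phi>) has_vector_derivative A (fourier_series (?u t)) \<phi>) (at t)"
    if \<phi>: "test_function \<phi>" for \<phi> t
  proof -
    let ?R = "\<bar>t\<bar> + 1"
    \<comment> \<open>D and E dominate the first and second time derivatives of the coefficients
      while |s| <= |t| + 1. The powers of omega in them are harmless, because the pairings of a test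
      function decay rapidly.\<close>
    define D where "D k = norm (?d k) + norm (of_real (\<omega> k) * ?c k)" for k
    define E where "E k = (\<omega> k)\<^sup>2 * (norm (?c k) + norm (?d k) * ?R)" for k
    have "poly_bounded D"
      unfolding D_def using poly_bounded_mult[OF poly_bounded_of_real[THEN iffD2, OF \<omega>] pb(1)]
      by (intro poly_bounded_add pbn) (simp add: poly_bounded_def)
    then have D: "(\<lambda>k. D k * norm (pairing k \<phi>)) summable_on UNIV"
      by (rule summable_pairing_poly_bounded[OF _ _ \<phi>]) (simp add: D_def)
    have "poly_bounded E"
      unfolding E_def power2_eq_square
      by (intro poly_bounded_add poly_bounded_mult \<omega> pbn poly_bounded_const)
    then have E: "(\<lambda>k. E k * norm (pairing k \<phi>)) summable_on UNIV"
      by (rule summable_pairing_poly_bounded[OF _ _ \<phi>]) (simp add: E_def)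
    show "((\<lambda>t. fourier_series (?u t) \<phi>) has_vector_derivative fourier_series (?v t) \<phi>) (at t)"
      unfolding fourier_series_eq
    proof (rule has_vector_derivative_infsum[OF wave_coeff_derivs(1) _ D])
      show "norm (?v s k * pairing k \<phi>) \<le> D k * norm (pairing k \<phi>)" for s k
        unfolding norm_mult[of _ "pairing k \<phi>"] D_def by (intro mult_right_mono norm_wave_coeff'_le) auto
      show "(\<lambda>k. ?u s k * pairing k \<phi>) summable_on UNIV" for s
        by (intro summable_fourier_series' pu \<phi>)
      show "\<bar>t\<bar> < ?R" by simp
    qed
    have "((\<lambda>t. fourier_series (?v t) \<phi>) has_vector_derivative
        fourier_series (\<lambda>k. - of_real ((\<omega> k)\<^sup>2) * ?u t k) \<phi>) (at t)"
      unfolding fourier_series_eq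
    proof (rule has_vector_derivative_infsum[OF wave_coeff_derivs(2) _ E])
      show "norm (- of_real ((\<omega> k)\<^sup>2) * ?u s k * pairing k \<phi>) \<le> E k * norm (pairing k \<phi>)" if "\<bar>s\<bar> \<le> ?R" for s k
      proof -
        have "norm (- of_real ((\<omega> k)\<^sup>2) * ?u s k) = (\<omega> k)\<^sup>2 * norm (?u s k)"
          by (simp add: norm_mult norm_power)
        also have "\<dots> \<le> E k" unfolding E_def by (intro mult_left_mono norm_wave_coeff_le that) auto
        finally show ?thesis unfolding norm_mult[of _ "pairing k \<phi>"] by (intro mult_right_mono) auto
      qed
      show "(\<lambda>k. ?v s k * pairing k \<phi>) summable_on UNIV" for s
        by (intro summable_fourier_series' pv \<phi>)
      show "\<bar>t\<bar> < ?R" by simp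
    qed
    then show "((\<lambda>t. fourier_series (?v t) \<phi>) has_vector_derivative A (fourier_series (?u t)) \<phi>) (at t)"
      by (simp add: A[OF periodic_distribution_fourier_series[OF pu] \<phi>])
  qed
  have sol: "wave_solution A f g (\<lambda>t. fourier_series (?u t))"
    unfolding wave_solution_def
  proof (intro exI[of _ "\<lambda>t. fourier_series (?v t)"] conjI allI impI)
    fix \<phi> :: "real^'n \<Rightarrow> complex" assume \<phi>: "test_function \<phi>"
    have "?u 0 = ?c" "?v 0 = ?d" by (auto simp: wave_coeff_def wave_coeff'_def osc_def)
    then show "fourier_series (?u 0) \<phi> = f \<phi>" "fourier_series (?v 0) \<phi> = g \<phi>"
      using fourier_series_fourier_coeff f g \<phi> by auto
  qed (auto intro: periodic_distribution_fourier_series pu pv has_vector_derivative_at_within dU dV)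
  have "V t \<phi> = fourier_series (?u t) \<phi>" if V: "wave_solution A f g V" and t: "t \<ge> 0" and \<phi>: "test_function \<phi>" for V t \<phi>
  proof -
    obtain W where W: "\<And>t. t \<ge> 0 \<Longrightarrow> periodic_distribution (V t)"
      "\<And>t \<phi>. test_function \<phi> \<Longrightarrow> t \<ge> 0 \<Longrightarrow> ((\<lambda>\<tau>. V \<tau> \<phi>) has_vector_derivative W t \<phi>) (at t within {0..})"
      "\<And>t \<phi>. test_function \<phi> \<Longrightarrow> t \<ge> 0 \<Longrightarrow> ((\<lambda>\<tau>. W \<tau> \<phi>) has_vector_derivative A (V t) \<phi>) (at t within {0..})"
      "\<And>\<phi>. test_function \<phi> \<Longrightarrow> V 0 \<phi> = f \<phi>" "\<And>\<phi>. test_function \<phi> \<Longrightarrow> W 0 \<phi> = g \<phi>"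
      using V unfolding wave_solution_def by blast
    have "fourier_coeff (V t) k = ?u t k" for k
    proof -
      let ?N = "of_real ((2 * pi) ^ CARD('n)) :: complex"
      have "fourier_coeff (V t) k = fourier_coeff (V 0) k * of_real (cos (\<omega> k * t)) + fourier_coeff (W 0) k * of_real (osc (\<omega> k) t)"
      proof (rule oscillator_unique[OF _ _ t])
        fix s :: real assume s: "s \<ge> 0"
        show "((\<lambda>t. fourier_coeff (V t) k) has_vector_derivative fourier_coeff (W s) k) (at s within {0..})"
          unfolding fourier_coeff_def
          by (intro has_vector_derivative_divide W test_function_echar s)
        have "A (V s) (echar (- k)) / ?N = - of_real ((\<omega> k)\<^sup>2) * fourier_coeff (V s) k"
        proof -
          have "A (V s) (echar (- k)) / ?N =
              fourier_coeff (fourier_series (\<lambda>k. - of_real ((\<omega> k)\<^sup>2) * fourier_coeff (V s) k)) k"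
            unfolding A[OF W(1)[OF s] test_function_echar] unfolding fourier_coeff_def[of "fourier_series _"] ..
          then show ?thesis unfolding fourier_coeff_fourier_series .
        qed
        then show "((\<lambda>t. fourier_coeff (W t) k) has_vector_derivative - of_real ((\<omega> k)\<^sup>2) * fourier_coeff (V s) k) (at s within {0..})"
          using has_vector_derivative_divide[OF W(3)[OF test_function_echar[of "- k"] s], of ?N]
          by (simp only: fourier_coeff_def)
      qed
      moreover have "fourier_coeff (V 0) k = ?c k" "fourier_coeff (W 0) k = ?d k"
        by (simp_all add: fourier_coeff_def W test_function_echar)
      ultimately show ?thesis by (simp add: wave_coeff_def)
    qed
    then have "fourier_coeff (V t) = ?u t" by (rule ext)
    then show ?thesis using fourier_series_fourier_coeff[OF W(1)[OF t] \<phi>] by simp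
  qed
  then show ?thesis using sol by (auto simp: unique_wave_solution_def)
qed

subsection \<open>Convergence in Sobolev spaces\<close>

lemma sobolev_weight_eq: "sobolev_weight q T k = weight k powr q * (norm (fourier_coeff T k))\<^sup>2"
  by (simp add: sobolev_weight_def weight_def)

lemma norm_add_sq_le: "(norm (x + y))\<^sup>2 \<le> 2 * ((norm x)\<^sup>2 + (norm y)\<^sup>2)"
  for x y :: "'a::real_normed_vector"
proof -
  have "(norm (x + y))\<^sup>2 \<le> (norm x + norm y)\<^sup>2" by (intro power_mono norm_triangle_ineq) simp
  also have "\<dots> \<le> 2 * ((norm x)\<^sup>2 + (norm y)\<^sup>2)"
    using sum_squares_bound[of "norm x" "norm y"] by (simp add: power2_sum)
  finally show ?thesis .
qed

context
  fixes f g :: "'n::finite pdist" and s1 s2 q \<theta> K t :: real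
  assumes f: "f \<in> sobolev_space s1" and g: "g \<in> sobolev_space s2"
    and q: "q \<le> s1" "q \<le> s2 + \<theta>" and K: "K \<ge> 0"
begin

text \<open>It depends on the data and on K alone, so it yields membership for each single frequency
  family and serves as the common majorant in the limit. The factor 2 stems from
  \<open>norm_add_sq_le\<close>.\<close>

definition sobolev_majorant :: "int^'n \<Rightarrow> real" where
  "sobolev_majorant k = 2 * (sobolev_weight s1 f k + K * sobolev_weight s2 g k)"

lemma summable_sobolev_majorant: "sobolev_majorant summable_on UNIV"
  unfolding sobolev_majorant_def[abs_def] using f g
  by (intro summable_on_cmult_right summable_on_add) (auto simp: sobolev_space_def)

lemma poly_bounded_sobolev: "poly_bounded (fourier_coeff f)" "poly_bounded (fourier_coeff g)"
  using f g by (auto simp: sobolev_space_def intro: poly_bounded_fourier_coeff)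

text \<open>Decay of the squared propagator like \<open>weight k powr - \<theta>\<close> gains theta
  derivatives on g. The uses are theta = max(0, (beta - n)/2), theta = 1 and theta = (2 -
  epsilon)/2.\<close>

lemma sobolev_weight_wave_le:
  assumes osc: "(osc (\<omega> k) t)\<^sup>2 \<le> K * weight k powr - \<theta>"
  shows "weight k powr q * (norm (wave_coeff \<omega> (fourier_coeff f) (fourier_coeff g) t k))\<^sup>2 \<le> sobolev_majorant k"
proof -
  let ?c = "fourier_coeff f k" and ?d = "fourier_coeff g k" and ?w = "weight k"
  note w = weight_ge_1[of k]
  have "(norm (wave_coeff \<omega> (fourier_coeff f) (fourier_coeff g) t k))\<^sup>2
      \<le> 2 * ((norm (?c * of_real (cos (\<omega> k * t))))\<^sup>2 + (norm (?d * of_real (osc (\<omega> k) t)))\<^sup>2)"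
    unfolding wave_coeff_def by (rule norm_add_sq_le)
  also have "\<dots> = 2 * ((norm ?c)\<^sup>2 * (cos (\<omega> k * t))\<^sup>2 + (norm ?d)\<^sup>2 * (osc (\<omega> k) t)\<^sup>2)"
    by (simp add: norm_mult power_mult_distrib)
  also have "\<dots> \<le> 2 * ((norm ?c)\<^sup>2 * 1 + (norm ?d)\<^sup>2 * (K * ?w powr - \<theta>))"
    using osc by (intro mult_left_mono add_mono) (auto simp: abs_square_le_1)
  finally have "?w powr q * (norm (wave_coeff \<omega> (fourier_coeff f) (fourier_coeff g) t k))\<^sup>2 \<le>
      ?w powr q * (2 * ((norm ?c)\<^sup>2 * 1 + (norm ?d)\<^sup>2 * (K * ?w powr - \<theta>)))"
    by (intro mult_left_mono) auto
  also have "\<dots> = 2 * (?w powr q * (norm ?c)\<^sup>2 + K * (?w powr (q - \<theta>) * (norm ?d)\<^sup>2))"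
    using w by (simp add: algebra_simps powr_diff powr_minus divide_inverse)
  also have "\<dots> \<le> sobolev_majorant k"
    unfolding sobolev_majorant_def sobolev_weight_eq using w q K
    by (intro mult_left_mono add_mono mult_right_mono powr_mono) auto
  finally show ?thesis .
qed

lemma wave_in_sobolev_space:
  assumes osc: "\<And>k. (osc (\<omega> k) t)\<^sup>2 \<le> K * weight k powr - \<theta>"
  shows "fourier_series (wave_coeff \<omega> (fourier_coeff f) (fourier_coeff g) t) \<in> sobolev_space q"
proof -
  have "sobolev_weight q (fourier_series (wave_coeff \<omega> (fourier_coeff f) (fourier_coeff g) t)) summable_on UNIV"
    by (rule summable_on_comparison_test[OF summable_sobolev_majorant])
      (auto simp: sobolev_weight_eq intro!: sobolev_weight_wave_le osc)
  then show ?thesis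
    unfolding sobolev_space_def
    by (auto intro!: periodic_distribution_fourier_series poly_bounded_wave_coeff poly_bounded_sobolev)
qed

text \<open>Convergence of \<open>osc\<close> is a separate assumption, since \<open>osc\<close> is
  defined by cases at frequency 0. The squared differences are dominated by four times the majorant:
  a factor 2 from squaring a difference, another from adding the bounds of both waves.\<close>

lemma tendsto_sobolev_wave:
  assumes osc: "\<forall>\<^sub>F b in \<F>. \<forall>k. (osc (\<omega> b k) t)\<^sup>2 \<le> K * weight k powr - \<theta>"
    and osc0: "\<And>k. (osc (\<omega>\<^sub>0 k) t)\<^sup>2 \<le> K * weight k powr - \<theta>"
    and lim: "\<And>k. ((\<lambda>b. \<omega> b k) \<longlongrightarrow> \<omega>\<^sub>0 k) \<F>" "\<And>k. ((\<lambda>b. osc (\<omega> b k) t) \<longlongrightarrow> osc (\<omega>\<^sub>0 k) t) \<F>"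
    and nt: "\<F> \<noteq> bot"
  shows "tendsto_sobolev q (\<lambda>b. fourier_series (wave_coeff (\<omega> b) (fourier_coeff f) (fourier_coeff g) t))
      (fourier_series (wave_coeff \<omega>\<^sub>0 (fourier_coeff f) (fourier_coeff g) t)) \<F>"
  unfolding tendsto_sobolev_def
proof (intro conjI)
  let ?u = "\<lambda>\<omega>. wave_coeff \<omega> (fourier_coeff f) (fourier_coeff g) t"
  show "fourier_series (?u \<omega>\<^sub>0) \<in> sobolev_space q" by (rule wave_in_sobolev_space[OF osc0])
  show "\<forall>\<^sub>F b in \<F>. fourier_series (?u (\<omega> b)) \<in> sobolev_space q"
    using osc by eventually_elim (rule wave_in_sobolev_space, blast)
  let ?D = "\<lambda>b k. weight k powr q * (norm (?u (\<omega> b) k - ?u \<omega>\<^sub>0 k))\<^sup>2"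
  have D: "sobolev_weight q (\<lambda>\<phi>. fourier_series (?u (\<omega> b)) \<phi> - fourier_series (?u \<omega>\<^sub>0) \<phi>) k = ?D b k" for b k
  proof -
    have "fourier_coeff (\<lambda>\<phi>. fourier_series (?u (\<omega> b)) \<phi> - fourier_series (?u \<omega>\<^sub>0) \<phi>) k =
        fourier_coeff (fourier_series (?u (\<omega> b))) k - fourier_coeff (fourier_series (?u \<omega>\<^sub>0)) k"
      unfolding fourier_coeff_def by (rule diff_divide_distrib)
    then show ?thesis by (simp add: sobolev_weight_eq)
  qed
  have "((\<lambda>b. \<Sum>\<^sub>\<infinity>k. ?D b k) \<longlongrightarrow> (\<Sum>\<^sub>\<infinity>k::int^'n. 0)) \<F>"
  proof (rule tannery[OF _ _ _ nt])
    show "((\<lambda>b. ?D b k) \<longlongrightarrow> 0) \<F>" for k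
    proof -
      have "((\<lambda>b. ?u (\<omega> b) k) \<longlongrightarrow> ?u \<omega>\<^sub>0 k) \<F>"
        unfolding wave_coeff_def
        by (intro tendsto_intros lim isCont_tendsto_compose[OF isCont_cos])
      then have "((\<lambda>b. ?D b k) \<longlongrightarrow> weight k powr q * (norm (?u \<omega>\<^sub>0 k - ?u \<omega>\<^sub>0 k))\<^sup>2) \<F>"
        by (intro tendsto_intros)
      then show ?thesis by simp
    qed
    show "\<forall>\<^sub>F b in \<F>. \<forall>k. norm (?D b k) \<le> 4 * sobolev_majorant k"
      using osc
    proof eventually_elim
      case (elim b)
      show ?case
      proof
        fix k
        have "?D b k \<le> weight k powr q * (2 * ((norm (?u (\<omega> b) k))\<^sup>2 + (norm (?u \<omega>\<^sub>0 k))\<^sup>2))"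
          using norm_add_sq_le[of "?u (\<omega> b) k" "- ?u \<omega>\<^sub>0 k"] by (intro mult_left_mono) auto
        also have "\<dots> = 2 * (weight k powr q * (norm (?u (\<omega> b) k))\<^sup>2 + weight k powr q * (norm (?u \<omega>\<^sub>0 k))\<^sup>2)"
          by (simp add: algebra_simps)
        also have "\<dots> \<le> 2 * (sobolev_majorant k + sobolev_majorant k)"
          using elim osc0 by (intro mult_left_mono add_mono sobolev_weight_wave_le) auto
        finally show "norm (?D b k) \<le> 4 * sobolev_majorant k" by simp
      qed
    qed
    show "(\<lambda>k. 4 * sobolev_majorant k) summable_on UNIV"
      by (intro summable_on_cmult_right summable_sobolev_majorant)
  qed
  then have "((\<lambda>b. \<Sum>\<^sub>\<infinity>k. ?D b k) \<longlongrightarrow> 0) \<F>" by simp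
  then have "((\<lambda>b. sqrt (\<Sum>\<^sub>\<infinity>k. ?D b k)) \<longlongrightarrow> sqrt 0) \<F>" by (rule tendsto_real_sqrt)
  then show "((\<lambda>b. sobolev_norm q (\<lambda>\<phi>. fourier_series (?u (\<omega> b)) \<phi> - fourier_series (?u \<omega>\<^sub>0) \<phi>)) \<longlongrightarrow> 0) \<F>"
    by (simp add: sobolev_norm_def D)
qed

end

subsection \<open>The frequencies\<close>

lemma norm_real_vec_sq_ge_1:
  assumes "k \<noteq> 0"
  shows "(norm (real_vec k))\<^sup>2 \<ge> 1"
proof -
  obtain j where "k $ j \<noteq> 0" using assms by (auto simp: vec_eq_iff)
  then have "1 \<le> \<bar>real_of_int (k $ j)\<bar>" by linarith
  then have "1 \<le> (real_of_int (k $ j))\<^sup>2" by (simp add: abs_le_square_iff[of 1, simplified])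
  then show ?thesis using nth_sq_le_weight[of k j] by (simp add: weight_def)
qed

definition freq :: "real \<Rightarrow> real \<Rightarrow> int^'n::finite \<Rightarrow> real" where
  "freq \<delta> \<beta> k = sqrt (- multiplier \<delta> \<beta> (real_vec k))"

lemma multiplier_eq_profile:
  fixes \<nu> :: "real^'n::finite"
  assumes "\<beta> < real CARD('n) + 4"
  shows "multiplier \<delta> \<beta> \<nu> = - (norm \<nu>)\<^sup>2 *
    profile (real CARD('n) / 2) ((real CARD('n) + 2 - \<beta>) / 2) ((norm \<nu>)\<^sup>2 * \<delta>\<^sup>2 / 4)"
proof -
  let ?a = "(real CARD('n) + 2 - \<beta>) / 2"
  have "(real CARD('n) + 2) / 2 = real CARD('n) / 2 + 1" "(real CARD('n) + 4 - \<beta>) / 2 = ?a + 1"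
    "- (1 / 4) * (norm \<nu>)\<^sup>2 * \<delta>\<^sup>2 = - ((norm \<nu>)\<^sup>2 * \<delta>\<^sup>2 / 4)" by (simp_all add: field_simps)
  moreover have "?a > - 1" using assms by simp
  ultimately show ?thesis unfolding multiplier_def by (simp only: hyp2F3_eq_profile)
qed

lemma half_card: "real CARD('n::finite) / 2 \<ge> 1 / 2"
  by (simp add: Suc_leI)

lemma freq_sq:
  fixes k :: "int^'n::finite"
  assumes "\<beta> < real CARD('n) + 4" and "\<delta> > 0"
  shows "(freq \<delta> \<beta> k)\<^sup>2 = (norm (real_vec k))\<^sup>2 *
    profile (real CARD('n) / 2) ((real CARD('n) + 2 - \<beta>) / 2) ((norm (real_vec k))\<^sup>2 * \<delta>\<^sup>2 / 4)"
    and "multiplier \<delta> \<beta> (real_vec k) = - (freq \<delta> \<beta> k)\<^sup>2"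
    and "freq \<delta> \<beta> k = 0 \<longleftrightarrow> k = 0"
proof -
  let ?F = "profile (real CARD('n) / 2) ((real CARD('n) + 2 - \<beta>) / 2) ((norm (real_vec k))\<^sup>2 * \<delta>\<^sup>2 / 4)"
  have m: "- multiplier \<delta> \<beta> (real_vec k) = (norm (real_vec k))\<^sup>2 * ?F"
    using multiplier_eq_profile[OF assms(1)] by simp
  have pos: "0 < (norm (real_vec k))\<^sup>2 * ?F" if "k \<noteq> 0"
  proof -
    have "(norm (real_vec k))\<^sup>2 > 0" using norm_real_vec_sq_ge_1[OF that] by linarith
    moreover from this have "?F > 0"
      using assms by (intro profile_pos half_card) auto
    ultimately show ?thesis by simp
  qed
  then have nn: "0 \<le> (norm (real_vec k))\<^sup>2 * ?F" by (cases "k = 0") (auto intro: less_imp_le)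
  show "(freq \<delta> \<beta> k)\<^sup>2 = (norm (real_vec k))\<^sup>2 * ?F"
    using nn unfolding freq_def m by simp
  then show "multiplier \<delta> \<beta> (real_vec k) = - (freq \<delta> \<beta> k)\<^sup>2" using m by simp
  show "freq \<delta> \<beta> k = 0 \<longleftrightarrow> k = 0"
    using pos unfolding freq_def m by (cases "k = 0") auto
qed

text \<open>Nonzero lattice points have y >= delta^2/4, so linear growth of the profile from there
  on gives a squared frequency of at most C ||k||^4; the bound omega <= 1 + omega^2 avoids taking
  roots.\<close>

lemma poly_bounded_freq:
  assumes \<beta>: "\<beta> < real CARD('n::finite) + 4" and \<delta>: "\<delta> > 0"
  shows "poly_bounded (freq \<delta> \<beta> :: int^'n \<Rightarrow> real)"
proof (rule poly_boundedI)
  fix k :: "int^'n"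
  let ?F = "profile (real CARD('n) / 2) ((real CARD('n) + 2 - \<beta>) / 2)"
  let ?r = "(norm (real_vec k))\<^sup>2"
  define C where "C = max 1 (?F (\<delta>\<^sup>2 / 4))"
  show "norm (freq \<delta> \<beta> k) \<le> (1 + C) * weight k ^ 2"
  proof (cases "k = 0")
    case True
    then show ?thesis using freq_sq(3)[OF \<beta> \<delta>, of k] by (simp add: C_def)
  next
    case False
    have r: "1 \<le> ?r" by (rule norm_real_vec_sq_ge_1[OF False])
    have "?F (?r * \<delta>\<^sup>2 / 4) \<le> C * ((?r * \<delta>\<^sup>2 / 4) / (\<delta>\<^sup>2 / 4))"
      unfolding C_def using \<beta> \<delta> mult_right_mono[OF r, of "\<delta>\<^sup>2"] by (intro profile_le_linear half_card) auto
    then have F: "?F (?r * \<delta>\<^sup>2 / 4) \<le> C * ?r" using \<delta> by simp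
    have "norm (freq \<delta> \<beta> k) \<le> 1 + (freq \<delta> \<beta> k)\<^sup>2"
      using sum_squares_bound[of "\<bar>freq \<delta> \<beta> k\<bar>" 1] by simp
    also have "\<dots> \<le> 1 * weight k ^ 2 + ?r * (C * ?r)"
      unfolding freq_sq(1)[OF \<beta> \<delta>] using F weight_ge_1[of k] by (intro add_mono mult_left_mono) auto
    also have "\<dots> \<le> 1 * weight k ^ 2 + C * weight k ^ 2"
    proof -
      have "?r ^ 2 \<le> weight k ^ 2" by (intro power_mono) (auto simp: weight_def)
      then have "C * ?r ^ 2 \<le> C * weight k ^ 2" by (intro mult_left_mono) (auto simp: C_def)
      then show ?thesis by (simp add: power2_eq_square mult_ac)
    qed
    finally show ?thesis by (simp add: algebra_simps)
  qed
qed

lemma freq_sq_ge: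
  assumes \<beta>: "\<beta> < real CARD('n::finite) + 4" and \<delta>: "\<delta> > 0"
  obtains c where "c > 0"
    "\<And>k :: int^'n. k \<noteq> 0 \<Longrightarrow> c * weight k powr (max 0 ((\<beta> - real CARD('n)) / 2)) \<le> (freq \<delta> \<beta> k)\<^sup>2"
proof -
  let ?a = "(real CARD('n) + 2 - \<beta>) / 2"
  let ?F = "profile (real CARD('n) / 2) ?a"
  define \<theta> where "\<theta> = max 0 ((\<beta> - real CARD('n)) / 2)"
  have \<theta>: "\<theta> = max 0 (1 - ?a)" "\<theta> \<ge> 0" by (simp_all add: \<theta>_def field_simps)
  obtain c where c: "c > 0" "\<And>y. y \<ge> \<delta>\<^sup>2 / 4 \<Longrightarrow> c * y powr \<theta> \<le> y * ?F y"
    using profile_growth[OF half_card, of ?a "\<delta>\<^sup>2 / 4"] \<beta> \<delta> unfolding \<theta>(1) by auto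
  show ?thesis
  proof
    \<comment> \<open>As \<open>weight k\<close> is at most 2 ||k||^2, delta^2/8 times the weight is
      at most y; the divisor delta^2/4 turns y F(y) into the squared frequency.\<close>
    show "c * (\<delta>\<^sup>2 / 8) powr \<theta> / (\<delta>\<^sup>2 / 4) > 0" using c \<delta> by simp
    fix k :: "int^'n" assume k: "k \<noteq> 0"
    let ?r = "(norm (real_vec k))\<^sup>2"
    have r: "1 \<le> ?r" by (rule norm_real_vec_sq_ge_1[OF k])
    let ?y = "?r * \<delta>\<^sup>2 / 4"
    have "weight k \<le> 2 * ?r" using r by (simp add: weight_def)
    then have "\<delta>\<^sup>2 / 8 * weight k \<le> \<delta>\<^sup>2 / 8 * (2 * ?r)" by (intro mult_left_mono) auto
    then have w: "\<delta>\<^sup>2 / 8 * weight k \<le> ?y" by (simp add: mult_ac)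
    have "c * (\<delta>\<^sup>2 / 8) powr \<theta> * weight k powr \<theta> = c * (\<delta>\<^sup>2 / 8 * weight k) powr \<theta>"
      by (subst powr_mult) auto
    also have "\<dots> \<le> c * ?y powr \<theta>"
      using c(1) w \<theta>(2) by (intro mult_left_mono powr_mono2) auto
    also have "\<dots> \<le> ?y * ?F ?y"
      using mult_right_mono[OF r, of "\<delta>\<^sup>2"] by (intro c) auto
    also have "\<dots> = (\<delta>\<^sup>2 / 4) * (freq \<delta> \<beta> k)\<^sup>2" unfolding freq_sq(1)[OF \<beta> \<delta>] by simp
    finally show "c * (\<delta>\<^sup>2 / 8) powr \<theta> / (\<delta>\<^sup>2 / 4) * weight k powr max 0 ((\<beta> - real CARD('n)) / 2) \<le> (freq \<delta> \<beta> k)\<^sup>2"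
      using \<delta> unfolding \<theta>_def[symmetric] by (simp add: field_simps)
  qed
qed

section \<open>Frequencies as beta tends to n + 2\<close>

lemma order_param_tendsto:
  "filterlim (\<lambda>\<beta>. (c + 2 - \<beta>) / 2) (at 0) (at (c + 2 :: real))"
proof (rule filterlim_atI)
  have "((\<lambda>\<beta>. (c + 2 - \<beta>) / 2) \<longlongrightarrow> (c + 2 - (c + 2)) / 2) (at (c + 2))" by (intro tendsto_intros) auto
  then show "((\<lambda>\<beta>. (c + 2 - \<beta>) / 2) \<longlongrightarrow> 0) (at (c + 2))" by simp
  show "\<forall>\<^sub>F \<beta> in at (c + 2). (c + 2 - \<beta>) / 2 \<noteq> 0"
    unfolding eventually_at by (intro exI[of _ 1]) auto
qed

lemma eventually_order_lt: "\<forall>\<^sub>F \<beta> in at (c + 2 :: real). \<beta> < c + 4"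
  unfolding eventually_at by (intro exI[of _ 1]) (auto simp: dist_real_def)

lemma freq_tendsto:
  fixes k :: "int^'n::finite"
  assumes \<delta>: "\<delta> > 0"
  shows "((\<lambda>\<beta>. freq \<delta> \<beta> k) \<longlongrightarrow> norm (real_vec k)) (at (real CARD('n) + 2))"
proof -
  let ?y = "(norm (real_vec k))\<^sup>2 * \<delta>\<^sup>2 / 4" and ?a = "\<lambda>\<beta>. (real CARD('n) + 2 - \<beta>) / 2"
  have "((\<lambda>\<beta>. profile (real CARD('n) / 2) (?a \<beta>) ?y) \<longlongrightarrow> 1) (at (real CARD('n) + 2))"
    by (rule filterlim_compose[OF profile_tendsto_1 order_param_tendsto]) simp
  then have "((\<lambda>\<beta>. sqrt ((norm (real_vec k))\<^sup>2 * profile (real CARD('n) / 2) (?a \<beta>) ?y)) \<longlongrightarrow>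
      sqrt ((norm (real_vec k))\<^sup>2 * 1)) (at (real CARD('n) + 2))"
    by (intro tendsto_intros)
  moreover have "\<forall>\<^sub>F \<beta> in at (real CARD('n) + 2).
      sqrt ((norm (real_vec k))\<^sup>2 * profile (real CARD('n) / 2) (?a \<beta>) ?y) = freq \<delta> \<beta> k"
    using eventually_order_lt by eventually_elim (simp add: freq_def multiplier_eq_profile)
  ultimately show ?thesis by (auto elim: Lim_transform_eventually)
qed

text \<open>For a <= 0 the profile is at least 1. For 0 < a < epsilon/2 it is at least its value at
  delta^2/4, eventually above 1/2, times ||k||^(-2a), and 2a < epsilon. One factor 1/2 of the
  constant 1/4 is this one; the other comes from \<open>weight k\<close> being at most 2
  ||k||^2.\<close>

lemma freq_sq_ge_uniform:
  assumes \<delta>: "\<delta> > 0" and \<epsilon>: "0 < \<epsilon>" "\<epsilon> < 2"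
  shows "\<forall>\<^sub>F \<beta> in at (real CARD('n::finite) + 2). \<forall>k :: int^'n. k \<noteq> 0 \<longrightarrow>
    1 / 4 * weight k powr ((2 - \<epsilon>) / 2) \<le> (freq \<delta> \<beta> k)\<^sup>2"
proof -
  let ?b = "real CARD('n) / 2" and ?a = "\<lambda>\<beta>. (real CARD('n) + 2 - \<beta>) / 2"
  let ?x = "\<delta>\<^sup>2 / 4"
  have "((\<lambda>\<beta>. profile ?b (?a \<beta>) ?x) \<longlongrightarrow> 1) (at (real CARD('n) + 2))"
    by (rule filterlim_compose[OF profile_tendsto_1 order_param_tendsto]) simp
  then have "\<forall>\<^sub>F \<beta> in at (real CARD('n) + 2). profile ?b (?a \<beta>) ?x > 1 / 2"
    by (rule order_tendstoD) simp
  moreover have "(?a \<longlongrightarrow> 0) (at (real CARD('n) + 2))"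
    using order_param_tendsto by (simp add: filterlim_at)
  then have "\<forall>\<^sub>F \<beta> in at (real CARD('n) + 2). ?a \<beta> < \<epsilon> / 2"
    by (rule order_tendstoD) (use \<epsilon> in simp)
  ultimately show ?thesis using eventually_order_lt
  proof eventually_elim
    case (elim \<beta>)
    have a: "?a \<beta> > - 1" using elim(3) by simp
    show ?case
    proof (intro allI impI)
      fix k :: "int^'n" assume k: "k \<noteq> 0"
      let ?r = "(norm (real_vec k))\<^sup>2"
      have r: "1 \<le> ?r" by (rule norm_real_vec_sq_ge_1[OF k])
      let ?y = "?r * \<delta>\<^sup>2 / 4"
      have "0 < ?r" using r by linarith
      then have y: "?y > 0" "?x \<le> ?y" "?x > 0" using \<delta> mult_right_mono[OF r, of "\<delta>\<^sup>2"] by auto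
      have r1: "?r powr (- (\<epsilon> / 2)) \<le> 1" using powr_mono[of "- (\<epsilon> / 2)" 0 ?r] r \<epsilon> by (auto split: if_splits)
      have F: "1 / 2 * ?r powr (- (\<epsilon> / 2)) \<le> profile ?b (?a \<beta>) ?y"
      proof (cases "?a \<beta> \<le> 0")
        case True
        then have "1 \<le> profile ?b (?a \<beta>) ?y"
          using profile_gt_1[OF half_card a _ y(1)] profile_a_0[of ?b ?y] by (cases "?a \<beta> = 0") (auto intro: less_imp_le)
        then show ?thesis using r1 by linarith
      next
        case False
        have "1 / 2 * ?r powr (- (\<epsilon> / 2)) \<le> profile ?b (?a \<beta>) ?x * ?r powr (- ?a \<beta>)"
          using elim(1,2) r by (intro mult_mono powr_mono) auto
        also have "\<dots> \<le> profile ?b (?a \<beta>) ?y"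
        proof -
          have "?y / ?x = ?r" using \<delta> by simp
          moreover have "profile ?b (?a \<beta>) ?x * (?y / ?x) powr (- ?a \<beta>) \<le> profile ?b (?a \<beta>) ?y"
            using False by (intro profile_ge_powr half_card a y) auto
          ultimately show ?thesis by simp
        qed
        finally show ?thesis .
      qed
      have "(weight k / 2) powr ((2 - \<epsilon>) / 2) \<le> ?r powr ((2 - \<epsilon>) / 2)"
        using r \<epsilon> by (intro powr_mono2) (auto simp: weight_def)
      moreover have "weight k powr ((2 - \<epsilon>) / 2) / 2 \<le> (weight k / 2) powr ((2 - \<epsilon>) / 2)"
      proof -
        have "2 powr ((2 - \<epsilon>) / 2) \<le> 2 powr 1" using \<epsilon> by (intro powr_mono) auto
        then have "weight k powr ((2 - \<epsilon>) / 2) / 2 \<le> weight k powr ((2 - \<epsilon>) / 2) / 2 powr ((2 - \<epsilon>) / 2)"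
          by (intro divide_left_mono) auto
        then show ?thesis by (simp only: powr_divide)
      qed
      ultimately have "1 / 4 * weight k powr ((2 - \<epsilon>) / 2) \<le> 1 / 2 * ?r powr ((2 - \<epsilon>) / 2)" by linarith
      also have "(2 - \<epsilon>) / 2 = 1 + - (\<epsilon> / 2)" by (simp add: field_simps)
      also have "1 / 2 * ?r powr (1 + - (\<epsilon> / 2)) = ?r * (1 / 2 * ?r powr (- (\<epsilon> / 2)))"
        using r by (subst powr_add) simp
      also have "\<dots> \<le> ?r * profile ?b (?a \<beta>) ?y" by (intro mult_left_mono F) simp
      also have "\<dots> = (freq \<delta> \<beta> k)\<^sup>2" unfolding freq_sq(1)[OF elim(3) \<delta>] ..
      finally show "1 / 4 * weight k powr ((2 - \<epsilon>) / 2) \<le> (freq \<delta> \<beta> k)\<^sup>2" by (simp add: field_simps)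
    qed
  qed
qed

text \<open>The term 1/c covers the nonzero modes, and t^2 covers k = 0, where the weight is 1 and
  \<open>osc\<close> equals t.\<close>

lemma osc_sq_bound:
  assumes c: "c > 0" and z: "k = 0 \<longleftrightarrow> \<omega> k = 0" and le: "k \<noteq> 0 \<Longrightarrow> c * weight k powr \<theta> \<le> (\<omega> k)\<^sup>2"
  shows "(osc (\<omega> k) t)\<^sup>2 \<le> (1 / c + t\<^sup>2) * weight k powr - \<theta>"
proof (cases "k = 0")
  case True
  then show ?thesis using z c by (simp add: osc_def weight_def)
next
  case False
  have "(osc (\<omega> k) t)\<^sup>2 \<le> 1 / (\<omega> k)\<^sup>2" using False z by (intro osc_sq_le) simp
  also have "\<dots> \<le> 1 / (c * weight k powr \<theta>)"
    using le[OF False] c False z by (intro divide_left_mono mult_pos_pos) (auto simp: zero_less_mult_iff)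
  also have "\<dots> = 1 / c * weight k powr - \<theta>" by (simp add: powr_minus divide_inverse)
  also have "\<dots> \<le> (1 / c + t\<^sup>2) * weight k powr - \<theta>" by (intro mult_right_mono) auto
  finally show ?thesis .
qed

section \<open>Both waves as multiplier solutions, and the conclusion\<close>

lemma nonlocal_wave_eq:
  fixes f g :: "'n::finite pdist"
  assumes "\<beta> < real CARD('n) + 4" "\<delta> > 0"
  shows "nonlocal_wave \<delta> \<beta> f g t = fourier_series (wave_coeff (freq \<delta> \<beta>) (fourier_coeff f) (fourier_coeff g) t)"
  unfolding nonlocal_wave_def
proof (rule arg_cong[where f = fourier_series], rule ext)
  fix k :: "int^'n"
  show "(if k = 0 then fourier_coeff f 0 + fourier_coeff g 0 * of_real t
     else let \<omega> = sqrt (- multiplier \<delta> \<beta> (real_vec k)) in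
       fourier_coeff f k * of_real (cos (\<omega> * t)) +
       fourier_coeff g k / of_real \<omega> * of_real (sin (\<omega> * t))) =
     wave_coeff (freq \<delta> \<beta>) (fourier_coeff f) (fourier_coeff g) t k"
    using freq_sq(3)[OF assms, of k] unfolding freq_def[symmetric]
    by (auto simp: wave_coeff_def osc_def Let_def)
qed

lemma local_wave_eq:
  fixes f g :: "'n::finite pdist"
  shows "local_wave f g t = fourier_series (wave_coeff (\<lambda>k. norm (real_vec k)) (fourier_coeff f) (fourier_coeff g) t)"
  unfolding local_wave_def
proof (rule arg_cong[where f = fourier_series], rule ext)
  fix k :: "int^'n"
  show "(if k = 0 then fourier_coeff f 0 + fourier_coeff g 0 * of_real t
     else let \<omega> = norm (real_vec k) in
       fourier_coeff f k * of_real (cos (\<omega> * t)) +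
       fourier_coeff g k / of_real \<omega> * of_real (sin (\<omega> * t))) =
     wave_coeff (\<lambda>k. norm (real_vec k)) (fourier_coeff f) (fourier_coeff g) t k"
    using norm_real_vec_sq_ge_1[of k]
    by (auto simp: wave_coeff_def osc_def Let_def)
qed

text \<open>Two integrations by parts turn the Laplacian of the test function into the factor
  -||k||^2 on its pairings; T is then evaluated through its Fourier series.\<close>

lemma laplacian_eq_fourier_series:
  fixes T :: "'n::finite pdist"
  assumes T: "periodic_distribution T" and t: "test_function \<phi>"
  shows "laplacian T \<phi> = fourier_series (\<lambda>k. - of_real ((norm (real_vec k))\<^sup>2) * fourier_coeff T k) \<phi>"
proof -
  let ?L = "\<lambda>x. \<Sum>i\<in>UNIV. partial_deriv i (partial_deriv i \<phi>) x"
  have ti: "test_function (partial_deriv i \<phi>)" "test_function (partial_deriv i (partial_deriv i \<phi>))" for i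
    by (intro test_function_partial_deriv t)+
  have "pairing k ?L = - of_real ((norm (real_vec k))\<^sup>2) * pairing k \<phi>" for k
  proof -
    have "pairing k ?L = (\<Sum>i\<in>UNIV. - of_int (k $ i) * of_int (k $ i) * pairing k \<phi>)"
      unfolding pairing_sum[OF ti(2)] pairing_partial_deriv[OF ti(1)] pairing_partial_deriv[OF t]
      by (intro sum.cong) (auto simp: algebra_simps)
    also have "\<dots> = - of_real ((norm (real_vec k))\<^sup>2) * pairing k \<phi>"
      unfolding norm_real_vec_sq by (simp add: sum_distrib_right sum_negf power2_eq_square)
    finally show ?thesis .
  qed
  then have "fourier_series (fourier_coeff T) ?L =
      fourier_series (\<lambda>k. - of_real ((norm (real_vec k))\<^sup>2) * fourier_coeff T k) \<phi>"
    unfolding fourier_series_eq by (intro infsum_cong) simp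
  moreover have "fourier_series (fourier_coeff T) ?L = T ?L"
    by (intro fourier_series_fourier_coeff T test_function_sum ti)
  ultimately show ?thesis by (simp add: laplacian_def)
qed

lemma poly_bounded_norm_real_vec: "poly_bounded (\<lambda>k. norm (real_vec k))"
proof (rule poly_boundedI)
  show "norm (norm (real_vec k)) \<le> 1 * weight k ^ 1" for k
    using sum_squares_bound[of "norm (real_vec k)" 1] by (simp add: weight_def) (smt (verit) zero_le_power2 norm_ge_zero)
qed

theorem theorem9:
  fixes f g :: "'n::finite pdist" and \<delta> s1 s2 :: real
  assumes "\<delta> > 0"
    and "f \<in> sobolev_space s1"
    and "g \<in> sobolev_space s2"
  shows
    "(\<forall>\<beta> < real CARD('n) + 4.
        unique_wave_solution (nonlocal_laplacian \<delta> \<beta>) f g (nonlocal_wave \<delta> \<beta> f g) \<and>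
        (\<forall>t\<ge>0. nonlocal_wave \<delta> \<beta> f g t
                  \<in> sobolev_space (min s1 (s2 + max 0 ((\<beta> - real CARD('n)) / 2))))) \<and>
     unique_wave_solution laplacian f g (local_wave f g) \<and>
     (\<forall>t\<ge>0. local_wave f g t \<in> sobolev_space (min s1 (s2 + 1))) \<and>
     (\<forall>t\<ge>0. \<forall>\<epsilon>::real. 0 < \<epsilon> \<and> \<epsilon> < 2 \<and> \<epsilon> < real CARD('n) / 2 \<longrightarrow>
        tendsto_sobolev (min s1 (s2 + (2 - \<epsilon>) / 2))
          (\<lambda>\<beta>. nonlocal_wave \<delta> \<beta> f g t) (local_wave f g t) (at (real CARD('n) + 2)))"
proof -
  note \<delta> = assms(1) and f = assms(2) and g = assms(3)
  have pd: "periodic_distribution f" "periodic_distribution g"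
    using f g by (auto simp: sobolev_space_def)
  have local_sq: "1 / 2 * weight k powr 1 \<le> (norm (real_vec k))\<^sup>2" if "k \<noteq> 0" for k :: "int^'n"
    using norm_real_vec_sq_ge_1[OF that] by (simp add: weight_def)
  have local_0: "k = 0 \<longleftrightarrow> norm (real_vec k) = 0" for k :: "int^'n"
    using norm_real_vec_sq_ge_1[of k] by (cases "k = 0") auto
  have "unique_wave_solution (nonlocal_laplacian \<delta> \<beta>) f g (nonlocal_wave \<delta> \<beta> f g)"
    if \<beta>: "\<beta> < real CARD('n) + 4" for \<beta>
    unfolding nonlocal_wave_eq[OF \<beta> \<delta>, abs_def]
    by (intro unique_wave_solution_multiplier pd poly_bounded_freq \<beta> \<delta>)
      (simp add: nonlocal_laplacian_def freq_sq(2)[OF \<beta> \<delta>])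
  moreover have "nonlocal_wave \<delta> \<beta> f g t \<in> sobolev_space (min s1 (s2 + max 0 ((\<beta> - real CARD('n)) / 2)))"
    if \<beta>: "\<beta> < real CARD('n) + 4" for \<beta> t
  proof -
    obtain c where c: "c > 0" "\<And>k :: int^'n. k \<noteq> 0 \<Longrightarrow>
        c * weight k powr (max 0 ((\<beta> - real CARD('n)) / 2)) \<le> (freq \<delta> \<beta> k)\<^sup>2"
      using freq_sq_ge[OF \<beta> \<delta>] by metis
    have "(osc (freq \<delta> \<beta> k) t)\<^sup>2 \<le> (1 / c + t\<^sup>2) * weight k powr - max 0 ((\<beta> - real CARD('n)) / 2)"
      for k :: "int^'n"
      using freq_sq(3)[OF \<beta> \<delta>, of k] by (intro osc_sq_bound c) auto
    then show ?thesis
      unfolding nonlocal_wave_eq[OF \<beta> \<delta>] using c(1)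
      by (intro wave_in_sobolev_space[OF f g, where K = "1 / c + t\<^sup>2"]) auto
  qed
  moreover have "unique_wave_solution laplacian f g (local_wave f g)"
    unfolding local_wave_eq[abs_def]
    by (intro unique_wave_solution_multiplier pd poly_bounded_norm_real_vec laplacian_eq_fourier_series)
  moreover have "local_wave f g t \<in> sobolev_space (min s1 (s2 + 1))" for t
  proof -
    have "(osc (norm (real_vec k)) t)\<^sup>2 \<le> (1 / (1 / 2) + t\<^sup>2) * weight k powr - 1" for k :: "int^'n"
      by (rule osc_sq_bound[where \<omega> = "\<lambda>k. norm (real_vec k)", OF _ local_0 local_sq]) auto
    then show ?thesis
      unfolding local_wave_eq
      by (intro wave_in_sobolev_space[OF f g, where K = "1 / (1 / 2) + t\<^sup>2" and \<theta> = 1]) auto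
  qed
  moreover have "tendsto_sobolev (min s1 (s2 + (2 - \<epsilon>) / 2))
      (\<lambda>\<beta>. nonlocal_wave \<delta> \<beta> f g t) (local_wave f g t) (at (real CARD('n) + 2))"
    if \<epsilon>: "0 < \<epsilon>" "\<epsilon> < 2" for t \<epsilon>
  proof -
    let ?\<F> = "at (real CARD('n) + 2)"
    let ?w = "\<lambda>\<omega>. fourier_series (wave_coeff \<omega> (fourier_coeff f) (fourier_coeff g) t)"
    \<comment> \<open>The constant and the exponent are independent of beta, and the same pair has
      to bound the limit wave, whose own exponent 1 is weakened accordingly.\<close>
    have "\<forall>\<^sub>F \<beta> in ?\<F>. \<forall>k :: int^'n. (osc (freq \<delta> \<beta> k) t)\<^sup>2 \<le> (1 / (1 / 4) + t\<^sup>2) * weight k powr - ((2 - \<epsilon>) / 2)"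
      using freq_sq_ge_uniform[OF \<delta> \<epsilon>] eventually_order_lt
    proof eventually_elim
      case (elim \<beta>)
      then show ?case using freq_sq(3)[OF elim(2) \<delta>] by (intro allI osc_sq_bound) auto
    qed
    moreover have "(osc (norm (real_vec k)) t)\<^sup>2 \<le> (1 / (1 / 4) + t\<^sup>2) * weight k powr - ((2 - \<epsilon>) / 2)" for k :: "int^'n"
    proof (rule osc_sq_bound[where \<omega> = "\<lambda>k. norm (real_vec k)", OF _ local_0])
      assume k: "k \<noteq> 0"
      have "weight k powr ((2 - \<epsilon>) / 2) \<le> weight k powr 1"
        using \<epsilon> weight_ge_1[of k] by (intro powr_mono) auto
      moreover have "0 \<le> (norm (real_vec k))\<^sup>2" by (rule zero_le_power2)
      ultimately show "1 / 4 * weight k powr ((2 - \<epsilon>) / 2) \<le> (norm (real_vec k))\<^sup>2"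
        using local_sq[OF k] by linarith
    qed simp
    moreover have "((\<lambda>\<beta>. osc (freq \<delta> \<beta> k) t) \<longlongrightarrow> osc (norm (real_vec k)) t) ?\<F>" for k :: "int^'n"
    proof (cases "k = 0")
      \<comment> \<open>The frequency is 0 for every beta < n + 4, so \<open>osc\<close> equals t
        throughout and is not given by the quotient.\<close>
      case True
      have "\<forall>\<^sub>F \<beta> in ?\<F>. osc (norm (real_vec k)) t = osc (freq \<delta> \<beta> k) t"
        using eventually_order_lt by eventually_elim (use freq_sq(3)[OF _ \<delta>, of _ k] True in simp)
      then show ?thesis by (rule Lim_transform_eventually[OF tendsto_const])
    next
      case False
      then have "norm (real_vec k) \<noteq> 0" using local_0 by blast
      then have "((\<lambda>\<beta>. sin (freq \<delta> \<beta> k * t) / freq \<delta> \<beta> k) \<longlongrightarrow> osc (norm (real_vec k)) t) ?\<F>"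
        unfolding osc_def by (auto intro!: tendsto_intros freq_tendsto \<delta>)
      moreover have "\<forall>\<^sub>F \<beta> in ?\<F>. sin (freq \<delta> \<beta> k * t) / freq \<delta> \<beta> k = osc (freq \<delta> \<beta> k) t"
        using eventually_order_lt by eventually_elim (use freq_sq(3)[OF _ \<delta>, of _ k] False in \<open>simp add: osc_def\<close>)
      ultimately show ?thesis by (rule Lim_transform_eventually)
    qed
    ultimately have *: "tendsto_sobolev (min s1 (s2 + (2 - \<epsilon>) / 2)) (\<lambda>\<beta>. ?w (freq \<delta> \<beta>)) (?w (\<lambda>k. norm (real_vec k))) ?\<F>"
      by (intro tendsto_sobolev_wave[OF f g]) (auto intro: freq_tendsto \<delta>)
    \<comment> \<open>The two expressions are known to agree for beta < n + 4, which holds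
      eventually near n + 2; the convergence is transferred along this.\<close>
    have ev: "\<forall>\<^sub>F \<beta> in ?\<F>. ?w (freq \<delta> \<beta>) = nonlocal_wave \<delta> \<beta> f g t"
      using eventually_order_lt by eventually_elim (simp add: nonlocal_wave_eq \<delta>)
    have "\<forall>\<^sub>F \<beta> in ?\<F>. nonlocal_wave \<delta> \<beta> f g t \<in> sobolev_space (min s1 (s2 + (2 - \<epsilon>) / 2))"
      using * ev unfolding tendsto_sobolev_def by (auto elim: eventually_elim2)
    moreover have "((\<lambda>\<beta>. sobolev_norm (min s1 (s2 + (2 - \<epsilon>) / 2)) (\<lambda>\<phi>. nonlocal_wave \<delta> \<beta> f g t \<phi> - local_wave f g t \<phi>)) \<longlongrightarrow> 0) ?\<F>"
    proof (rule Lim_transform_eventually)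
      show "((\<lambda>\<beta>. sobolev_norm (min s1 (s2 + (2 - \<epsilon>) / 2)) (\<lambda>\<phi>. ?w (freq \<delta> \<beta>) \<phi> - local_wave f g t \<phi>)) \<longlongrightarrow> 0) ?\<F>"
        using * unfolding tendsto_sobolev_def local_wave_eq by blast
    qed (use ev in eventually_elim, simp)
    ultimately show ?thesis
      using * unfolding tendsto_sobolev_def local_wave_eq by blast
  qed
  ultimately show ?thesis by blast
qed

end
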